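(* Let $J$ be a nonselfadjoint Jacobi operator in $l_2(\mathbb{N})$, let $\tilde J$ be a canonical selfadjoint extension of $J$ with spectral measure $E$, and let $\mu(\cdot)=\langle\delta_1,E(\cdot)\delta_1\rangle$, where $\delta_1$ is the first canonical basis vector. For $n\in\mathbb{N}$ and Borel sets $\partial\subset\mathbb{R}$ put $$\nu_n(\partial):=\frac1{C_n}\int_\partial(1+x^2)^{-n}d\mu(x),\qquad C_n:=\int_{\mathbb{R}}(1+x^2)^{-n}d\mu(x).$$ (i) For every $n\in\mathbb{N}$, the index of determinacy of $\nu_n$ is $\operatorname{ind}\nu_n=n$. (ii) (Case $n=1$.) Let $\{R_{k-1}\}_{k=1}^\infty$ be the orthonormal sequence of polynomials in $L_2(\mathbb{R},\nu_1)$ obtained from the monomials by the Gram-Schmidt procedure, and let $f_{k-1}(t):=\frac{1}{\sqrt{C_1}\,(t-i)}R_{k-1}(t)$ and $\omega_k:=Uf_{k-1}$ for $k\in\mathbb{N}$. Then $\{\omega_k\}_{k=1}^\infty$ is a basis of representation for $\tilde J$, and the corresponding matrix representation of $\tilde J$ is the Jacobi matrix formed by the coefficients of the three-term recurrence relation satisfied by $\{R_{k-1}\}_{k=1}^\infty$. (iii) For any $n\in\mathbb{N}$, by using $\nu_n$ and modifying accordingly the definition of the functions $f_{k-1}$ in (ii), one can construct a basis of representation for $\tilde J$ such that the corresponding matrix representation of $\tilde J$ is a Jacobi matrix.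
   Context: Hilbert spaces are complex; inner products are antilinear in the first argument; $\mathbb{N}=\{1,2,\dots\}$. Jacobi matrix: a semi-infinite tridiagonal matrix with real diagonal entries $q_1,q_2,\dots$ and positive entries $b_1,b_2,\dots$ on both the sub- and superdiagonal, all other entries being zero. The associated Jacobi operator $J$ is the closure in $l_2(\mathbb{N})$ of the operator defined on finitely supported sequences by $(J_0\phi)_1=q_1\phi_1+b_1\phi_2$, $(J_0\phi)_k=b_{k-1}\phi_{k-1}+q_k\phi_k+b_k\phi_{k+1}$ for $k\ge2$. $\{\delta_k\}_{k=1}^\infty$ is the canonical basis of $l_2(\mathbb{N})$. A canonical selfadjoint extension of a symmetric operator is a selfadjoint restriction of its adjoint. Basis of representation (also called basis of matrix representation): an orthonormal basis $\{u_k\}_{k=1}^\infty$ of a Hilbert space is a basis of representation for a closed operator $A$ if (a) $u_k\in\operatorname{dom}A$ for all $k$, and (b) every closed operator $B$ with $Bu_k=Au_k$ for all $k$ satisfies $B\supset A$. Then the matrix with entries $a_{kj}=\langle u_k,Au_j\rangle$ is the matrix representation of $A$ with respect to $\{u_k\}$. Index of determinacy: for a solution $\nu$ (with infinite support) to a Hamburger moment problem, let $\nu^{(m)}(\partial):=\int_\partial(1+x^2)^m d\nu(x)$ and $$\operatorname{ind}\nu:=\sup\{m\in\mathbb{N}:\text{the polynomials are dense in }L_2(\mathbb{R},\nu^{(m)})\}\in\mathbb{N}\cup\{\infty\}.$$ The index makes sense only for solutions to determinate moment problems (those with exactly one solution). The Gram-Schmidt procedure is normalized so that the $k$-th orthonormal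 polynomial has degree $k$ and positive leading coefficient. The map $U$: with $\{P_{k-1}\}_{k=1}^\infty$ the orthonormal polynomials obtained from the monomials by the Gram-Schmidt procedure in $L_2(\mathbb{R},\mu)$ (they form an orthonormal basis, since the polynomials are dense in $L_2(\mathbb{R},\mu)$), $U:L_2(\mathbb{R},\mu)\to l_2(\mathbb{N})$ is the isometric isomorphism with $UP_{k-1}=\delta_k$ for $k\in\mathbb{N}$. Three-term recurrence: the orthonormal polynomials $R_0,R_1,\dots$ satisfy $tR_0=q_1R_0+b_1R_1$ and $tR_k=b_kR_{k-1}+q_{k+1}R_k+b_{k+1}R_{k+1}$ for $k\ge1$; the numbers $q_k$ and $b_k$ form the corresponding Jacobi matrix. *)

theory Defs
  imports "HOL-Analysis.Analysis" "HOL-Computational_Algebra.Polynomial"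
begin

text \<open>
  Indexing: everything indexed by \<open>1, 2, \<dots>\<close> in the mathematics (sequences in \<open>l\<^sub>2\<close>, basis
  vectors, Jacobi parameters \<open>q\<^sub>k\<close>, \<open>b\<^sub>k\<close>) is indexed by \<^typ>\<open>nat\<close> starting from \<open>0\<close> here.
  Orthonormal polynomials keep their index, which is their degree.
\<close>

section \<open>The Hilbert space of square-summable complex sequences\<close>

typedef ell2 = "{x :: nat \<Rightarrow> complex. summable (\<lambda>k. (cmod (x k))\<^sup>2)}"
  morphisms coord Abs_ell2
  by (rule exI[of _ "\<lambda>_. 0"]) simp

setup_lifting type_definition_ell2

lemma ell2_eqI: "(\<And>k. coord x k = coord y k) \<Longrightarrow> x = y"
  by (simp add: coord_inject[symmetric] fun_eq_iff)

lemma summable_coord_sq: "summable (\<lambda>k. (cmod (coord x k))\<^sup>2)"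
  using coord[of x] by simp

lemma summable_norm_cinner:
  "summable (\<lambda>k. cmod (cnj (coord x k) * coord y k))"
proof (rule summable_comparison_test')
  show "summable (\<lambda>k. (cmod (coord x k))\<^sup>2 + (cmod (coord y k))\<^sup>2)"
    by (intro summable_add summable_coord_sq)
  fix k :: nat
  let ?a = "cmod (coord x k)" and ?b = "cmod (coord y k)"
  have "2 * (?a * ?b) \<le> ?a\<^sup>2 + ?b\<^sup>2"
    using sum_squares_bound[of ?a ?b] by simp
  moreover have "0 \<le> ?a * ?b" by simp
  ultimately have "?a * ?b \<le> ?a\<^sup>2 + ?b\<^sup>2" by linarith
  then show "norm (cmod (cnj (coord x k) * coord y k)) \<le> ?a\<^sup>2 + ?b\<^sup>2"
    by (simp add: norm_mult)
qed

lemma summable_cinner: "summable (\<lambda>k. cnj (coord x k) * coord y k)"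
  by (rule summable_norm_cancel[OF summable_norm_cinner])

lift_definition scaleC :: "complex \<Rightarrow> ell2 \<Rightarrow> ell2" (infixr "*\<^sub>C" 75)
  is "\<lambda>c x k. c * x k"
  by (simp add: norm_mult power_mult_distrib summable_mult)

definition cinner :: "ell2 \<Rightarrow> ell2 \<Rightarrow> complex" where
  "cinner x y = (\<Sum>k. cnj (coord x k) * coord y k)"

lemma summable_cmod_add:
  fixes x y :: "nat \<Rightarrow> complex"
  assumes "summable (\<lambda>k. (cmod (x k))\<^sup>2)" "summable (\<lambda>k. (cmod (y k))\<^sup>2)"
  shows "summable (\<lambda>k. (cmod (x k + y k))\<^sup>2)"
proof (rule summable_comparison_test')
  show "summable (\<lambda>k. 2 * (cmod (x k))\<^sup>2 + 2 * (cmod (y k))\<^sup>2)"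
    by (intro summable_add summable_mult assms)
  fix k :: nat
  let ?a = "cmod (x k)" and ?b = "cmod (y k)"
  have "(cmod (x k + y k))\<^sup>2 \<le> (?a + ?b)\<^sup>2"
    by (intro power_mono norm_triangle_ineq) simp
  also have "\<dots> = ?a\<^sup>2 + ?b\<^sup>2 + 2 * ?a * ?b"
    by (simp add: power2_sum)
  also have "\<dots> \<le> 2 * ?a\<^sup>2 + 2 * ?b\<^sup>2"
    using sum_squares_bound[of ?a ?b] by linarith
  finally show "norm ((cmod (x k + y k))\<^sup>2) \<le> 2 * ?a\<^sup>2 + 2 * ?b\<^sup>2" by simp
qed

instantiation ell2 :: real_inner
begin

lift_definition zero_ell2 :: ell2 is "\<lambda>_. 0" by simp

lift_definition plus_ell2 :: "ell2 \<Rightarrow> ell2 \<Rightarrow> ell2" is "\<lambda>x y k. x k + y k"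
  by (rule summable_cmod_add)

lift_definition uminus_ell2 :: "ell2 \<Rightarrow> ell2" is "\<lambda>x k. - x k" by simp

definition minus_ell2 :: "ell2 \<Rightarrow> ell2 \<Rightarrow> ell2" where "x - y = x + - (y :: ell2)"

definition scaleR_ell2 :: "real \<Rightarrow> ell2 \<Rightarrow> ell2" where
  "r *\<^sub>R x = complex_of_real r *\<^sub>C x"

definition inner_ell2 :: "ell2 \<Rightarrow> ell2 \<Rightarrow> real" where
  "x \<bullet> y = Re (cinner x y)"

definition norm_ell2 :: "ell2 \<Rightarrow> real" where "norm x = sqrt (x \<bullet> (x :: ell2))"

definition sgn_ell2 :: "ell2 \<Rightarrow> ell2" where "sgn x = inverse (norm x) *\<^sub>R (x :: ell2)"

definition dist_ell2 :: "ell2 \<Rightarrow> ell2 \<Rightarrow> real" where "dist x y = norm (x - y :: ell2)"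

definition uniformity_ell2 :: "(ell2 \<times> ell2) filter" where
  "uniformity_ell2 = (INF e\<in>{0<..}. principal {(x, y). dist x (y :: ell2) < e})"

definition open_ell2 :: "ell2 set \<Rightarrow> bool" where
  "open_ell2 S \<longleftrightarrow> (\<forall>x\<in>S. \<forall>\<^sub>F (x', y) in uniformity. x' = x \<longrightarrow> y \<in> S)"

instance
proof
  fix x y z :: ell2 and r s :: real and S :: "ell2 set"
  show "x + y + z = x + (y + z)" by transfer (simp add: add.assoc)
  show "x + y = y + x" by transfer (simp add: add.commute)
  show "0 + x = x" by transfer simp
  show "- x + x = 0" by transfer simp
  show "x - y = x + - y" by (rule minus_ell2_def)
  show "r *\<^sub>R (x + y) = r *\<^sub>R x + r *\<^sub>R y"
    unfolding scaleR_ell2_def by transfer (simp add: distrib_left)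
  show "(r + s) *\<^sub>R x = r *\<^sub>R x + s *\<^sub>R x"
    unfolding scaleR_ell2_def by transfer (simp add: distrib_right)
  show "r *\<^sub>R s *\<^sub>R x = (r * s) *\<^sub>R x"
    unfolding scaleR_ell2_def by transfer (simp add: mult.assoc)
  show "1 *\<^sub>R x = x"
    unfolding scaleR_ell2_def by transfer simp
  show "dist x y = norm (x - y)" by (rule dist_ell2_def)
  show "sgn x = inverse (norm x) *\<^sub>R x" by (rule sgn_ell2_def)
  show "uniformity = (INF e\<in>{0<..}. principal {(x, y). dist x (y :: ell2) < e})"
    by (rule uniformity_ell2_def)
  show "open S = (\<forall>x\<in>S. \<forall>\<^sub>F (x', y) in uniformity. x' = x \<longrightarrow> y \<in> S)"
    by (rule open_ell2_def)
  show "norm x = sqrt (x \<bullet> x)" by (rule norm_ell2_def)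
  have inner_alt: "u \<bullet> v = (\<Sum>k. Re (cnj (coord u k) * coord v k))" for u v :: ell2
    unfolding inner_ell2_def cinner_def by (rule Re_suminf[OF summable_cinner])
  have summ: "summable (\<lambda>k. Re (cnj (coord u k) * coord v k))" for u v :: ell2
    by (rule summable_Re[OF summable_cinner])
  show "x \<bullet> y = y \<bullet> x"
    unfolding inner_alt by (intro suminf_cong) (simp add: mult.commute)
  show "(x + y) \<bullet> z = x \<bullet> z + y \<bullet> z"
    unfolding inner_alt suminf_add[OF summ summ]
    by (intro suminf_cong) (simp add: plus_ell2.rep_eq algebra_simps)
  show "(r *\<^sub>R x) \<bullet> y = r * (x \<bullet> y)"
    unfolding inner_alt suminf_mult[OF summ, symmetric]
    by (intro suminf_cong) (simp add: scaleR_ell2_def scaleC.rep_eq algebra_simps)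
  have sq: "Re (cnj (coord x k) * coord x k) = (cmod (coord x k))\<^sup>2" for k
    unfolding cmod_power2 by (simp add: power2_eq_square)
  show "0 \<le> x \<bullet> x"
    unfolding inner_alt sq by (intro suminf_nonneg summable_coord_sq) simp
  have "x \<bullet> x = 0 \<longleftrightarrow> (\<forall>k. coord x k = 0)"
    unfolding inner_alt sq by (subst suminf_eq_zero_iff[OF summable_coord_sq]) auto
  also have "\<dots> \<longleftrightarrow> x = 0"
    by (auto intro: ell2_eqI simp: zero_ell2.rep_eq)
  finally show "x \<bullet> x = 0 \<longleftrightarrow> x = 0" .
qed

end

lift_definition delta :: "nat \<Rightarrow> ell2" is "\<lambda>n k. if k = n then 1 else 0"
proof -
  fix n :: nat
  show "summable (\<lambda>k. (cmod (if k = n then 1 else 0 :: complex))\<^sup>2)"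
    by (rule summable_finite[of "{n}"]) auto
qed

definition cspan_seq :: "(nat \<Rightarrow> ell2) \<Rightarrow> ell2 set" where
  "cspan_seq u = {\<Sum>k<n. c k *\<^sub>C u k | n c. True}"

definition orthonormal_basis :: "(nat \<Rightarrow> ell2) \<Rightarrow> bool" where
  "orthonormal_basis u \<longleftrightarrow>
     (\<forall>j k. cinner (u j) (u k) = (if j = k then 1 else 0)) \<and> closure (cspan_seq u) = UNIV"


section \<open>Unbounded operators\<close>

text \<open>Operators are identified with their graphs; extension is inclusion of graphs.\<close>

type_synonym operator = "(ell2 \<times> ell2) set"

definition linear_operator :: "operator \<Rightarrow> bool" where
  "linear_operator T \<longleftrightarrow>
     (0, 0) \<in> T \<and>
     (\<forall>x y x' y'. (x, y) \<in> T \<longrightarrow> (x', y') \<in> T \<longrightarrow> (x + x', y + y') \<in> T) \<and>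
     (\<forall>c x y. (x, y) \<in> T \<longrightarrow> (c *\<^sub>C x, c *\<^sub>C y) \<in> T) \<and>
     single_valued T"

definition closed_operator :: "operator \<Rightarrow> bool" where
  "closed_operator T \<longleftrightarrow> linear_operator T \<and> closed T"

definition op_app :: "operator \<Rightarrow> ell2 \<Rightarrow> ell2" where
  "op_app T x = (THE y. (x, y) \<in> T)"

definition adjoint_op :: "operator \<Rightarrow> operator" where
  "adjoint_op T = {(y, z). \<forall>(x, w)\<in>T. cinner y w = cinner z x}"

definition selfadjoint :: "operator \<Rightarrow> bool" where
  "selfadjoint T \<longleftrightarrow> linear_operator T \<and> closure (Domain T) = UNIV \<and> adjoint_op T = T"

definition canonical_selfadjoint_extension :: "operator \<Rightarrow> operator \<Rightarrow> bool" where
  "canonical_selfadjoint_extension T S \<longleftrightarrow> selfadjoint S \<and> S \<subseteq> adjoint_op T"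

definition basis_of_representation :: "operator \<Rightarrow> (nat \<Rightarrow> ell2) \<Rightarrow> bool" where
  "basis_of_representation A u \<longleftrightarrow>
     closed_operator A \<and> orthonormal_basis u \<and>
     (\<forall>k. u k \<in> Domain A) \<and>
     (\<forall>B. closed_operator B \<longrightarrow>
          (\<forall>k. u k \<in> Domain B \<and> op_app B (u k) = op_app A (u k)) \<longrightarrow> A \<subseteq> B)"

definition matrix_representation :: "operator \<Rightarrow> (nat \<Rightarrow> ell2) \<Rightarrow> nat \<Rightarrow> nat \<Rightarrow> complex" where
  "matrix_representation A u k j = cinner (u k) (op_app A (u j))"


section \<open>Jacobi matrices and operators\<close>

definition jacobi_matrix :: "(nat \<Rightarrow> real) \<Rightarrow> (nat \<Rightarrow> real) \<Rightarrow> nat \<Rightarrow> nat \<Rightarrow> complex" where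
  "jacobi_matrix q b i j =
     (if i = j then of_real (q i)
      else if j = Suc i then of_real (b i)
      else if i = Suc j then of_real (b j)
      else 0)"

definition jacobi_op0 :: "(nat \<Rightarrow> real) \<Rightarrow> (nat \<Rightarrow> real) \<Rightarrow> operator" where
  "jacobi_op0 q b =
     {(\<phi>, \<psi>). finite {k. coord \<phi> k \<noteq> 0} \<and>
        coord \<psi> 0 = of_real (q 0) * coord \<phi> 0 + of_real (b 0) * coord \<phi> 1 \<and>
        (\<forall>k\<ge>1. coord \<psi> k = of_real (b (k - 1)) * coord \<phi> (k - 1)
                     + of_real (q k) * coord \<phi> k + of_real (b k) * coord \<phi> (k + 1))}"

definition jacobi_op :: "(nat \<Rightarrow> real) \<Rightarrow> (nat \<Rightarrow> real) \<Rightarrow> operator" where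
  "jacobi_op q b = closure (jacobi_op0 q b)"


section \<open>Spectral measures\<close>

definition orthogonal_projection :: "(ell2 \<Rightarrow> ell2) \<Rightarrow> bool" where
  "orthogonal_projection P \<longleftrightarrow>
     (\<forall>x y. P (x + y) = P x + P y) \<and> (\<forall>c x. P (c *\<^sub>C x) = c *\<^sub>C P x) \<and>
     (\<forall>x. P (P x) = P x) \<and> (\<forall>x y. cinner (P x) y = cinner x (P y))"

definition projection_valued_measure :: "(real set \<Rightarrow> ell2 \<Rightarrow> ell2) \<Rightarrow> bool" where
  "projection_valued_measure E \<longleftrightarrow>
     (\<forall>S\<in>sets borel. orthogonal_projection (E S)) \<and>
     (\<forall>x. E UNIV x = x) \<and>
     (\<forall>A :: nat \<Rightarrow> real set. range A \<subseteq> sets borel \<longrightarrow> disjoint_family A \<longrightarrow>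
        (\<forall>x. (\<lambda>n. E (A n) x) sums E (\<Union>n. A n) x))"

definition scalar_measure :: "(real set \<Rightarrow> ell2 \<Rightarrow> ell2) \<Rightarrow> ell2 \<Rightarrow> real measure" where
  "scalar_measure E x = measure_of UNIV (sets borel) (\<lambda>S. ennreal (Re (cinner x (E S x))))"

text \<open>
  \<open>A = \<integral> t dE(t)\<close>: the domain consists of the \<open>x\<close> with \<open>\<integral> t\<^sup>2 d\<langle>x, E x\<rangle> < \<infinity>\<close>, and
  \<open>\<langle>x, A x\<rangle> = \<integral> t d\<langle>x, E x\<rangle>\<close> there, which fixes \<open>A\<close> by polarization.
\<close>

definition is_spectral_measure :: "operator \<Rightarrow> (real set \<Rightarrow> ell2 \<Rightarrow> ell2) \<Rightarrow> bool" where
  "is_spectral_measure A E \<longleftrightarrow>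
     projection_valued_measure E \<and>
     Domain A = {x. integrable (scalar_measure E x) (\<lambda>t. t\<^sup>2)} \<and>
     (\<forall>(x, y)\<in>A. cinner x y = of_real (\<integral>t. t \<partial>scalar_measure E x))"


section \<open>Moment problems and orthogonal polynomials\<close>

definition L2_space :: "real measure \<Rightarrow> (real \<Rightarrow> complex) set" where
  "L2_space M = {f \<in> borel_measurable M. integrable M (\<lambda>t. (cmod (f t))\<^sup>2)}"

definition polynomials_dense :: "real measure \<Rightarrow> bool" where
  "polynomials_dense M \<longleftrightarrow>
     (\<forall>p :: complex poly. (\<lambda>t. poly p (of_real t)) \<in> L2_space M) \<and>
     (\<forall>f\<in>L2_space M. \<forall>\<epsilon>>0. \<exists>p :: complex poly.
        sqrt (\<integral>t. (cmod (f t - poly p (of_real t)))\<^sup>2 \<partial>M) < \<epsilon>)"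

definition hamburger_solution :: "real measure \<Rightarrow> bool" where
  "hamburger_solution \<nu> \<longleftrightarrow> sets \<nu> = sets borel \<and> (\<forall>k. integrable \<nu> (\<lambda>t. t ^ k))"

definition determinate :: "real measure \<Rightarrow> bool" where
  "determinate \<nu> \<longleftrightarrow> hamburger_solution \<nu> \<and>
     (\<forall>\<sigma>. hamburger_solution \<sigma> \<longrightarrow>
        (\<forall>k. (\<integral>t. t ^ k \<partial>\<sigma>) = (\<integral>t. t ^ k \<partial>\<nu>)) \<longrightarrow> \<sigma> = \<nu>)"

definition measure_support :: "real measure \<Rightarrow> real set" where
  "measure_support \<nu> = {t. \<forall>\<epsilon>>0. emeasure \<nu> (ball t \<epsilon>) > 0}"

text \<open>The number \<open>ind \<nu>\<close>; the index is meaningful for \<^const>\<open>determinate\<close> measures with infinite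
  \<^const>\<open>measure_support\<close>.\<close>

definition ind :: "real measure \<Rightarrow> enat" where
  "ind \<nu> = Sup (enat ` {m. m \<ge> 1 \<and>
     polynomials_dense (density \<nu> (\<lambda>t. ennreal ((1 + t\<^sup>2) ^ m)))})"

definition poly_inner :: "real measure \<Rightarrow> real poly \<Rightarrow> real poly \<Rightarrow> real" where
  "poly_inner M p r = (\<integral>t. poly p t * poly r t \<partial>M)"

text \<open>Gram--Schmidt applied to \<open>1, t, t\<^sup>2, \<dots>\<close>. All coefficients are real, so real polynomials suffice.\<close>

fun gram_schmidt :: "real measure \<Rightarrow> nat \<Rightarrow> real poly" where
  "gram_schmidt M k =
     (let p = monom 1 k - (\<Sum>j<k. smult (poly_inner M (gram_schmidt M j) (monom 1 k)) (gram_schmidt M j))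
      in smult (1 / sqrt (poly_inner M p p)) p)"

declare gram_schmidt.simps [simp del]

definition three_term_recurrence ::
  "(nat \<Rightarrow> real poly) \<Rightarrow> (nat \<Rightarrow> real) \<Rightarrow> (nat \<Rightarrow> real) \<Rightarrow> bool" where
  "three_term_recurrence R q b \<longleftrightarrow>
     [:0, 1:] * R 0 = smult (q 0) (R 0) + smult (b 0) (R 1) \<and>
     (\<forall>k\<ge>1. [:0, 1:] * R k =
        smult (b (k - 1)) (R (k - 1)) + smult (q k) (R k) + smult (b k) (R (k + 1)))"


section \<open>The measures \<open>\<nu>\<^sub>n\<close>, the map \<open>U\<close> and the vectors \<open>\<omega>\<^sub>k\<close>\<close>

definition C_const :: "real measure \<Rightarrow> nat \<Rightarrow> real" where
  "C_const \<mu> n = (\<integral>t. 1 / (1 + t\<^sup>2) ^ n \<partial>\<mu>)"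

definition nu :: "real measure \<Rightarrow> nat \<Rightarrow> real measure" where
  "nu \<mu> n = density \<mu> (\<lambda>t. ennreal (1 / C_const \<mu> n * (1 / (1 + t\<^sup>2) ^ n)))"

text \<open>
  Isometric isomorphisms \<open>L\<^sub>2(\<real>, \<mu>) \<rightarrow> l\<^sub>2\<close>, acting on representatives: the isometry condition forces
  \<open>U\<close> to agree on functions equal almost everywhere. Values outside \<^const>\<open>L2_space\<close> are irrelevant.
\<close>

definition isometric_isomorphism :: "real measure \<Rightarrow> ((real \<Rightarrow> complex) \<Rightarrow> ell2) \<Rightarrow> bool" where
  "isometric_isomorphism \<mu> U \<longleftrightarrow>
     (\<forall>f\<in>L2_space \<mu>. \<forall>g\<in>L2_space \<mu>. U (\<lambda>t. f t + g t) = U f + U g) \<and>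
     (\<forall>c. \<forall>f\<in>L2_space \<mu>. U (\<lambda>t. c * f t) = c *\<^sub>C U f) \<and>
     (\<forall>f\<in>L2_space \<mu>. norm (U f) = sqrt (\<integral>t. (cmod (f t))\<^sup>2 \<partial>\<mu>)) \<and>
     U ` L2_space \<mu> = UNIV"

text \<open>The properties below determine \<open>U\<close> on \<^const>\<open>L2_space\<close> when the polynomials are dense there.\<close>

definition U_map :: "real measure \<Rightarrow> (real \<Rightarrow> complex) \<Rightarrow> ell2" where
  "U_map \<mu> = (SOME U. isometric_isomorphism \<mu> U \<and>
     (\<forall>k. U (\<lambda>t. of_real (poly (gram_schmidt \<mu> k) t)) = delta k))"

text \<open>\<open>|t - \<i>|\<^sup>2\<^sup>n = (1 + t\<^sup>2)\<^sup>n\<close>, so multiplication by the prefactor maps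
  \<open>L\<^sub>2(\<real>, \<nu>\<^sub>n)\<close> isometrically into \<open>L\<^sub>2(\<real>, \<mu>)\<close>.\<close>

definition f_fun :: "real measure \<Rightarrow> nat \<Rightarrow> nat \<Rightarrow> real \<Rightarrow> complex" where
  "f_fun \<mu> n k t =
     1 / (of_real (sqrt (C_const \<mu> n)) * (of_real t - \<i>) ^ n) * of_real (poly (gram_schmidt (nu \<mu> n) k) t)"

definition omega :: "real measure \<Rightarrow> nat \<Rightarrow> nat \<Rightarrow> ell2" where
  "omega \<mu> n k = U_map \<mu> (f_fun \<mu> n k)"

end

theory Submission
  imports Defs "HOL-Probability.Probability"
begin

text \<open>
  The map \<open>1\<^sub>S \<mapsto> E(S) \<delta>\<^sub>1\<close> extends to an isometry between \<open>L\<^sub>2(\<mu>)\<close> and the cyclic subspace of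
  \<open>\<delta>\<^sub>1\<close>. It turns \<open>Jt\<close> into multiplication by \<open>t\<close>, so the \<open>\<delta>\<^sub>k\<close> correspond to the orthonormal
  polynomials of \<open>\<mu>\<close>, the cyclic subspace is everything and the polynomials are dense in \<open>L\<^sub>2(\<mu>)\<close>.
  They are then dense in \<open>L\<^sub>2((1 + t\<^sup>2)\<^sup>k \<mu>)\<close> for every \<open>k \<le> 0\<close>, but for no \<open>k \<ge> 1\<close>: density for \<open>k = 1\<close>
  means that the finitely supported sequences are a core of \<open>Jt\<close>, which would make the Jacobi operator
  equal to \<open>Jt\<close>. This gives the index of \<open>\<nu>\<^sub>n\<close>, and determinacy by the theorem of M. Riesz. The density for
  \<open>k = 1 - n\<close>, transported by the factor \<open>(t - \<i>)\<^sup>-\<^sup>n\<close>, says that the span of the \<open>\<omega>\<^sub>k\<close> is a core of \<open>Jt\<close>.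
\<close>

section \<open>\<open>l\<^sub>2\<close> as a complex Hilbert space\<close>

text \<open>\<open>is_spectral_measure\<close> describes \<open>Jt\<close> only by its domain and
  its quadratic form; that \<open>Jt\<close> commutes with \<open>E\<close> is not given. The
  obstacle is therefore to show that \<open>Jt\<close> does not leave the cyclic subspace:
  polarization yields inner products with domain vectors alone, which is why truncations by
  \<open>E\<close> of bounded sets enter. Once \<open>Jt\<close> is multiplication by t, the rest is
  about weights, because the graph norm of this multiplication is the norm of L2((1 + t^2) mu). The
  measure \<open>nu mu n\<close> weighted by (1 + t^2)^m is a constant multiple of (1 + t^2)^(m - n)
  mu, so m = n is the last exponent at which density survives. The value m = 1, admissible since n
  >= 1, serves twice: for determinacy and for the core property of the \<open>omega mu n k\<close>.
  The factor (t - i)^-n commutes with multiplication by t and has squared modulus (1 + t^2)^-n.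
  Hence the matrix of \<open>Jt\<close> is that of multiplication by t on the orthonormal
  polynomials of \<open>nu mu n\<close>, tridiagonal by degree and symmetry.\<close>

lemma coord_simps:
  "coord 0 k = 0" "coord (x + y) k = coord x k + coord y k" "coord (- x) k = - coord x k" "coord (x - y) k = coord x k - coord y k"
  "coord (c *\<^sub>C x) k = c * coord x k" "coord (delta n) k = (if k = n then 1 else 0)"
proof -
  show "coord (- x) k = - coord x k" by (simp add: uminus_ell2.rep_eq)
  then show "coord (x - y) k = coord x k - coord y k"
    unfolding minus_ell2_def[of x y] plus_ell2.rep_eq by (simp add: uminus_ell2.rep_eq)
qed (simp_all add: zero_ell2.rep_eq plus_ell2.rep_eq scaleC.rep_eq delta.rep_eq)

lemma scaleC_simps:
  "c *\<^sub>C (x + y) = c *\<^sub>C x + c *\<^sub>C y" "(c + d) *\<^sub>C x = c *\<^sub>C x + d *\<^sub>C x"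
  "c *\<^sub>C (x - y) = c *\<^sub>C x - c *\<^sub>C y" "c *\<^sub>C d *\<^sub>C x = (c * d) *\<^sub>C x"
  "1 *\<^sub>C x = x" "0 *\<^sub>C x = 0" "c *\<^sub>C 0 = 0" "(-1) *\<^sub>C x = - x"
  by (auto intro!: ell2_eqI simp: coord_simps algebra_simps)

lemma coord_sum: "coord (\<Sum>i\<in>A. f i) k = (\<Sum>i\<in>A. coord (f i) k)"
  by (induction A rule: infinite_finite_induct) (auto simp: coord_simps)

lemma cinner_scaleC_left: "cinner (c *\<^sub>C x) z = cnj c * cinner x z"
  unfolding cinner_def suminf_mult[OF summable_cinner, symmetric]
  by (simp add: coord_simps algebra_simps)

lemma cinner_scaleC_right: "cinner z (c *\<^sub>C x) = c * cinner z x"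
  unfolding cinner_def suminf_mult[OF summable_cinner, symmetric]
  by (simp add: coord_simps algebra_simps)

lemma cinner_zero: "cinner x 0 = 0" "cinner 0 x = 0"
  by (simp_all add: cinner_def coord_simps)

lemma cinner_cnj: "cnj (cinner x y) = cinner y x"
proof -
  have "cnj (cinner x y) = (\<Sum>k. cnj (cnj (coord x k) * coord y k))"
    unfolding cinner_def by (intro sums_unique) (simp only: sums_cnj summable_sums[OF summable_cinner])
  then show ?thesis by (simp add: cinner_def mult.commute)
qed

lemma cinner_alt: "cinner x y = Complex (x \<bullet> y) ((\<i> *\<^sub>C x) \<bullet> y)"
  by (simp add: inner_ell2_def cinner_scaleC_left complex_eq_iff)

lemma cinner_delta: "cinner (delta k) x = coord x k"
proof -
  have "cinner (delta k) x = (\<Sum>j. if j = k then coord x k else 0)"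
    unfolding cinner_def by (intro suminf_cong) (auto simp: coord_simps)
  also have "\<dots> = coord x k"
    by (subst suminf_finite[of "{k}"]) auto
  finally show ?thesis .
qed

lemma norm_ell2_sq: "(norm x)\<^sup>2 = (\<Sum>k. (cmod (coord x k))\<^sup>2)" for x :: ell2
proof -
  have "(norm x)\<^sup>2 = x \<bullet> x" by (rule power2_norm_eq_inner)
  also have "\<dots> = (\<Sum>k. Re (cnj (coord x k) * coord x k))"
    unfolding inner_ell2_def cinner_def by (rule Re_suminf[OF summable_cinner])
  also have "(\<lambda>k. Re (cnj (coord x k) * coord x k)) = (\<lambda>k. (cmod (coord x k))\<^sup>2)"
    unfolding cmod_power2 by (simp add: power2_eq_square)
  finally show ?thesis .
qed

lemma norm_scaleC: "norm (c *\<^sub>C x) = cmod c * norm x"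
proof -
  have "(norm (c *\<^sub>C x))\<^sup>2 = (cmod c * norm x)\<^sup>2"
    by (simp add: norm_ell2_sq coord_simps norm_mult power_mult_distrib suminf_mult summable_coord_sq)
  then show ?thesis by (simp add: power2_eq_iff_nonneg)
qed

lemma norm_coord_le: "cmod (coord x k) \<le> norm x"
proof (rule power2_le_imp_le)
  have "(\<Sum>j\<in>{k}. (cmod (coord x j))\<^sup>2) \<le> (\<Sum>j. (cmod (coord x j))\<^sup>2)"
    by (intro sum_le_suminf summable_coord_sq) auto
  then show "(cmod (coord x k))\<^sup>2 \<le> (norm x)\<^sup>2" by (simp add: norm_ell2_sq)
qed simp

text \<open>Completeness turns Cauchy sequences of vectors into vectors in
  \<open>rep_limit_exists\<close>. The limit is taken coordinatewise; the Cauchy bound passes to it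
  on finite partial sums, and from there to the whole series.\<close>

instance ell2 :: complete_space
proof
  fix X :: "nat \<Rightarrow> ell2" assume X: "Cauchy X"
  have "Cauchy (\<lambda>n. coord (X n) k)" for k
    unfolding Cauchy_def
  proof (intro allI impI)
    fix e :: real assume "e > 0"
    with X obtain M where M: "\<forall>m\<ge>M. \<forall>n\<ge>M. dist (X m) (X n) < e" unfolding Cauchy_def by blast
    have "dist (coord (X m) k) (coord (X n) k) \<le> dist (X m) (X n)" for m n
      using norm_coord_le[of "X m - X n" k] by (simp add: dist_norm coord_simps)
    then show "\<exists>M. \<forall>m\<ge>M. \<forall>n\<ge>M. dist (coord (X m) k) (coord (X n) k) < e"
      using M by (meson le_less_trans)
  qed
  then obtain L where L: "\<And>k. (\<lambda>n. coord (X n) k) \<longlonglongrightarrow> L k"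
    unfolding Cauchy_convergent_iff convergent_def by metis
  have bd: "\<exists>N. \<forall>n\<ge>N. summable (\<lambda>k. (cmod (coord (X n) k - L k))\<^sup>2) \<and>
              (\<Sum>k. (cmod (coord (X n) k - L k))\<^sup>2) \<le> e\<^sup>2" if "e > 0" for e :: real
  proof -
    from CauchyD[OF X that]
    obtain N where N: "\<forall>m\<ge>N. \<forall>n\<ge>N. norm (X m - X n) < e" ..
    have fin: "(\<Sum>k<K. (cmod (coord (X n) k - L k))\<^sup>2) \<le> e\<^sup>2" if n: "n \<ge> N" for n K
    proof (rule LIMSEQ_le_const2)
      show "(\<lambda>m. \<Sum>k<K. (cmod (coord (X n) k - coord (X m) k))\<^sup>2) \<longlonglongrightarrow> (\<Sum>k<K. (cmod (coord (X n) k - L k))\<^sup>2)"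
        by (intro tendsto_intros L)
      have "(\<Sum>k<K. (cmod (coord (X n) k - coord (X m) k))\<^sup>2) \<le> e\<^sup>2" if "m \<ge> N" for m
      proof -
        have "(\<Sum>k<K. (cmod (coord (X n - X m) k))\<^sup>2) \<le> (norm (X n - X m))\<^sup>2"
          unfolding norm_ell2_sq by (intro sum_le_suminf summable_coord_sq) auto
        also have "\<dots> \<le> e\<^sup>2"
          using N n that by (intro power_mono) (auto intro: less_imp_le)
        finally show ?thesis by (simp add: coord_simps)
      qed
      then show "\<exists>N. \<forall>m\<ge>N. (\<Sum>k<K. (cmod (coord (X n) k - coord (X m) k))\<^sup>2) \<le> e\<^sup>2" by blast
    qed
    have "summable (\<lambda>k. (cmod (coord (X n) k - L k))\<^sup>2)" if "n \<ge> N" for n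
      using fin[OF that] by (intro summableI_nonneg_bounded[where x="e\<^sup>2"]) auto
    moreover have "(\<Sum>k. (cmod (coord (X n) k - L k))\<^sup>2) \<le> e\<^sup>2" if "n \<ge> N" for n
      using fin[OF that] calculation[OF that] by (intro suminf_le_const) auto
    ultimately show ?thesis by blast
  qed
  obtain N where "summable (\<lambda>k. (cmod (coord (X N) k - L k))\<^sup>2)"
    using bd[of 1] by auto
  then have "summable (\<lambda>k. (cmod (coord (X N) k + - (coord (X N) k - L k)))\<^sup>2)"
    by (intro summable_cmod_add summable_coord_sq) (simp only: norm_minus_cancel)
  then have "summable (\<lambda>k. (cmod (L k))\<^sup>2)" by simp
  then obtain x where x: "coord x = L"
    using Abs_ell2_inverse by (metis mem_Collect_eq)
  have "X \<longlonglongrightarrow> x"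
  proof (rule LIMSEQ_I)
    fix r :: real assume "0 < r"
    then obtain N where N: "\<And>n. n \<ge> N \<Longrightarrow> (\<Sum>k. (cmod (coord (X n) k - L k))\<^sup>2) \<le> (r/2)\<^sup>2"
      using bd[of "r/2"] by auto
    have "norm (X n - x) < r" if "n \<ge> N" for n
    proof -
      have "(norm (X n - x))\<^sup>2 \<le> (r/2)\<^sup>2"
        using N[OF that] by (simp add: norm_ell2_sq coord_simps x)
      then show ?thesis using \<open>0 < r\<close> power2_le_imp_le[of "norm (X n - x)" "r/2"] by simp
    qed
    then show "\<exists>no. \<forall>n\<ge>no. norm (X n - x) < r" by blast
  qed
  then show "convergent X" by (auto simp: convergent_def)
qed

text \<open>The squared error is a tail of a convergent series.\<close>

lemma delta_expansion: "(\<lambda>n. \<Sum>k<n. coord x k *\<^sub>C delta k) \<longlonglongrightarrow> x"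
proof -
  let ?s = "\<lambda>n. \<Sum>k<n. coord x k *\<^sub>C delta k"
  let ?a = "\<lambda>k. (cmod (coord x k))\<^sup>2"
  have c: "coord (x - ?s n) k = (if k < n then 0 else coord x k)" for n k
    by (simp add: coord_simps coord_sum if_distrib cong: if_cong)
  have "(norm (x - ?s n))\<^sup>2 = (\<Sum>k. ?a (k + n))" for n
  proof -
    have "(norm (x - ?s n))\<^sup>2 = (\<Sum>k. if k < n then 0 else ?a k)"
      unfolding norm_ell2_sq c by (intro suminf_cong) simp
    also have "\<dots> = (\<Sum>k. ?a (k + n))"
    proof -
      have e: "(cmod (coord (x - ?s n) k))\<^sup>2 = (if k < n then 0 else ?a k)" for k
        unfolding c by simp
      show ?thesis
        using suminf_split_initial_segment[of "\<lambda>k. (cmod (coord (x - ?s n) k))\<^sup>2" n, OF summable_coord_sq]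
        unfolding e by simp
    qed
    finally show ?thesis .
  qed
  moreover have "(\<lambda>n. \<Sum>k. ?a (k + n)) \<longlonglongrightarrow> 0"
    by (rule suminf_exist_split2[OF summable_coord_sq])
  ultimately have "(\<lambda>n. sqrt ((norm (x - ?s n))\<^sup>2)) \<longlonglongrightarrow> sqrt 0"
    by (intro tendsto_real_sqrt) simp
  then have "(\<lambda>n. norm (x - ?s n)) \<longlonglongrightarrow> 0" by simp
  then have "(\<lambda>n. x - ?s n) \<longlonglongrightarrow> 0" by (rule tendsto_norm_zero_cancel)
  then have "(\<lambda>n. x - (x - ?s n)) \<longlonglongrightarrow> x - 0" by (intro tendsto_intros)
  then show ?thesis by simp
qed

section \<open>Projection-valued measures\<close>

locale pvm =
  fixes E :: "real set \<Rightarrow> ell2 \<Rightarrow> ell2"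
  assumes pvm: "projection_valued_measure E"
begin

lemma
  assumes "S \<in> sets borel"
  shows E_add: "E S (x + y) = E S x + E S y"
    and E_scaleC: "E S (c *\<^sub>C x) = c *\<^sub>C E S x"
    and E_idem: "E S (E S x) = E S x"
    and E_cinner: "cinner (E S x) y = cinner x (E S y)"
proof -
  have "orthogonal_projection (E S)"
    using pvm assms by (simp add: projection_valued_measure_def)
  then show "E S (x + y) = E S x + E S y" "E S (c *\<^sub>C x) = c *\<^sub>C E S x"
    "E S (E S x) = E S x" "cinner (E S x) y = cinner x (E S y)"
    by (simp_all add: orthogonal_projection_def)
qed

lemma E_UNIV: "E UNIV x = x"
  using pvm unfolding projection_valued_measure_def by blast

lemma E_sums:
  "range A \<subseteq> sets borel \<Longrightarrow> disjoint_family A \<Longrightarrow> (\<lambda>n::nat. E (A n) x) sums E (\<Union>n. A n) x"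
  using pvm unfolding projection_valued_measure_def by blast

lemma E_inner: "S \<in> sets borel \<Longrightarrow> E S x \<bullet> y = x \<bullet> E S y"
  by (simp add: inner_ell2_def E_cinner)

lemma E_minus: "S \<in> sets borel \<Longrightarrow> E S (- x) = - E S x"
  using E_scaleC[of S "-1" x] by (simp add: scaleC_simps)

lemma E_diff: "S \<in> sets borel \<Longrightarrow> E S (x - y) = E S x - E S y"
  using E_add[of S x "- y"] by (simp add: E_minus)

text \<open>Countable additivity over constantly empty sets gives a convergent series with equal
  terms, which forces the term to vanish.\<close>

lemma E_empty: "E {} x = 0"
proof -
  have "(\<lambda>n::nat. E {} x) sums E (\<Union>n::nat. {}) x"
    by (rule E_sums) (auto simp: disjoint_family_on_def)
  then have "summable (\<lambda>n::nat. E {} x)" by (rule sums_summable)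
  then have "(\<lambda>n::nat. E {} x) \<longlonglongrightarrow> 0" by (rule summable_LIMSEQ_zero)
  then show ?thesis by (simp add: LIMSEQ_const_iff)
qed

lemma E_Un:
  assumes "S \<in> sets borel" "T \<in> sets borel" "S \<inter> T = {}"
  shows "E (S \<union> T) x = E S x + E T x"
proof -
  have "(\<lambda>n. E (binaryset S T n) x) sums E (\<Union>n. binaryset S T n) x"
    using assms by (intro E_sums) (auto simp: binaryset_def disjoint_family_on_def)
  moreover have "(\<lambda>n. E (binaryset S T n) x) sums (E S x + E T x)"
    by (rule binaryset_sums) (rule E_empty)
  ultimately show ?thesis by (metis UN_binaryset_eq sums_unique2)
qed

text \<open>Orthogonality follows from additivity: idempotence of \<open>E (S \<union> T)\<close>
  makes \<open>E S\<close> and \<open>E T\<close> anticommute, and composing with \<open>E S\<close>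
  once more shows \<open>E S (E T x)\<close> to be its own negative.\<close>

lemma E_disjoint:
  assumes S: "S \<in> sets borel" and T: "T \<in> sets borel" and "S \<inter> T = {}"
  shows "E S (E T x) = 0"
proof -
  have anti: "E S (E T x) = - E T (E S x)" for x
  proof -
    have "E (S \<union> T) (E (S \<union> T) x) = E (S \<union> T) x"
      using S T by (intro E_idem) auto
    then have "E S x + E S (E T x) + (E T (E S x) + E T x) = E S x + E T x"
      using assms by (simp add: E_Un E_add E_idem add_ac)
    then have "E S (E T x) + E T (E S x) = 0"
      by (simp add: algebra_simps)
    then show ?thesis by (simp add: eq_neg_iff_add_eq_0)
  qed
  have "E S (E T (E S x)) = E S (E T x)"
    using anti[of "E S x"] anti[of x] by (simp add: E_idem S)
  moreover have "E S (E T x) = - E S (E T (E S x))"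
    by (metis anti E_idem E_minus S)
  ultimately have "E S (E T x) = - E S (E T x)" by simp
  then show ?thesis
    by (metis add.inverse_inverse eq_neg_iff_add_eq_0 scaleR_2 scaleR_eq_0_iff zero_neq_numeral)
qed

text \<open>Both sets are cut along their intersection, and \<open>E_disjoint\<close> removes the
  mixed terms.\<close>

lemma E_Int:
  assumes S: "S \<in> sets borel" and T: "T \<in> sets borel"
  shows "E S (E T x) = E (S \<inter> T) x"
proof -
  have split: "E A y = E (A \<inter> B) y + E (A - B) y"
    if "A \<in> sets borel" "B \<in> sets borel" for A B y
  proof -
    have "(A \<inter> B) \<union> (A - B) = A" by blast
    then show ?thesis using E_Un[of "A \<inter> B" "A - B" y] that by auto
  qed
  have "E S (E T x) = E S (E (T \<inter> S) x) + E S (E (T - S) x)"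
    using split[OF T S, of x] by (simp add: E_add S)
  also have "E S (E (T - S) x) = 0"
    using S T by (intro E_disjoint) auto
  also have "E S (E (T \<inter> S) x) = E (S \<inter> T) (E (S \<inter> T) x) + E (S - T) (E (S \<inter> T) x)"
    using split[OF S T] by (simp add: Int_commute)
  also have "E (S - T) (E (S \<inter> T) x) = 0"
    using S T by (intro E_disjoint) auto
  also have "E (S \<inter> T) (E (S \<inter> T) x) = E (S \<inter> T) x"
    using S T by (intro E_idem) auto
  finally show ?thesis by simp
qed

lemma E_lim:
  assumes A: "incseq A" "range A \<subseteq> sets borel" "(\<Union>n::nat. A n) = UNIV"
  shows "(\<lambda>n. E (A n) x) \<longlonglongrightarrow> x"
proof -
  have "(\<lambda>n. E (disjointed A n) x) sums E (\<Union>n. disjointed A n) x"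
    using A(2) by (intro E_sums disjoint_family_disjointed sets.range_disjointed_sets)
  then have "(\<lambda>n. E (disjointed A n) x) sums x"
    by (simp add: UN_disjointed_eq A(3) E_UNIV)
  then have "(\<lambda>n. \<Sum>i<Suc n. E (disjointed A i) x) \<longlonglongrightarrow> x"
    unfolding sums_def by (rule LIMSEQ_Suc)
  moreover have "(\<Sum>i<Suc n. E (disjointed A i) x) = E (A n) x" for n
  proof (induction n)
    case 0
    then show ?case by (simp add: disjointed_def)
  next
    case (Suc n)
    have "A n \<union> (A (Suc n) - A n) = A (Suc n)"
      using A(1) by (auto simp: incseq_Suc_iff)
    then have "E (A (Suc n)) x = E (A n) x + E (A (Suc n) - A n) x"
      using A(2) E_Un[of "A n" "A (Suc n) - A n" x] by auto
    then show ?case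
      using Suc disjointed_mono[OF A(1), of n] by simp
  qed
  ultimately show ?thesis by simp
qed

lemma norm_E_sq: "S \<in> sets borel \<Longrightarrow> (norm (E S x))\<^sup>2 = x \<bullet> E S x"
  by (simp add: power2_norm_eq_inner E_inner E_idem)

lemma inner_E_nonneg: "S \<in> sets borel \<Longrightarrow> 0 \<le> x \<bullet> E S x"
  by (simp add: norm_E_sq[symmetric])

lemma sets_scalar_measure [measurable_cong, simp]: "sets (scalar_measure E x) = sets borel"
  unfolding scalar_measure_def using sets.sets_measure_of_eq[of borel] by simp

lemma space_scalar_measure [simp]: "space (scalar_measure E x) = UNIV"
  unfolding scalar_measure_def by (rule space_measure_of_conv)

text \<open>\<open>measure_of\<close> collapses to the zero measure unless the set function is
  countably additive, so this is checked before any value of \<open>scalar_measure\<close> can be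
  read off.\<close>

lemma emeasure_scalar_measure:
  assumes S: "S \<in> sets borel"
  shows "emeasure (scalar_measure E x) S = ennreal (x \<bullet> E S x)"
proof -
  have "emeasure (scalar_measure E x) S = ennreal (Re (cinner x (E S x)))"
    unfolding scalar_measure_def
  proof (rule emeasure_measure_of_sigma[OF _ _ _ S])
    show "sigma_algebra UNIV (sets borel :: real set set)"
      using sets.sigma_algebra_axioms[of borel] by simp
    show "positive (sets borel) (\<lambda>S. ennreal (Re (cinner x (E S x))))"
      by (auto simp: positive_def E_empty cinner_zero)
    show "countably_additive (sets borel) (\<lambda>S. ennreal (Re (cinner x (E S x))))"
      unfolding inner_ell2_def[symmetric]
    proof (rule countably_additiveI)
      fix A :: "nat \<Rightarrow> real set"
      assume A: "range A \<subseteq> sets borel" "disjoint_family A" "(\<Union>i. A i) \<in> sets borel"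
      have s: "(\<lambda>i. x \<bullet> E (A i) x) sums (x \<bullet> E (\<Union>i. A i) x)"
        by (rule bounded_linear.sums[OF bounded_linear_inner_right E_sums[OF A(1,2)]])
      have "(\<Sum>i. ennreal (x \<bullet> E (A i) x)) = ennreal (\<Sum>i. x \<bullet> E (A i) x)"
        using A s by (intro suminf_ennreal2 inner_E_nonneg) (auto simp: sums_iff)
      then show "(\<Sum>i. ennreal (x \<bullet> E (A i) x)) = ennreal (x \<bullet> E (\<Union>i. A i) x)"
        using s by (simp add: sums_iff)
    qed
  qed
  then show ?thesis by (simp add: inner_ell2_def)
qed

lemma finite_scalar_measure: "finite_measure (scalar_measure E x)"
  by (rule finite_measureI) (simp add: emeasure_scalar_measure)

lemma scalar_measure_eqI:
  "(\<And>S. S \<in> sets borel \<Longrightarrow> x \<bullet> E S x = y \<bullet> E S y) \<Longrightarrow> scalar_measure E x = scalar_measure E y"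
  by (rule measure_eqI) (auto simp: emeasure_scalar_measure)

end

section \<open>Square-integrable functions and the cyclic subspace\<close>

text \<open>The norm is kept squared: convergence and smallness can then be handled by |x + y|^2 <=
  2|x|^2 + 2|y|^2 in place of Minkowski's inequality.\<close>

definition sqn :: "real measure \<Rightarrow> (real \<Rightarrow> complex) \<Rightarrow> real" where
  "sqn M f = (\<integral>t. (cmod (f t))\<^sup>2 \<partial>M)"

lemma L2_spaceD:
  assumes "f \<in> L2_space M"
  shows "f \<in> borel_measurable M" "integrable M (\<lambda>t. (cmod (f t))\<^sup>2)"
  using assms by (auto simp: L2_space_def)

lemma L2_space_bound:
  assumes f: "f \<in> L2_space M" and "g \<in> borel_measurable M" and "\<And>t. cmod (g t) \<le> c * cmod (f t)"
  shows "g \<in> L2_space M"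
proof -
  have "integrable M (\<lambda>t. (cmod (g t))\<^sup>2)"
  proof (rule Bochner_Integration.integrable_bound)
    show "integrable M (\<lambda>t. c\<^sup>2 * (cmod (f t))\<^sup>2)"
      using L2_spaceD(2)[OF f] by simp
    show "AE t in M. norm ((cmod (g t))\<^sup>2) \<le> norm (c\<^sup>2 * (cmod (f t))\<^sup>2)"
      using assms(3) by (auto simp: power_mult_distrib[symmetric] intro!: power_mono)
  qed (use assms in measurable)
  then show ?thesis using assms by (simp add: L2_space_def)
qed

lemma cmod_add_sq_le: "(cmod (x + y))\<^sup>2 \<le> 2 * (cmod x)\<^sup>2 + 2 * (cmod y)\<^sup>2"
proof -
  have "(cmod (x + y))\<^sup>2 \<le> (cmod x + cmod y)\<^sup>2"
    by (intro power_mono norm_triangle_ineq) simp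
  also have "\<dots> \<le> 2 * (cmod x)\<^sup>2 + 2 * (cmod y)\<^sup>2"
    using sum_squares_bound[of "cmod x" "cmod y"] by (simp add: power2_sum)
  finally show ?thesis .
qed

lemma L2_space_add:
  assumes f: "f \<in> L2_space M" and g: "g \<in> L2_space M"
  shows "(\<lambda>t. f t + g t) \<in> L2_space M"
proof -
  have [measurable]: "f \<in> borel_measurable M" "g \<in> borel_measurable M"
    using assms by (auto simp: L2_space_def)
  have "integrable M (\<lambda>t. (cmod (f t + g t))\<^sup>2)"
  proof (rule Bochner_Integration.integrable_bound)
    show "integrable M (\<lambda>t. 2 * (cmod (f t))\<^sup>2 + 2 * (cmod (g t))\<^sup>2)"
      using L2_spaceD(2)[OF f] L2_spaceD(2)[OF g] by simp
    show "AE t in M. norm ((cmod (f t + g t))\<^sup>2) \<le> norm (2 * (cmod (f t))\<^sup>2 + 2 * (cmod (g t))\<^sup>2)"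
      using cmod_add_sq_le by auto
  qed measurable
  then show ?thesis by (simp add: L2_space_def)
qed

lemma L2_space_scale: "f \<in> L2_space M \<Longrightarrow> (\<lambda>t. c * f t) \<in> L2_space M"
  by (rule L2_space_bound[of f _ _ "cmod c"]) (auto simp: L2_space_def norm_mult)

lemma L2_space_diff:
  "f \<in> L2_space M \<Longrightarrow> g \<in> L2_space M \<Longrightarrow> (\<lambda>t. f t - g t) \<in> L2_space M"
  using L2_space_add[of f M "\<lambda>t. (-1) * g t"] L2_space_scale[of g M "-1"] by simp

lemma L2_space_zero: "(\<lambda>_. 0) \<in> L2_space M"
  by (simp add: L2_space_def)

lemma L2_space_integrable_mult:
  assumes f: "f \<in> L2_space M" and g: "g \<in> L2_space M"
  shows "integrable M (\<lambda>t. cnj (f t) * g t)"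
proof -
  have [measurable]: "f \<in> borel_measurable M" "g \<in> borel_measurable M"
    using assms by (auto simp: L2_space_def)
  have [measurable]: "cnj \<in> borel_measurable borel"
    by (intro borel_measurable_continuous_onI continuous_intros)
  show ?thesis
  proof (rule Bochner_Integration.integrable_bound)
    show "integrable M (\<lambda>t. (cmod (f t))\<^sup>2 + (cmod (g t))\<^sup>2)"
      using L2_spaceD(2)[OF f] L2_spaceD(2)[OF g] by simp
    have "cmod x * cmod y \<le> (cmod x)\<^sup>2 + (cmod y)\<^sup>2" for x y
      using sum_squares_bound[of "cmod x" "cmod y"] mult_nonneg_nonneg[OF norm_ge_zero norm_ge_zero, of x y]
      by linarith
    then show "AE t in M. norm (cnj (f t) * g t) \<le> norm ((cmod (f t))\<^sup>2 + (cmod (g t))\<^sup>2)"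
      by (auto simp: norm_mult)
  qed measurable
qed

lemma inner_complex_Re: "x \<bullet> y = Re (cnj x * y)" for x y :: complex
  by (simp add: inner_complex_def)

lemma L2_space_integrable_inner:
  assumes "f \<in> L2_space M" "g \<in> L2_space M"
  shows "integrable M (\<lambda>t. f t \<bullet> g t)"
  unfolding inner_complex_Re by (rule integrable_Re[OF L2_space_integrable_mult[OF assms]])

lemma sqn_nonneg: "0 \<le> sqn M f"
  by (simp add: sqn_def)

lemma sqn_inner: "sqn M f = (\<integral>t. f t \<bullet> f t \<partial>M)"
  by (simp add: sqn_def power2_norm_eq_inner)

lemma sqn_minus_commute: "sqn M (\<lambda>t. f t - g t) = sqn M (\<lambda>t. g t - f t)"
  by (simp add: sqn_def norm_minus_commute)

lemma sqn_mono:
  "f \<in> L2_space M \<Longrightarrow> g \<in> L2_space M \<Longrightarrow> (\<And>t. cmod (f t) \<le> cmod (g t)) \<Longrightarrow> sqn M f \<le> sqn M g"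
  unfolding sqn_def by (intro integral_mono L2_spaceD) (auto intro: power_mono)

lemma sqn_add_le:
  assumes "f \<in> L2_space M" "g \<in> L2_space M"
  shows "sqn M (\<lambda>t. f t + g t) \<le> 2 * sqn M f + 2 * sqn M g"
proof -
  have "sqn M (\<lambda>t. f t + g t) \<le> (\<integral>t. 2 * (cmod (f t))\<^sup>2 + 2 * (cmod (g t))\<^sup>2 \<partial>M)"
    unfolding sqn_def
    using L2_spaceD(2)[OF L2_space_add[OF assms]] L2_spaceD(2)[OF assms(1)] L2_spaceD(2)[OF assms(2)]
    by (intro integral_mono cmod_add_sq_le) auto
  then show ?thesis
    using L2_spaceD(2)[OF assms(1)] L2_spaceD(2)[OF assms(2)] by (simp add: sqn_def)
qed

lemma sqn_triangle:
  assumes "f \<in> L2_space M" "g \<in> L2_space M" "h \<in> L2_space M"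
  shows "sqn M (\<lambda>t. f t - h t) \<le> 2 * sqn M (\<lambda>t. f t - g t) + 2 * sqn M (\<lambda>t. g t - h t)"
  using sqn_add_le[of "\<lambda>t. f t - g t" M "\<lambda>t. g t - h t"] L2_space_diff assms by auto

lemma L2_Cauchy_Schwarz:
  assumes f: "f \<in> L2_space M" and g: "g \<in> L2_space M"
  shows "\<bar>\<integral>t. f t \<bullet> g t \<partial>M\<bar> \<le> sqrt (sqn M f) * sqrt (sqn M g)"
proof -
  let ?I = "\<integral>t. f t \<bullet> g t \<partial>M"
  have quad: "0 \<le> sqn M f + 2 * s * ?I + s\<^sup>2 * sqn M g" for s :: real
  proof -
    have "(f t + of_real s * g t) \<bullet> (f t + of_real s * g t)
        = f t \<bullet> f t + 2 * s * (f t \<bullet> g t) + s\<^sup>2 * (g t \<bullet> g t)" for t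
      by (simp add: inner_complex_def algebra_simps power2_eq_square)
    moreover have "(\<integral>t. f t \<bullet> f t + 2 * s * (f t \<bullet> g t) + s\<^sup>2 * (g t \<bullet> g t) \<partial>M)
        = sqn M f + 2 * s * ?I + s\<^sup>2 * sqn M g"
      by (simp add: L2_space_integrable_inner f g sqn_inner)
    ultimately have "sqn M (\<lambda>t. f t + of_real s * g t) = sqn M f + 2 * s * ?I + s\<^sup>2 * sqn M g"
      by (simp add: sqn_inner)
    then show ?thesis using sqn_nonneg by metis
  qed
  have "?I\<^sup>2 \<le> sqn M f * sqn M g"
  proof (cases "sqn M g = 0")
    case True
    have "?I = 0"
    proof (rule ccontr)
      assume "?I \<noteq> 0"
      \<comment> \<open>This \<open>s\<close> makes the nonnegative quadratic equal to -1.\<close>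
      then show False using quad[of "- (sqn M f + 1) / (2 * ?I)"] True by (simp add: field_simps)
    qed
    then show ?thesis using True by simp
  next
    case False
    then have g: "sqn M g > 0" using sqn_nonneg[of M g] by simp
    \<comment> \<open>The value of \<open>s\<close> inserted here minimizes the quadratic.\<close>
    have "0 \<le> sqn M f + 2 * (- ?I / sqn M g) * ?I + (- ?I / sqn M g)\<^sup>2 * sqn M g" by (rule quad)
    also have "\<dots> = sqn M f - ?I\<^sup>2 / sqn M g"
      using g by (simp add: field_simps power2_eq_square)
    finally show ?thesis using g by (simp add: field_simps)
  qed
  then have "sqrt (?I\<^sup>2) \<le> sqrt (sqn M f * sqn M g)" by (rule real_sqrt_le_mono)
  then show ?thesis by (simp add: real_sqrt_mult)
qed

lemma tendsto_L2_inner: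
  assumes "\<And>n::nat. f n \<in> L2_space M" "g \<in> L2_space M" "h \<in> L2_space M"
    and lim: "(\<lambda>n. sqn M (\<lambda>t. f n t - g t)) \<longlonglongrightarrow> 0"
  shows "(\<lambda>n. \<integral>t. f n t \<bullet> h t \<partial>M) \<longlonglongrightarrow> (\<integral>t. g t \<bullet> h t \<partial>M)"
proof -
  have "(\<lambda>n. sqrt (sqn M (\<lambda>t. f n t - g t)) * sqrt (sqn M h)) \<longlonglongrightarrow> sqrt 0 * sqrt (sqn M h)"
    by (intro tendsto_intros lim)
  then have "(\<lambda>n. (\<integral>t. f n t \<bullet> h t \<partial>M) - (\<integral>t. g t \<bullet> h t \<partial>M)) \<longlonglongrightarrow> 0"
  proof (rule Lim_null_comparison[rotated, OF tendsto_eq_rhs])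
    have "\<bar>(\<integral>t. f n t \<bullet> h t \<partial>M) - (\<integral>t. g t \<bullet> h t \<partial>M)\<bar> \<le> sqrt (sqn M (\<lambda>t. f n t - g t)) * sqrt (sqn M h)" for n
      using L2_Cauchy_Schwarz[OF L2_space_diff[OF assms(1,2)] assms(3), of n]
      by (simp add: inner_diff_left L2_space_integrable_inner assms)
    then show "\<forall>\<^sub>F n in sequentially. norm ((\<integral>t. f n t \<bullet> h t \<partial>M) - (\<integral>t. g t \<bullet> h t \<partial>M))
        \<le> sqrt (sqn M (\<lambda>t. f n t - g t)) * sqrt (sqn M h)" by simp
  qed simp
  then show ?thesis by (simp add: LIM_zero_iff)
qed

lemma tendsto_sqn_dominated:
  assumes f: "f \<in> L2_space M" and g [measurable]: "\<And>n::nat. g n \<in> borel_measurable M"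
    and le: "\<And>n t. cmod (g n t) \<le> c * cmod (f t)" and lim: "\<And>t. t \<in> space M \<Longrightarrow> (\<lambda>n. g n t) \<longlonglongrightarrow> f t"
  shows "(\<lambda>n. sqn M (\<lambda>t. g n t - f t)) \<longlonglongrightarrow> 0"
proof -
  have [measurable]: "f \<in> borel_measurable M" using f by (rule L2_spaceD)
  have "(\<lambda>n. \<integral>t. (cmod (g n t - f t))\<^sup>2 \<partial>M) \<longlonglongrightarrow> (\<integral>t. 0 \<partial>M)"
  proof (rule integral_dominated_convergence)
    show "integrable M (\<lambda>t. (c + 1)\<^sup>2 * (cmod (f t))\<^sup>2)"
      using L2_spaceD(2)[OF f] by simp
    show "AE t in M. (\<lambda>n. (cmod (g n t - f t))\<^sup>2) \<longlonglongrightarrow> 0"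
    proof (rule AE_I2)
      fix t assume "t \<in> space M"
      then have "(\<lambda>n. (cmod (g n t - f t))\<^sup>2) \<longlonglongrightarrow> (cmod (f t - f t))\<^sup>2"
        by (intro tendsto_intros lim)
      then show "(\<lambda>n. (cmod (g n t - f t))\<^sup>2) \<longlonglongrightarrow> 0" by simp
    qed
    have "cmod (g n t - f t) \<le> (c + 1) * cmod (f t)" for n t
      using norm_triangle_ineq4[of "g n t" "f t"] le[of n t] by (simp add: algebra_simps)
    then show "AE t in M. norm ((cmod (g n t - f t))\<^sup>2) \<le> (c + 1)\<^sup>2 * (cmod (f t))\<^sup>2" for n
      by (auto simp: power_mult_distrib[symmetric] intro!: power_mono)
  qed measurable
  then show ?thesis by (simp add: sqn_def)
qed

section \<open>The isometry between L2(mu) and the cyclic subspace\<close>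

context pvm
begin

abbreviation mu :: "real measure" where "mu \<equiv> scalar_measure E (delta 0)"

text \<open>The graph of the isometry, on representatives: f is determined up to null sets, and v by
  f (\<open>rep_unique\<close>). As an inductive closure under sums and simultaneous limits it
  carries an induction principle, so inner products and the action of \<open>E\<close> can be
  transported without a prior proof of well-definedness.\<close>

inductive rep :: "ell2 \<Rightarrow> (real \<Rightarrow> complex) \<Rightarrow> bool" where
  rep_base: "S \<in> sets borel \<Longrightarrow> rep (c *\<^sub>C E S (delta 0)) (\<lambda>t. c * indicator S t)"
| rep_add: "rep v f \<Longrightarrow> rep w g \<Longrightarrow> rep (v + w) (\<lambda>t. f t + g t)"
| rep_lim: "(\<And>n::nat. rep (v n) (f n)) \<Longrightarrow> v \<longlonglongrightarrow> w \<Longrightarrow> g \<in> L2_space mu \<Longrightarrow>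
    (\<lambda>n. sqn mu (\<lambda>t. f n t - g t)) \<longlonglongrightarrow> 0 \<Longrightarrow> rep w g"

lemma L2_indicator: "S \<in> sets borel \<Longrightarrow> (\<lambda>t. c * indicator S t) \<in> L2_space mu"
proof -
  assume [measurable]: "S \<in> sets borel"
  interpret finite_measure mu by (rule finite_scalar_measure)
  have "(\<lambda>t. 1) \<in> L2_space mu" by (simp add: L2_space_def)
  then show ?thesis
    by (rule L2_space_bound[of _ _ _ "cmod c"]) (auto simp: indicator_def)
qed

lemma rep_L2: "rep v f \<Longrightarrow> f \<in> L2_space mu"
  by (induction rule: rep.induct) (auto intro: L2_indicator L2_space_add)

lemma rep_scale: "rep v f \<Longrightarrow> rep (c *\<^sub>C v) (\<lambda>t. c * f t)"
proof (induction rule: rep.induct)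
  case (rep_base S d)
  then show ?case using rep.rep_base[of S "c * d"] by (simp add: scaleC_simps mult.assoc)
next
  case (rep_add v f w g)
  then show ?case using rep.rep_add[OF rep_add.IH] by (simp add: scaleC_simps algebra_simps)
next
  case (rep_lim v f w g)
  show ?case
  proof (rule rep.rep_lim[OF rep_lim.IH])
    have "(\<lambda>n. norm (c *\<^sub>C (v n - w))) \<longlonglongrightarrow> cmod c * 0"
      unfolding norm_scaleC using rep_lim.hyps
      by (intro tendsto_intros) (simp add: LIM_zero tendsto_norm_zero)
    then have "(\<lambda>n. c *\<^sub>C (v n - w)) \<longlonglongrightarrow> 0"
      by (simp add: tendsto_norm_zero_iff)
    then show "(\<lambda>n. c *\<^sub>C v n) \<longlonglongrightarrow> c *\<^sub>C w"
      by (simp add: scaleC_simps LIM_zero_iff)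
    have "(\<lambda>n. (cmod c)\<^sup>2 * sqn mu (\<lambda>t. f n t - g t)) \<longlonglongrightarrow> (cmod c)\<^sup>2 * 0"
      by (intro tendsto_intros rep_lim.hyps)
    then show "(\<lambda>n. sqn mu (\<lambda>t. c * f n t - c * g t)) \<longlonglongrightarrow> 0"
      by (simp add: sqn_def right_diff_distrib[symmetric] norm_mult power_mult_distrib)
  qed (use rep_lim in \<open>auto intro: L2_space_scale\<close>)
qed

text \<open>The base case is \<open>E_Int\<close>; limits pass because projections are
  contractions.\<close>

lemma rep_E: "rep v f \<Longrightarrow> A \<in> sets borel \<Longrightarrow> rep (E A v) (\<lambda>t. indicator A t * f t)"
proof (induction rule: rep.induct)
  case (rep_base S c)
  then have "rep (c *\<^sub>C E (A \<inter> S) (delta 0)) (\<lambda>t. c * indicator (A \<inter> S) t)"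
    by (intro rep.rep_base) simp
  moreover have "(\<lambda>t. c * indicator (A \<inter> S) t) = (\<lambda>t. indicator A t * (c * indicator S t))"
    by (auto simp: indicator_def)
  ultimately show ?case using rep_base by (simp add: E_scaleC E_Int)
next
  case (rep_add v f w g)
  then show ?case using rep.rep_add[OF rep_add.IH] by (simp add: E_add algebra_simps)
next
  case (rep_lim v f w g)
  have [measurable]: "A \<in> sets borel" by fact
  have L2: "(\<lambda>t. indicator A t * h t) \<in> L2_space mu" if "h \<in> L2_space mu" for h :: "real \<Rightarrow> complex"
    using L2_spaceD(1)[OF that] by (intro L2_space_bound[OF that, of _ 1]) (auto simp: indicator_def)
  show ?case
  proof (rule rep.rep_lim[OF rep_lim.IH[OF \<open>A \<in> sets borel\<close>]])
    have le: "norm (E A (v n) - E A w) \<le> norm (v n - w)" for n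
    proof -
      have "(norm (E A (v n - w)))\<^sup>2 = (v n - w) \<bullet> E A (v n - w)"
        using \<open>A \<in> sets borel\<close> by (rule norm_E_sq)
      also have "\<dots> \<le> norm (v n - w) * norm (E A (v n - w))" by (rule norm_cauchy_schwarz)
      finally have "norm (E A (v n - w)) * norm (E A (v n - w)) \<le> norm (v n - w) * norm (E A (v n - w))"
        by (simp add: power2_eq_square)
      then have "norm (E A (v n - w)) \<le> norm (v n - w)"
        by (cases "norm (E A (v n - w)) = 0") auto
      then show ?thesis by (simp add: E_diff)
    qed
    have "(\<lambda>n. norm (v n - w)) \<longlonglongrightarrow> 0"
      using rep_lim.hyps by (simp add: LIM_zero tendsto_norm_zero)
    then have "(\<lambda>n. E A (v n) - E A w) \<longlonglongrightarrow> 0"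
      by (rule Lim_null_comparison[rotated]) (simp add: le)
    then show "(\<lambda>n. E A (v n)) \<longlonglongrightarrow> E A w" by (simp add: LIM_zero_iff)
    have "sqn mu (\<lambda>t. indicator A t * f n t - indicator A t * g t) \<le> sqn mu (\<lambda>t. f n t - g t)" for n
      unfolding right_diff_distrib[symmetric]
      using rep_lim.hyps rep_L2
      by (intro sqn_mono L2 L2_space_diff) (auto simp: indicator_def)
    then show "(\<lambda>n. sqn mu (\<lambda>t. indicator A t * f n t - indicator A t * g t)) \<longlonglongrightarrow> 0"
      by (intro Lim_null_comparison[OF _ rep_lim.hyps(4)]) (simp add: sqn_nonneg)
  qed (use rep_lim L2 in auto)
qed

lemma measure_mu: "S \<in> sets borel \<Longrightarrow> measure mu S = delta 0 \<bullet> E S (delta 0)"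
  by (simp add: measure_def emeasure_scalar_measure inner_E_nonneg)

lemma inner_rep_base:
  assumes [measurable]: "S \<in> sets borel" "T \<in> sets borel"
  shows "(c *\<^sub>C E S (delta 0)) \<bullet> (d *\<^sub>C E T (delta 0)) = (\<integral>t. (c * indicator S t) \<bullet> (d * indicator T t) \<partial>mu)"
proof -
  let ?d = "delta 0"
  have ST: "S \<inter> T \<in> sets borel" by simp
  have real: "cinner ?d (E (S \<inter> T) ?d) = of_real (measure mu (S \<inter> T))"
  proof -
    have "cnj (cinner ?d (E (S \<inter> T) ?d)) = cinner ?d (E (S \<inter> T) ?d)"
      by (simp add: cinner_cnj E_cinner[OF ST])
    then have "Im (cinner ?d (E (S \<inter> T) ?d)) = 0" by (simp add: complex_eq_iff)
    then show ?thesis by (simp add: complex_eq_iff measure_mu inner_ell2_def)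
  qed
  have "(c *\<^sub>C E S ?d) \<bullet> (d *\<^sub>C E T ?d) = Re (cnj c * d * cinner ?d (E (S \<inter> T) ?d))"
    by (simp add: inner_ell2_def cinner_scaleC_left cinner_scaleC_right E_cinner E_Int mult.assoc mult.left_commute)
  also have "\<dots> = (c \<bullet> d) * measure mu (S \<inter> T)"
    unfolding real inner_complex_Re by simp
  also have "\<dots> = (\<integral>t. (c \<bullet> d) * indicator (S \<inter> T) t \<partial>mu)"
    by simp
  also have "\<dots> = (\<integral>t. (c * indicator S t) \<bullet> (d * indicator T t) \<partial>mu)"
    by (intro Bochner_Integration.integral_cong) (auto simp: indicator_def)
  finally show ?thesis .
qed

text \<open>Double induction, one argument at a time: two indicators meet in \<open>E_Int\<close>,
  and limits pass by Cauchy-Schwarz.\<close>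

lemma inner_rep: "rep v f \<Longrightarrow> rep w g \<Longrightarrow> v \<bullet> w = (\<integral>t. f t \<bullet> g t \<partial>mu)"
proof (induction arbitrary: w g rule: rep.induct)
  case (rep_base S c w g)
  from rep_base(2) show ?case
  proof (induction rule: rep.induct)
    case (rep_base T d)
    then show ?case using inner_rep_base \<open>S \<in> sets borel\<close> by blast
  next
    case (rep_add v f w g)
    then show ?case
      by (simp add: inner_add_right L2_space_integrable_inner L2_indicator \<open>S \<in> sets borel\<close> rep_L2)
  next
    case (rep_lim v f w g)
    have "(\<lambda>n. (c *\<^sub>C E S (delta 0)) \<bullet> v n) \<longlonglongrightarrow> (c *\<^sub>C E S (delta 0)) \<bullet> w"
      by (intro tendsto_intros rep_lim.hyps)
    moreover have "(\<lambda>n. (c *\<^sub>C E S (delta 0)) \<bullet> v n) \<longlonglongrightarrow> (\<integral>t. (c * indicator S t) \<bullet> g t \<partial>mu)"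
      unfolding rep_lim.IH inner_commute[of "c * indicator S _"]
      by (rule tendsto_L2_inner) (use rep_lim.hyps rep_L2 L2_indicator \<open>S \<in> sets borel\<close> in auto)
    ultimately show ?case by (rule LIMSEQ_unique)
  qed
next
  case (rep_add v f v' f' w g)
  then show ?case by (simp add: inner_add_left L2_space_integrable_inner rep_L2)
next
  case (rep_lim v f v' f' w g)
  have "(\<lambda>n. v n \<bullet> w) \<longlonglongrightarrow> v' \<bullet> w" by (intro tendsto_intros rep_lim.hyps)
  moreover have "(\<lambda>n. v n \<bullet> w) \<longlonglongrightarrow> (\<integral>t. f' t \<bullet> g t \<partial>mu)"
    unfolding rep_lim.IH[OF rep_lim.prems]
    using rep_L2[OF rep_lim.hyps(1)] rep_lim.hyps rep_L2[OF rep_lim.prems]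
    by (intro tendsto_L2_inner)
  ultimately show ?case by (rule LIMSEQ_unique)
qed

lemma norm_rep: "rep v f \<Longrightarrow> (norm v)\<^sup>2 = sqn mu f"
  by (simp add: power2_norm_eq_inner inner_rep sqn_inner)

lemma rep_diff: "rep v f \<Longrightarrow> rep w g \<Longrightarrow> rep (v - w) (\<lambda>t. f t - g t)"
  using rep_add[of v f "(-1) *\<^sub>C w" "\<lambda>t. (-1) * g t"] rep_scale[of w g "-1"]
  by (simp add: scaleC_simps)

lemma rep_unique: "rep v f \<Longrightarrow> rep w f \<Longrightarrow> v = w"
  using norm_rep[OF rep_diff, of v f w f] by (simp add: sqn_def)

lemma rep_zero: "rep 0 (\<lambda>_. 0)"
  using rep_base[of "{}" 0] by (simp add: scaleC_simps)

lemma rep_sum: "(\<And>i. i \<in> A \<Longrightarrow> rep (v i) (f i)) \<Longrightarrow> rep (\<Sum>i\<in>A. v i) (\<lambda>t. \<Sum>i\<in>A. f i t)"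
  by (induction A rule: infinite_finite_induct) (auto intro: rep_zero rep_add)

text \<open>\<open>inner_rep\<close> gives the real part; replacing v by i v gives the imaginary
  part.\<close>

lemma cinner_rep:
  assumes "rep v f" "rep w g"
  shows "cinner v w = (\<integral>t. cnj (f t) * g t \<partial>mu)"
proof -
  have i: "integrable mu (\<lambda>t. cnj (f t) * g t)"
    by (intro L2_space_integrable_mult rep_L2[OF assms(1)] rep_L2[OF assms(2)])
  have "v \<bullet> w = Re (\<integral>t. cnj (f t) * g t \<partial>mu)"
    using inner_rep[OF assms] unfolding inner_complex_Re integral_Re[OF i] .
  moreover have "(\<i> *\<^sub>C v) \<bullet> w = Im (\<integral>t. cnj (f t) * g t \<partial>mu)"
  proof -
    have "(\<i> *\<^sub>C v) \<bullet> w = (\<integral>t. Im (cnj (f t) * g t) \<partial>mu)"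
      using inner_rep[OF rep_scale[OF assms(1), of \<i>] assms(2)] by (simp add: inner_complex_Re)
    then show ?thesis unfolding integral_Im[OF i] .
  qed
  ultimately show ?thesis by (simp add: cinner_alt)
qed

text \<open>The isometry makes the vectors Cauchy, and \<open>ell2\<close> is complete.\<close>

lemma rep_limit_exists:
  assumes r: "\<And>n::nat. rep (v n) (f n)" and g: "g \<in> L2_space mu"
    and lim: "(\<lambda>n. sqn mu (\<lambda>t. f n t - g t)) \<longlonglongrightarrow> 0"
  shows "\<exists>w. rep w g"
proof -
  have "Cauchy v"
  proof (rule metric_CauchyI)
    fix e :: real assume "e > 0"
    then have "e\<^sup>2 / 4 > 0" by simp
    then have "\<forall>\<^sub>F n in sequentially. sqn mu (\<lambda>t. f n t - g t) < e\<^sup>2 / 4"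
      by (rule order_tendstoD(2)[OF lim])
    then obtain N where N: "\<And>n. n \<ge> N \<Longrightarrow> sqn mu (\<lambda>t. f n t - g t) < e\<^sup>2 / 4"
      by (auto simp: eventually_sequentially)
    have "dist (v m) (v n) < e" if "m \<ge> N" "n \<ge> N" for m n
    proof (rule power_less_imp_less_base)
      have "(dist (v m) (v n))\<^sup>2 = sqn mu (\<lambda>t. f m t - f n t)"
        by (simp add: dist_norm norm_rep[OF rep_diff[OF r r]])
      also have "\<dots> \<le> 2 * sqn mu (\<lambda>t. f m t - g t) + 2 * sqn mu (\<lambda>t. g t - f n t)"
        using rep_L2[OF r] g by (intro sqn_triangle) auto
      also have "\<dots> < e\<^sup>2"
        using N[OF that(1)] N[OF that(2)] sqn_minus_commute[of mu g "f n"] by simp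
      finally show "(dist (v m) (v n))\<^sup>2 < e\<^sup>2" .
    qed (use \<open>e > 0\<close> in simp)
    then show "\<exists>M. \<forall>m\<ge>M. \<forall>n\<ge>M. dist (v m) (v n) < e" by blast
  qed
  then obtain w where "v \<longlonglongrightarrow> w" by (metis Cauchy_convergent_iff convergent_def)
  then show ?thesis using rep_lim[OF r _ g lim] by blast
qed

lemma rep_simple:
  assumes s: "simple_function mu (s :: real \<Rightarrow> complex)"
  shows "\<exists>v. rep v s"
proof -
  have fin: "finite (range s)" using s by (simp add: simple_function_def)
  have sb: "s -` {y} \<in> sets borel" if "y \<in> range s" for y
    using s that by (auto simp: simple_function_def)
  have "rep (\<Sum>y\<in>range s. y *\<^sub>C E (s -` {y}) (delta 0)) (\<lambda>t. \<Sum>y\<in>range s. y * indicator (s -` {y}) t)"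
    by (intro rep_sum rep_base sb)
  moreover have "(\<Sum>y\<in>range s. y * indicator (s -` {y}) t) = s t" for t
  proof -
    have "(\<Sum>y\<in>range s. y * indicator (s -` {y}) t) = (\<Sum>y\<in>range s. if y = s t then y else 0)"
      by (intro sum.cong) (auto simp: indicator_def)
    then show ?thesis using fin by simp
  qed
  ultimately show ?thesis by auto
qed

lemma rep_exists:
  assumes g: "g \<in> L2_space mu"
  shows "\<exists>w. rep w g"
proof -
  have "g \<in> borel_measurable mu" using g by (rule L2_spaceD)
  then obtain F where F: "\<And>i. simple_function mu (F i)"
      "\<And>t. t \<in> space mu \<Longrightarrow> (\<lambda>i. F i t) \<longlonglongrightarrow> g t" "\<And>i t. t \<in> space mu \<Longrightarrow> dist (F i t) 0 \<le> 2 * dist (g t) 0"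
    using borel_measurable_implies_sequence_metric[of g mu 0] by blast
  have "\<forall>i. \<exists>v. rep v (F i)" using rep_simple F(1) by blast
  then obtain v where "\<And>i. rep (v i) (F i)" by metis
  then show ?thesis
    using F g by (intro rep_limit_exists tendsto_sqn_dominated[where c = 2])
      (auto intro: borel_measurable_simple_function)
qed

text \<open>Follows from \<open>rep_E\<close> and \<open>inner_rep\<close>. It translates the
  conditions on scalar measures in \<open>is_spectral_measure\<close> into integrals against
  \<open>mu\<close>.\<close>

lemma scalar_measure_rep:
  assumes r: "rep v f"
  shows "scalar_measure E v = density mu (\<lambda>t. ennreal ((cmod (f t))\<^sup>2))"
proof (rule measure_eqI)
  have f [measurable]: "f \<in> borel_measurable borel"
    using L2_spaceD(1)[OF rep_L2[OF r]] by simp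
  show "sets (scalar_measure E v) = sets (density mu (\<lambda>t. ennreal ((cmod (f t))\<^sup>2)))" by simp
  fix S assume "S \<in> sets (scalar_measure E v)"
  then have S [measurable]: "S \<in> sets borel" by simp
  have "emeasure (scalar_measure E v) S = ennreal (\<integral>t. f t \<bullet> (indicator S t * f t) \<partial>mu)"
    by (simp add: emeasure_scalar_measure S inner_rep[OF r rep_E[OF r S]])
  also have "\<dots> = (\<integral>\<^sup>+ t. ennreal (f t \<bullet> (indicator S t * f t)) \<partial>mu)"
    using L2_space_integrable_inner[OF rep_L2[OF r] rep_L2[OF rep_E[OF r S]]]
    by (intro nn_integral_eq_integral[symmetric]) (auto simp: indicator_def)
  also have "\<dots> = (\<integral>\<^sup>+ t. ennreal ((cmod (f t))\<^sup>2) * indicator S t \<partial>mu)"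
    by (intro nn_integral_cong) (auto simp: indicator_def power2_norm_eq_inner)
  also have "\<dots> = emeasure (density mu (\<lambda>t. ennreal ((cmod (f t))\<^sup>2))) S"
    by (rule emeasure_density[symmetric]) auto
  finally show "emeasure (scalar_measure E v) S = emeasure (density mu (\<lambda>t. ennreal ((cmod (f t))\<^sup>2))) S" .
qed

end

section \<open>The spectral theorem on the cyclic subspace\<close>

locale spectral = pvm E for E +
  fixes Jt :: operator
  assumes sa: "selfadjoint Jt" and spec: "is_spectral_measure Jt E"
begin

lemma Jt_add: "(x, y) \<in> Jt \<Longrightarrow> (x', y') \<in> Jt \<Longrightarrow> (x + x', y + y') \<in> Jt"
  and Jt_scale: "(x, y) \<in> Jt \<Longrightarrow> (c *\<^sub>C x, c *\<^sub>C y) \<in> Jt"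
  and Jt_unique: "(x, y) \<in> Jt \<Longrightarrow> (x, z) \<in> Jt \<Longrightarrow> y = z"
proof -
  have lin: "linear_operator Jt" using sa by (simp add: selfadjoint_def)
  then show "(x, y) \<in> Jt \<Longrightarrow> (x', y') \<in> Jt \<Longrightarrow> (x + x', y + y') \<in> Jt"
    and "(x, y) \<in> Jt \<Longrightarrow> (c *\<^sub>C x, c *\<^sub>C y) \<in> Jt"
    by (simp_all add: linear_operator_def)
  have "single_valued Jt" using lin by (simp add: linear_operator_def)
  then show "(x, y) \<in> Jt \<Longrightarrow> (x, z) \<in> Jt \<Longrightarrow> y = z" by (rule single_valuedD)
qed

lemma Jt_diff: "(x, y) \<in> Jt \<Longrightarrow> (x', y') \<in> Jt \<Longrightarrow> (x - x', y - y') \<in> Jt"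
  using Jt_add[of x y "- x'" "- y'"] Jt_scale[of x' y' "-1"] by (simp add: scaleC_simps)

lemma Jt_iff_adjoint: "(y, z) \<in> Jt \<longleftrightarrow> (\<forall>(x, w)\<in>Jt. cinner y w = cinner z x)"
proof -
  have "(y, z) \<in> adjoint_op Jt \<longleftrightarrow> (\<forall>(x, w)\<in>Jt. cinner y w = cinner z x)"
    by (auto simp: adjoint_op_def)
  then show ?thesis using sa by (simp add: selfadjoint_def)
qed

lemma Jt_sym: "(x, w) \<in> Jt \<Longrightarrow> (y, z) \<in> Jt \<Longrightarrow> y \<bullet> w = z \<bullet> x"
  using Jt_iff_adjoint[of y z] by (auto simp: inner_ell2_def)

lemma Jt_Domain: "x \<in> Domain Jt \<longleftrightarrow> integrable (scalar_measure E x) (\<lambda>t. t\<^sup>2)"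
  using spec by (auto simp: is_spectral_measure_def)

lemma Jt_quadratic:
  assumes "(x, y) \<in> Jt"
  shows "x \<bullet> y = (\<integral>t. t \<partial>scalar_measure E x)"
proof -
  have "cinner x y = of_real (\<integral>t. t \<partial>scalar_measure E x)"
    using spec assms by (auto simp: is_spectral_measure_def)
  then show ?thesis by (simp add: inner_ell2_def)
qed

text \<open>The symmetry of \<open>Jt\<close> makes the two cross terms equal, so two terms of
  polarization recover the real inner product.\<close>

lemma Jt_polarization:
  assumes "(v, w) \<in> Jt" "(z, y) \<in> Jt"
  shows "4 * (z \<bullet> w) = (\<integral>t. t \<partial>scalar_measure E (v + z)) - (\<integral>t. t \<partial>scalar_measure E (v - z))"
proof -
  have "(v + z) \<bullet> (w + y) - (v - z) \<bullet> (w - y) = 2 * (z \<bullet> w) + 2 * (v \<bullet> y)"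
    by (simp add: inner_simps)
  also have "v \<bullet> y = z \<bullet> w"
    using Jt_sym[OF assms] by (simp add: inner_commute)
  finally show ?thesis
    using Jt_quadratic[OF Jt_add[OF assms]] Jt_quadratic[OF Jt_diff[OF assms]] by simp
qed

text \<open>Under \<open>orth\<close> the vectors v + z and v - z have the same scalar measure, so
  polarization gives zero. This stands in for the commutation of \<open>Jt\<close> with
  \<open>E\<close>: tested against domain vectors, the image of v lies in the cyclic subspace of
  v.\<close>

lemma Jt_orthogonal:
  assumes "(v, w) \<in> Jt" "(z, y) \<in> Jt" and orth: "\<And>S. S \<in> sets borel \<Longrightarrow> z \<bullet> E S v = 0"
  shows "z \<bullet> w = 0"
proof -
  have "scalar_measure E (v + z) = scalar_measure E (v - z)"
  proof (rule scalar_measure_eqI)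
    fix S :: "real set" assume S: "S \<in> sets borel"
    have "z \<bullet> E S v = 0" by (rule orth[OF S])
    moreover have "v \<bullet> E S z = 0" using orth[OF S] E_inner[OF S, of v z] inner_commute[of z] by simp
    ultimately show "(v + z) \<bullet> E S (v + z) = (v - z) \<bullet> E S (v - z)"
      by (simp add: E_add E_diff S inner_simps)
  qed
  then show ?thesis using Jt_polarization[OF assms(1,2)] by simp
qed

text \<open>The scalar measure of \<open>E S v\<close> is finite and concentrated on S, where t^2 is
  bounded.\<close>

lemma bounded_in_Domain:
  assumes S [measurable]: "S \<in> sets borel" and bd: "S \<subseteq> {- r..r}"
  shows "E S v \<in> Domain Jt"
proof -
  let ?M = "scalar_measure E (E S v)"
  interpret finite_measure ?M by (rule finite_scalar_measure)
  have "emeasure ?M (- S) = 0"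
    using S by (simp add: emeasure_scalar_measure E_disjoint)
  then have "AE t in ?M. t \<notin> - S"
    by (intro AE_not_in) (simp add: null_sets_def S)
  then have "AE t in ?M. norm (t\<^sup>2) \<le> r\<^sup>2"
  proof eventually_elim
    case (elim t)
    then have "\<bar>t\<bar> \<le> r" using bd by (force simp: abs_le_iff)
    then show ?case by (simp add: abs_le_square_iff[symmetric])
  qed
  then have "integrable ?M (\<lambda>t. t\<^sup>2)"
    by (rule integrable_const_bound) simp
  then show ?thesis by (simp add: Jt_Domain)
qed

lemma rep_Domain_L2:
  assumes r: "rep v f" and v: "v \<in> Domain Jt"
  shows "(\<lambda>t. of_real t * f t) \<in> L2_space mu"
proof -
  have [measurable]: "f \<in> borel_measurable borel"
    using L2_spaceD(1)[OF rep_L2[OF r]] by simp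
  have "integrable (density mu (\<lambda>t. ennreal ((cmod (f t))\<^sup>2))) (\<lambda>t. t\<^sup>2)"
    using v by (simp add: Jt_Domain scalar_measure_rep[OF r])
  then have "integrable mu (\<lambda>t. (cmod (f t))\<^sup>2 * t\<^sup>2)"
    by (subst (asm) integrable_real_density) auto
  then show ?thesis
    by (simp add: L2_space_def norm_mult power_mult_distrib mult.commute)
qed

lemma integral_scalar_measure_rep:
  assumes r: "rep v f"
  shows "(\<integral>t. t \<partial>scalar_measure E v) = (\<integral>t. (cmod (f t))\<^sup>2 * t \<partial>mu)"
proof -
  have [measurable]: "f \<in> borel_measurable borel"
    using L2_spaceD(1)[OF rep_L2[OF r]] by simp
  show ?thesis
    unfolding scalar_measure_rep[OF r] by (rule integral_real_density) auto
qed

text \<open>Both sides are polarized: the scalar measures of v + z and v - z have the densities |f +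
  g|^2 and |f - g|^2 with respect to \<open>mu\<close>.\<close>

lemma Jt_inner_rep:
  assumes f: "rep v f" "(v, w) \<in> Jt" and g: "rep z g" "(z, y) \<in> Jt"
  shows "z \<bullet> w = (\<integral>t. g t \<bullet> (of_real t * f t) \<partial>mu)"
proof -
  have dom: "v \<in> Domain Jt" "z \<in> Domain Jt" "v + z \<in> Domain Jt" "v - z \<in> Domain Jt"
    using f(2) g(2) Jt_add Jt_diff by blast+
  have eq: "(cmod (h t))\<^sup>2 * t = h t \<bullet> (of_real t * h t)" for h t
    unfolding cmod_power2 by (simp add: inner_complex_def algebra_simps power2_eq_square)
  have int: "integrable mu (\<lambda>t. (cmod (h t))\<^sup>2 * t)" if "rep x h" "x \<in> Domain Jt" for x h
    unfolding eq by (intro L2_space_integrable_inner rep_L2[OF that(1)] rep_Domain_L2[OF that])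
  note fg = rep_add[OF f(1) g(1)] rep_diff[OF f(1) g(1)]
  have "4 * (z \<bullet> w) = (\<integral>t. (cmod (f t + g t))\<^sup>2 * t \<partial>mu) - (\<integral>t. (cmod (f t - g t))\<^sup>2 * t \<partial>mu)"
    using Jt_polarization[OF f(2) g(2)]
    unfolding integral_scalar_measure_rep[OF fg(1)] integral_scalar_measure_rep[OF fg(2)] .
  also have "\<dots> = (\<integral>t. (cmod (f t + g t))\<^sup>2 * t - (cmod (f t - g t))\<^sup>2 * t \<partial>mu)"
    using int[OF fg(1) dom(3)] int[OF fg(2) dom(4)] by simp
  also have "\<dots> = (\<integral>t. 4 * (g t \<bullet> (of_real t * f t)) \<partial>mu)"
    unfolding cmod_power2
    by (intro Bochner_Integration.integral_cong)
      (auto simp: inner_complex_def algebra_simps power2_eq_square)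
  finally show ?thesis by simp
qed

text \<open>The vector \<open>u\<close> measures the failure of the claim. It is orthogonal to the vectors in the domain
  that lie in the cyclic subspace, so its truncations \<open>E (K n) u\<close> are orthogonal to \<open>E S v\<close>, hence to
  \<open>w\<close> by \<open>Jt_orthogonal\<close>, and to \<open>w0\<close>.\<close>

lemma Jt_rep:
  assumes f: "rep v f" and vw: "(v, w) \<in> Jt"
  shows "rep w (\<lambda>t. of_real t * f t)"
proof -
  obtain w0 where w0: "rep w0 (\<lambda>t. of_real t * f t)"
    using rep_exists[OF rep_Domain_L2[OF f]] vw by blast
  define u where "u = w - w0"
  have orth: "z \<bullet> u = 0" if "rep z g" "z \<in> Domain Jt" for z g
    using Jt_inner_rep[OF f vw that(1)] inner_rep[OF that(1) w0] that(2)
    by (auto simp: u_def inner_simps)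
  define K where "K n = {- real n..real n}" for n
  have K: "K n \<in> sets borel" for n by (simp add: K_def)
  have KS: "(E (S \<inter> K n) z) \<bullet> u = 0" if "S \<in> sets borel" "rep z g" for n S z g
    using that K by (intro orth[OF rep_E[OF that(2)]] bounded_in_Domain[of _ "real n"]) (auto simp: K_def)
  have "E (K n) u = 0" for n
  proof -
    let ?x = "E (K n) u"
    have "?x \<in> Domain Jt" by (rule bounded_in_Domain[OF K, of _ "real n"]) (auto simp: K_def)
    then obtain y where "(?x, y) \<in> Jt" by blast
    moreover have "?x \<bullet> E S v = 0" if "S \<in> sets borel" for S
      using KS[OF that f, of n] by (simp add: E_inner K E_Int that Int_commute inner_commute[of u])
    ultimately have "?x \<bullet> w = 0" by (rule Jt_orthogonal[OF vw])
    moreover have "?x \<bullet> w0 = 0"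
      using KS[OF _ w0, of UNIV n] by (simp add: E_inner K inner_commute[of u])
    ultimately have "?x \<bullet> u = 0" by (simp add: u_def inner_simps)
    then have "(norm ?x)\<^sup>2 = 0" by (simp add: norm_E_sq K inner_commute)
    then show ?thesis by simp
  qed
  moreover have "(\<lambda>n. E (K n) u) \<longlonglongrightarrow> u"
  proof (rule E_lim)
    show "incseq K" by (auto simp: incseq_def K_def)
    show "(\<Union>n. K n) = UNIV"
    proof -
      have "\<exists>n. x \<in> K n" for x
      proof -
        obtain n where "\<bar>x\<bar> \<le> real n" using real_arch_simple by blast
        then have "x \<in> K n" by (simp add: K_def abs_le_iff)
        then show ?thesis ..
      qed
      then show ?thesis by blast
    qed
  qed (use K in auto)
  ultimately have "u = 0" by (simp add: LIMSEQ_const_iff)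
  then show ?thesis using w0 by (simp add: u_def)
qed

end

section \<open>Orthonormal polynomials\<close>

text \<open>The leading term is stripped off by induction. The bounds are put on coefficients
  instead of \<open>degree\<close> so that n = 0 means p = 0, which \<open>degree\<close> cannot
  tell from a nonzero constant.\<close>

lemma poly_span:
  fixes R :: "nat \<Rightarrow> 'a::field poly"
  assumes R: "\<And>k. coeff (R k) k \<noteq> 0" "\<And>k i. i > k \<Longrightarrow> coeff (R k) i = 0"
    and p: "\<And>i. i \<ge> n \<Longrightarrow> coeff p i = 0"
  shows "\<exists>c. p = (\<Sum>k<n. smult (c k) (R k))"
  using p
proof (induction n arbitrary: p)
  case 0
  then show ?case by (auto simp: poly_eq_iff)
next
  case (Suc n)
  define r where "r = p - smult (coeff p n / coeff (R n) n) (R n)"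
  have "coeff r i = 0" if "i \<ge> n" for i
    using that R Suc.prems[of i] by (cases "i = n") (auto simp: r_def)
  then obtain c where c: "r = (\<Sum>k<n. smult (c k) (R k))" using Suc.IH by blast
  define c' where "c' = c(n := coeff p n / coeff (R n) n)"
  have "p = r + smult (c' n) (R n)" by (simp add: r_def c'_def)
  also have "r = (\<Sum>k<n. smult (c' k) (R k))"
    unfolding c by (intro sum.cong) (auto simp: c'_def)
  finally show ?case by (intro exI[of _ c']) simp
qed

text \<open>The positive leading coefficient removes the sign ambiguity and makes the sequence
  unique, see \<open>gram_schmidt_unique\<close>.\<close>

definition orthonormal_polys :: "real measure \<Rightarrow> (nat \<Rightarrow> real poly) \<Rightarrow> bool" where
  "orthonormal_polys M R \<longleftrightarrow>
     (\<forall>k. coeff (R k) k > 0 \<and> (\<forall>i>k. coeff (R k) i = 0)) \<and>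
     (\<forall>j k. poly_inner M (R j) (R k) = (if j = k then 1 else 0))"

locale all_moments =
  fixes M :: "real measure"
  assumes moment: "integrable M (\<lambda>t. t ^ k)"
begin

lemma integrable_poly: "integrable M (poly p)"
proof -
  have "integrable M (\<lambda>t. \<Sum>i\<le>degree p. coeff p i * t ^ i)"
    using moment by (intro Bochner_Integration.integrable_sum) auto
  then show ?thesis by (simp add: poly_altdef[abs_def])
qed

lemma integrable_poly_mult: "integrable M (\<lambda>t. poly p t * poly r t)"
  using integrable_poly[of "p * r"] by (simp add: poly_mult[abs_def])

lemma poly_inner_commute: "poly_inner M p r = poly_inner M r p"
  by (simp add: poly_inner_def mult.commute)

lemma poly_inner_add_right: "poly_inner M s (p + r) = poly_inner M s p + poly_inner M s r"
  by (simp add: poly_inner_def distrib_left integrable_poly_mult)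

lemma poly_inner_smult_right: "poly_inner M s (smult c p) = c * poly_inner M s p"
  by (simp add: poly_inner_def mult.left_commute)

lemma poly_inner_smult_left: "poly_inner M (smult c p) s = c * poly_inner M p s"
  by (simp add: poly_inner_def mult.assoc)

lemma poly_inner_diff_right: "poly_inner M s (p - r) = poly_inner M s p - poly_inner M s r"
  by (simp add: poly_inner_def right_diff_distrib integrable_poly_mult)

lemma poly_inner_sum_right: "poly_inner M s (\<Sum>i\<in>A. f i) = (\<Sum>i\<in>A. poly_inner M s (f i))"
  by (induction A rule: infinite_finite_induct) (auto simp: poly_inner_add_right poly_inner_def[of _ _ 0])

lemma poly_inner_mult: "poly_inner M (r * p) s = poly_inner M p (r * s)"
  by (simp add: poly_inner_def mult_ac)

text \<open>Degree, sign, orthogonality and norm go through one strong induction. The unnormalized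
  \<open>p\<close> has leading coefficient 1, hence is nonzero, and \<open>pos\<close> makes the
  normalization legitimate.\<close>

lemma gram_schmidt_orthonormal:
  assumes pos: "\<And>p. p \<noteq> 0 \<Longrightarrow> poly_inner M p p > 0"
  shows "orthonormal_polys M (gram_schmidt M)"
proof -
  let ?g = "gram_schmidt M"
  have main: "coeff (?g k) k > 0 \<and> (\<forall>i>k. coeff (?g k) i = 0) \<and>
      (\<forall>j<k. poly_inner M (?g j) (?g k) = 0) \<and> poly_inner M (?g k) (?g k) = 1" for k
  proof (induction k rule: less_induct)
    case (less k)
    define p where "p = monom 1 k - (\<Sum>j<k. smult (poly_inner M (?g j) (monom 1 k)) (?g j))"
    define N where "N = poly_inner M p p"
    have gk: "?g k = smult (1 / sqrt N) p"
      by (simp add: gram_schmidt.simps[of M k] Let_def p_def N_def)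
    have cp: "coeff p k = 1" "\<And>i. i > k \<Longrightarrow> coeff p i = 0"
      using less.IH by (auto simp: p_def coeff_sum intro!: sum.neutral)
    then have "N > 0" unfolding N_def by (intro pos) auto
    have "poly_inner M (?g j) p = 0" if j: "j < k" for j
    proof -
      have ip: "poly_inner M (?g j) (?g i) = (if i = j then 1 else 0)" if "i < k" for i
        using less.IH[OF j] less.IH[OF that] poly_inner_commute[of "?g i" "?g j"]
        by (cases i j rule: linorder_cases) auto
      have "(\<Sum>i<k. poly_inner M (?g i) (monom 1 k) * poly_inner M (?g j) (?g i))
          = (\<Sum>i<k. if i = j then poly_inner M (?g j) (monom 1 k) else 0)"
        by (intro sum.cong) (auto simp: ip)
      then show ?thesis
        using j by (simp add: p_def poly_inner_diff_right poly_inner_sum_right poly_inner_smult_right)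
    qed
    then show ?case
      using cp \<open>N > 0\<close>
      by (simp add: gk poly_inner_smult_right poly_inner_smult_left N_def[symmetric] field_simps)
  qed
  have "poly_inner M (?g j) (?g k) = (if j = k then 1 else 0)" for j k
    using main[of j] main[of k] poly_inner_commute[of "?g j" "?g k"]
    by (cases j k rule: linorder_cases) auto
  then show ?thesis using main by (simp add: orthonormal_polys_def)
qed

section \<open>Jacobi parameters of an orthonormal sequence of polynomials\<close>

context
  fixes R :: "nat \<Rightarrow> real poly"
  assumes R: "orthonormal_polys M R"
begin

lemma orthonormal_polysD:
  "coeff (R k) k > 0" "i > k \<Longrightarrow> coeff (R k) i = 0"
  "poly_inner M (R j) (R k) = (if j = k then 1 else 0)"
  using R by (auto simp: orthonormal_polys_def)

lemma orthonormal_polys_expansion: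
  assumes "\<And>i. i \<ge> n \<Longrightarrow> coeff p i = 0"
  shows "p = (\<Sum>k<n. smult (poly_inner M (R k) p) (R k))"
proof -
  obtain c where c: "p = (\<Sum>k<n. smult (c k) (R k))"
    using poly_span[of R n p] orthonormal_polysD(1,2) assms by (metis less_irrefl)
  have "poly_inner M (R j) p = c j" if "j < n" for j
  proof -
    have "poly_inner M (R j) p = (\<Sum>k<n. if k = j then c j else 0)"
      unfolding c poly_inner_sum_right poly_inner_smult_right
      by (intro sum.cong) (auto simp: orthonormal_polysD(3))
    then show ?thesis using that by simp
  qed
  then show ?thesis by (subst c) (auto intro: sum.cong)
qed

lemma poly_inner_low_degree:
  assumes "\<And>i. i \<ge> k \<Longrightarrow> coeff p i = 0"
  shows "poly_inner M (R k) p = 0"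
proof -
  have "poly_inner M (R k) p = poly_inner M (R k) (\<Sum>j<k. smult (poly_inner M (R j) p) (R j))"
    using orthonormal_polys_expansion[OF assms] by simp
  also have "\<dots> = 0"
    unfolding poly_inner_sum_right poly_inner_smult_right
    by (intro sum.neutral) (auto simp: orthonormal_polysD(3))
  finally show ?thesis .
qed

text \<open>Removing from the expansion of t^k in the \<open>R j\<close> all terms below k leaves a
  multiple \<open>a\<close> of \<open>R k\<close>. Comparing leading coefficients gives
  \<open>a > 0\<close>, and normalization cancels it.\<close>

lemma gram_schmidt_unique: "gram_schmidt M k = R k"
proof (induction k rule: less_induct)
  case (less k)
  define a where "a = poly_inner M (R k) (monom 1 k)"
  have m: "monom 1 k = (\<Sum>j<Suc k. smult (poly_inner M (R j) (monom 1 k)) (R j))"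
    by (rule orthonormal_polys_expansion) auto
  have p: "monom 1 k - (\<Sum>j<k. smult (poly_inner M (gram_schmidt M j) (monom 1 k)) (gram_schmidt M j))
      = smult a (R k)"
    using m less.IH by (simp add: a_def)
  have "coeff (monom 1 k) k = coeff (\<Sum>j<Suc k. smult (poly_inner M (R j) (monom 1 k)) (R j)) k"
    using m by simp
  also have "\<dots> = a * coeff (R k) k"
    by (simp add: coeff_sum a_def orthonormal_polysD(2))
  finally have "a > 0"
    using orthonormal_polysD(1)[of k] by (simp add: zero_less_mult_iff) (metis zero_less_mult_pos2 zero_less_one)
  then show ?case
    by (simp add: gram_schmidt.simps[of M k] Let_def p poly_inner_smult_left poly_inner_smult_right
        orthonormal_polysD(3))
qed

definition rec_q :: "nat \<Rightarrow> real" where "rec_q k = poly_inner M (R k) ([:0, 1:] * R k)"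
definition rec_b :: "nat \<Rightarrow> real" where "rec_b k = poly_inner M (R (Suc k)) ([:0, 1:] * R k)"

lemma coeff_X_mult: "coeff ([:0, 1:] * p) i = (if i = 0 then 0 else coeff p (i - 1))" for p :: "real poly"
  by (cases i) auto

text \<open>Multiplication by t raises the degree by one, which kills the entries below the
  subdiagonal; its symmetry gives the rest.\<close>

lemma poly_inner_recurrence:
  "poly_inner M (R i) ([:0, 1:] * R j) =
     (if i = j then rec_q i else if j = Suc i then rec_b i else if i = Suc j then rec_b j else 0)"
proof -
  have low: "poly_inner M (R i) ([:0, 1:] * R j) = 0" if "i > Suc j" for i j
    using that by (intro poly_inner_low_degree) (auto simp: coeff_X_mult orthonormal_polysD(2) simp del: mult_pCons_left)
  have sym: "poly_inner M (R i) ([:0, 1:] * R j) = poly_inner M (R j) ([:0, 1:] * R i)" for i j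
    using poly_inner_mult[of "[:0, 1:]" "R j" "R i"] by (metis poly_inner_commute)
  consider "i = j" | "j = Suc i" | "i = Suc j" | "i > Suc j" | "j > Suc i" by linarith
  then show ?thesis
    by cases (use low sym[of i j] in \<open>auto simp: rec_q_def rec_b_def\<close>)
qed

text \<open>Compare the coefficients of t^(k + 1) in the expansion of t \<open>R k\<close>: the last
  term alone contributes, and both leading coefficients are positive.\<close>

lemma rec_b_pos: "rec_b k > 0"
proof -
  let ?p = "[:0, 1:] * R k"
  have e: "?p = (\<Sum>j<Suc (Suc k). smult (poly_inner M (R j) ?p) (R j))"
    by (rule orthonormal_polys_expansion) (auto simp: coeff_X_mult orthonormal_polysD(2) simp del: mult_pCons_left)
  have "coeff (R k) k = coeff ?p (Suc k)" by simp
  also have "\<dots> = (\<Sum>j<Suc (Suc k). poly_inner M (R j) ?p * coeff (R j) (Suc k))"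
    by (subst e) (simp only: coeff_sum coeff_smult)
  also have "\<dots> = rec_b k * coeff (R (Suc k)) (Suc k)"
    by (simp add: rec_b_def orthonormal_polysD(2) del: mult_pCons_left)
  finally show ?thesis
    using orthonormal_polysD(1)[of k] orthonormal_polysD(1)[of "Suc k"]
    by (metis zero_less_mult_pos2)
qed

lemma three_term: "three_term_recurrence R rec_q rec_b"
proof -
  have e: "[:0, 1:] * R k = (\<Sum>j<Suc (Suc k). smult (poly_inner M (R j) ([:0, 1:] * R k)) (R j))" for k
    by (rule orthonormal_polys_expansion) (auto simp: coeff_X_mult orthonormal_polysD(2) simp del: mult_pCons_left)
  have "[:0, 1:] * R 0 = smult (rec_q 0) (R 0) + smult (rec_b 0) (R 1)"
    by (subst e) (simp add: poly_inner_recurrence del: mult_pCons_left)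
  moreover have "[:0, 1:] * R (Suc k) = smult (rec_b k) (R k) + smult (rec_q (Suc k)) (R (Suc k))
      + smult (rec_b (Suc k)) (R (Suc (Suc k)))" for k
  proof -
    have "(\<Sum>j<k. smult (poly_inner M (R j) ([:0, 1:] * R (Suc k))) (R j)) = 0"
      by (intro sum.neutral) (auto simp: poly_inner_recurrence simp del: mult_pCons_left)
    then show ?thesis
      by (subst e) (simp add: poly_inner_recurrence del: mult_pCons_left)
  qed
  ultimately show ?thesis
    unfolding three_term_recurrence_def by (auto simp: Suc_le_eq gr0_conv_Suc simp del: mult_pCons_left)
qed

end

end

section \<open>Completeness of \<open>L\<^sub>2\<close> and density of polynomials\<close>

text \<open>On a finite measure space geometric decay in L2 yields geometric decay in L1, and an
  integrable sum of moduli is finite almost everywhere.\<close>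

lemma summable_AE_of_L2_geometric:
  fixes d :: "nat \<Rightarrow> real \<Rightarrow> complex"
  assumes fin: "finite_measure M" and d: "\<And>j. d j \<in> L2_space M"
    and bd: "\<And>j. sqn M (d j) \<le> (1/4) ^ j"
  shows "AE t in M. summable (\<lambda>j. d j t)"
proof -
  interpret finite_measure M by (rule fin)
  have [measurable]: "d j \<in> borel_measurable M" for j using d by (rule L2_spaceD)
  define B where "B = (measure M (space M) + 1) / 2"
  have I: "(\<integral>\<^sup>+ t. ennreal (cmod (d j t)) \<partial>M) \<le> ennreal (B * (1/2) ^ j)" for j
  proof -
    have pw: "cmod z \<le> (1/2) ^ j / 2 + 2 ^ j / 2 * (cmod z)\<^sup>2" for z
    proof -
      \<comment> \<open>The scaling 2^j balances the constant term against the bound (1/4)^j: both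
        halves become of order (1/2)^j.\<close>
      have "0 \<le> (2 ^ j * cmod z - 1)\<^sup>2" by simp
      then show ?thesis
        by (simp add: power_one_over field_simps power2_eq_square)
    qed
    have int: "integrable M (\<lambda>t. (1/2) ^ j / 2 + 2 ^ j / 2 * (cmod (d j t))\<^sup>2)"
      using L2_spaceD(2)[OF d[of j]] by simp
    have "(\<integral>\<^sup>+ t. ennreal (cmod (d j t)) \<partial>M) \<le> (\<integral>\<^sup>+ t. ennreal ((1/2) ^ j / 2 + 2 ^ j / 2 * (cmod (d j t))\<^sup>2) \<partial>M)"
      by (intro nn_integral_mono ennreal_leI pw)
    also have "\<dots> = ennreal (\<integral>t. (1/2) ^ j / 2 + 2 ^ j / 2 * (cmod (d j t))\<^sup>2 \<partial>M)"
      using int by (intro nn_integral_eq_integral) auto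
    also have "(\<integral>t. (1/2) ^ j / 2 + 2 ^ j / 2 * (cmod (d j t))\<^sup>2 \<partial>M)
        = measure M (space M) * ((1/2) ^ j / 2) + 2 ^ j / 2 * sqn M (d j)"
      using L2_spaceD(2)[OF d[of j]] by (simp add: sqn_def)
    also have "\<dots> \<le> measure M (space M) * ((1/2) ^ j / 2) + 2 ^ j / 2 * (1/4) ^ j"
      by (intro add_left_mono mult_left_mono bd) simp
    also have "(2::real) ^ j / 2 * (1/4) ^ j = (1/2) ^ j / 2"
      by (simp add: power_mult_distrib[symmetric])
    finally show ?thesis
      by (simp add: B_def algebra_simps add_divide_distrib ennreal_leI)
  qed
  have B: "B \<ge> 0" by (simp add: B_def)
  have "(\<integral>\<^sup>+ t. (\<Sum>j. ennreal (cmod (d j t))) \<partial>M) = (\<Sum>j. \<integral>\<^sup>+ t. ennreal (cmod (d j t)) \<partial>M)"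
    by (rule nn_integral_suminf) auto
  also have "\<dots> \<le> (\<Sum>j. ennreal (B * (1/2) ^ j))"
    by (intro suminf_le I) auto
  also have "\<dots> = ennreal (\<Sum>j. B * (1/2) ^ j)"
    using B by (intro suminf_ennreal2) auto
  also have "\<dots> < \<infinity>" by simp
  finally have "(\<integral>\<^sup>+ t. (\<Sum>j. ennreal (cmod (d j t))) \<partial>M) \<noteq> \<infinity>" by simp
  then have "AE t in M. (\<Sum>j. ennreal (cmod (d j t))) \<noteq> \<infinity>"
    by (intro nn_integral_noteq_infinite) auto
  then show ?thesis
  proof eventually_elim
    case (elim t)
    then have "summable (\<lambda>j. cmod (d j t))"
      by (intro summable_suminf_not_top) auto
    then show ?case by (rule summable_norm_cancel)
  qed
qed

text \<open>Supplies the function behind a limit of vectors in \<open>rep_surj\<close>. A rapidly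
  Cauchy subsequence converges almost everywhere.\<close>

theorem Riesz_Fischer:
  assumes fin: "finite_measure M" and f: "\<And>n::nat. f n \<in> L2_space M"
    and cauchy: "\<And>e. e > 0 \<Longrightarrow> \<exists>N. \<forall>m\<ge>N. \<forall>n\<ge>N. sqn M (\<lambda>t. f m t - f n t) < e"
  shows "\<exists>g\<in>L2_space M. (\<lambda>n. sqn M (\<lambda>t. f n t - g t)) \<longlonglongrightarrow> 0"
proof -
  have fm [measurable]: "f n \<in> borel_measurable M" for n using f by (rule L2_spaceD)
  have "\<exists>N. \<forall>m\<ge>N. \<forall>n\<ge>N. sqn M (\<lambda>t. f m t - f n t) < (1/4) ^ j" for j :: nat
    by (rule cauchy) simp
  then obtain r where r: "\<And>j m n. m \<ge> r j \<Longrightarrow> n \<ge> r j \<Longrightarrow> sqn M (\<lambda>t. f m t - f n t) < (1/4) ^ j"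
    by metis
  \<comment> \<open>Summing the thresholds makes \<open>s\<close> monotone, at least
    \<open>r j\<close> and at least \<open>j\<close>: the subsequence is rapidly Cauchy and
    eventually enters every tail.\<close>
  define s where "s j = (\<Sum>i\<le>j. r i + 1)" for j
  have s_ge: "r j \<le> s j" "j \<le> s j" for j
  proof -
    have "r j + 1 \<le> s j" unfolding s_def by (rule member_le_sum) auto
    then show "r j \<le> s j" by simp
    have "(\<Sum>i\<le>j. 1) \<le> s j" unfolding s_def by (rule sum_mono) simp
    then show "j \<le> s j" by simp
  qed
  have s_Suc: "s j \<le> s (Suc j)" for j by (simp add: s_def)
  define h where "h j = f (s j)" for j
  have "AE t in M. summable (\<lambda>j. h (Suc j) t - h j t)"
  proof (rule summable_AE_of_L2_geometric[OF fin])
    show "(\<lambda>t. h (Suc j) t - h j t) \<in> L2_space M" for j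
      unfolding h_def by (intro L2_space_diff f)
    show "sqn M (\<lambda>t. h (Suc j) t - h j t) \<le> (1/4) ^ j" for j
      unfolding h_def using s_ge(1)[of j] s_Suc[of j] by (intro r[THEN less_imp_le]) auto
  qed
  then have AE_conv: "AE t in M. (\<lambda>j. h j t) \<longlonglongrightarrow> lim (\<lambda>j. h j t)"
  proof eventually_elim
    case (elim t)
    then have "convergent (\<lambda>n. \<Sum>j<n. h (Suc j) t - h j t)" by (simp add: summable_iff_convergent)
    then have "convergent (\<lambda>n. h n t - h 0 t)"
      by (simp only: sum_lessThan_telescope[of "\<lambda>n. h n t"])
    from convergent_add[OF this convergent_const[of "h 0 t"]] have "convergent (\<lambda>n. h n t)" by simp
    then show ?case by (simp add: convergent_LIMSEQ_iff)
  qed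
  \<comment> \<open>Off the set of convergence, \<open>lim\<close> takes an unspecified value; this
    happens on a null set and leaves \<open>g\<close> measurable.\<close>
  define g where "g t = lim (\<lambda>j. h j t)" for t
  have [measurable]: "h j \<in> borel_measurable M" for j by (simp add: h_def)
  have [measurable]: "g \<in> borel_measurable M" unfolding g_def by measurable
  \<comment> \<open>Fatou's lemma along the subsequence lets the limit inherit the Cauchy
    bound.\<close>
  have key: "\<exists>N. \<forall>n\<ge>N. (\<lambda>t. f n t - g t) \<in> L2_space M \<and> sqn M (\<lambda>t. f n t - g t) \<le> e" if "e > 0" for e
  proof -
    obtain N where N: "\<And>m n. m \<ge> N \<Longrightarrow> n \<ge> N \<Longrightarrow> sqn M (\<lambda>t. f m t - f n t) < e"
      using cauchy[OF \<open>e > 0\<close>] by blast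
    have "(\<lambda>t. f n t - g t) \<in> L2_space M \<and> sqn M (\<lambda>t. f n t - g t) \<le> e" if n: "n \<ge> N" for n
    proof -
      have "(\<integral>\<^sup>+ t. ennreal ((cmod (f n t - g t))\<^sup>2) \<partial>M)
          = (\<integral>\<^sup>+ t. liminf (\<lambda>j. ennreal ((cmod (f n t - h j t))\<^sup>2)) \<partial>M)"
      proof (rule nn_integral_cong_AE)
        from AE_conv show "AE t in M. ennreal ((cmod (f n t - g t))\<^sup>2) = liminf (\<lambda>j. ennreal ((cmod (f n t - h j t))\<^sup>2))"
        proof eventually_elim
          case (elim t)
          then have "(\<lambda>j. ennreal ((cmod (f n t - h j t))\<^sup>2)) \<longlonglongrightarrow> ennreal ((cmod (f n t - g t))\<^sup>2)"
            unfolding g_def by (intro tendsto_ennrealI tendsto_intros)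
          then show ?case by (intro lim_imp_Liminf[symmetric]) simp
        qed
      qed
      also have "\<dots> \<le> liminf (\<lambda>j. \<integral>\<^sup>+ t. ennreal ((cmod (f n t - h j t))\<^sup>2) \<partial>M)"
        by (rule nn_integral_liminf) measurable
      also have "\<dots> \<le> ennreal e"
      proof (rule Liminf_le)
        show "\<forall>\<^sub>F j in sequentially. (\<integral>\<^sup>+ t. ennreal ((cmod (f n t - h j t))\<^sup>2) \<partial>M) \<le> ennreal e"
        proof (rule eventually_sequentiallyI[of N])
          fix j assume "N \<le> j"
          then have "s j \<ge> N" using s_ge(2)[of j] by linarith
          then have "sqn M (\<lambda>t. f n t - h j t) \<le> e"
            unfolding h_def by (intro N[THEN less_imp_le] n)
          moreover have "(\<integral>\<^sup>+ t. ennreal ((cmod (f n t - h j t))\<^sup>2) \<partial>M) = ennreal (sqn M (\<lambda>t. f n t - h j t))"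
            unfolding sqn_def h_def
            by (intro nn_integral_eq_integral L2_spaceD(2) L2_space_diff f) auto
          ultimately show "(\<integral>\<^sup>+ t. ennreal ((cmod (f n t - h j t))\<^sup>2) \<partial>M) \<le> ennreal e"
            by (simp add: ennreal_leI)
        qed
      qed simp
      finally have le: "(\<integral>\<^sup>+ t. ennreal ((cmod (f n t - g t))\<^sup>2) \<partial>M) \<le> ennreal e" .
      then have "(\<integral>\<^sup>+ t. ennreal ((cmod (f n t - g t))\<^sup>2) \<partial>M) < \<infinity>"
        by (rule le_less_trans) simp
      then have int: "integrable M (\<lambda>t. (cmod (f n t - g t))\<^sup>2)"
        by (intro integrableI_nonneg) auto
      then have "ennreal (sqn M (\<lambda>t. f n t - g t)) \<le> ennreal e"
        using le by (simp add: sqn_def nn_integral_eq_integral)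
      then have "sqn M (\<lambda>t. f n t - g t) \<le> e"
        using \<open>e > 0\<close> by (simp add: ennreal_le_iff)
      then show ?thesis using int by (simp add: L2_space_def)
    qed
    then show ?thesis by blast
  qed
  obtain N where "(\<lambda>t. f N t - g t) \<in> L2_space M" using key[of 1] by auto
  from L2_space_diff[OF f[of N] this] have "g \<in> L2_space M" by simp
  moreover have "(\<lambda>n. sqn M (\<lambda>t. f n t - g t)) \<longlonglongrightarrow> 0"
  proof (rule LIMSEQ_I)
    fix e :: real assume "e > 0"
    then obtain N where "\<forall>n\<ge>N. sqn M (\<lambda>t. f n t - g t) \<le> e / 2" using key[of "e / 2"] by auto
    then show "\<exists>N. \<forall>n\<ge>N. norm (sqn M (\<lambda>t. f n t - g t) - 0) < e"
      using \<open>e > 0\<close> sqn_nonneg by (intro exI[of _ N]) fastforce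
  qed
  ultimately show ?thesis by blast
qed

abbreviation cpoly :: "complex poly \<Rightarrow> real \<Rightarrow> complex" where
  "cpoly p \<equiv> \<lambda>t. poly p (of_real t)"

lemma polynomials_dense_iff:
  "polynomials_dense M \<longleftrightarrow> (\<forall>p. cpoly p \<in> L2_space M) \<and>
     (\<forall>f\<in>L2_space M. \<forall>e>0. \<exists>p. sqn M (\<lambda>t. f t - cpoly p t) < e)"
proof -
  have "(\<forall>e>0. \<exists>p. sqrt (sqn M (\<lambda>t. f t - cpoly p t)) < e) \<longleftrightarrow>
      (\<forall>e>0. \<exists>p. sqn M (\<lambda>t. f t - cpoly p t) < e)" for f
  proof safe
    fix e :: real assume "\<forall>e>0. \<exists>p. sqrt (sqn M (\<lambda>t. f t - cpoly p t)) < e" "e > 0"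
    then obtain p where "sqrt (sqn M (\<lambda>t. f t - cpoly p t)) < sqrt e"
      by (metis real_sqrt_gt_zero)
    then show "\<exists>p. sqn M (\<lambda>t. f t - cpoly p t) < e" by auto
  next
    fix e :: real assume "\<forall>e>0. \<exists>p. sqn M (\<lambda>t. f t - cpoly p t) < e" "e > 0"
    then obtain p where "sqn M (\<lambda>t. f t - cpoly p t) < e\<^sup>2"
      by (metis zero_less_power)
    then have "sqrt (sqn M (\<lambda>t. f t - cpoly p t)) < sqrt (e\<^sup>2)" by (rule real_sqrt_less_mono)
    then show "\<exists>p. sqrt (sqn M (\<lambda>t. f t - cpoly p t)) < e"
      using \<open>e > 0\<close> by auto
  qed
  then show ?thesis unfolding polynomials_dense_def sqn_def by blast
qed

section \<open>Weighted measures and the transfer of density between them\<close>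

lemma L2_space_density:
  assumes "sets M = sets borel" and w: "w \<in> borel_measurable borel" "\<And>t. 0 \<le> w t"
  shows "f \<in> L2_space (density M (\<lambda>t. ennreal (w t))) \<longleftrightarrow>
    f \<in> borel_measurable borel \<and> integrable M (\<lambda>t. w t * (cmod (f t))\<^sup>2)"
proof -
  have [measurable_cong]: "sets M = sets borel" by fact
  note w [measurable]
  have "integrable (density M (\<lambda>t. ennreal (w t))) (\<lambda>t. (cmod (f t))\<^sup>2) \<longleftrightarrow>
      integrable M (\<lambda>t. w t * (cmod (f t))\<^sup>2)" if [measurable]: "f \<in> borel_measurable borel"
    by (rule integrable_real_density) (auto simp: w)
  moreover have "f \<in> borel_measurable (density M (\<lambda>t. ennreal (w t))) \<longleftrightarrow> f \<in> borel_measurable borel"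
    by (intro measurable_cong_sets[THEN eqset_imp_iff]) (auto simp: assms(1))
  ultimately show ?thesis by (auto simp: L2_space_def)
qed

lemma sqn_density:
  assumes "sets M = sets borel" and w: "w \<in> borel_measurable borel" "\<And>t. 0 \<le> w t"
    and [measurable]: "f \<in> borel_measurable borel"
  shows "sqn (density M (\<lambda>t. ennreal (w t))) f = (\<integral>t. w t * (cmod (f t))\<^sup>2 \<partial>M)"
proof -
  have [measurable_cong]: "sets M = sets borel" by fact
  note w(1) [measurable]
  show ?thesis unfolding sqn_def by (rule integral_real_density) (auto simp: w)
qed

text \<open>A function of L2(w1) need not lie in L2(w2), so it is first truncated to an interval,
  where continuity makes the weights comparable. The truncation is approximated in L2(w2), and w1 <=
  c w2 carries the error back.\<close>

lemma polynomials_dense_weight: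
  assumes M: "sets M = sets borel"
    and w1: "continuous_on UNIV w1" "\<And>t. 0 < w1 t" and w2: "continuous_on UNIV w2" "\<And>t. 0 < w2 t"
    and le: "\<And>t. w1 t \<le> c * w2 t"
    and dense: "polynomials_dense (density M (\<lambda>t. ennreal (w2 t)))"
  shows "polynomials_dense (density M (\<lambda>t. ennreal (w1 t)))"
proof -
  let ?M1 = "density M (\<lambda>t. ennreal (w1 t))" and ?M2 = "density M (\<lambda>t. ennreal (w2 t))"
  have [measurable_cong]: "sets M = sets borel" by fact
  have w [measurable]: "w1 \<in> borel_measurable borel" "w2 \<in> borel_measurable borel"
    using w1 w2 by (auto intro: borel_measurable_continuous_onI)
  note L2_1 = L2_space_density[OF M w(1) less_imp_le[OF w1(2)]]
  note L2_2 = L2_space_density[OF M w(2) less_imp_le[OF w2(2)]]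
  have "c > 0"
    using le[of 0] w1(2)[of 0] w2(2)[of 0] by (metis less_le_trans zero_less_mult_pos2)
  have step: "f \<in> L2_space ?M1 \<and> sqn ?M1 f \<le> c * sqn ?M2 f" if f: "f \<in> L2_space ?M2" for f
  proof -
    have [measurable]: "f \<in> borel_measurable borel" and int: "integrable M (\<lambda>t. w2 t * (cmod (f t))\<^sup>2)"
      using f unfolding L2_2 by auto
    have pw: "w1 t * (cmod (f t))\<^sup>2 \<le> c * (w2 t * (cmod (f t))\<^sup>2)" for t
      using mult_right_mono[OF le, of "(cmod (f t))\<^sup>2" t] by (simp add: mult.assoc)
    have int1: "integrable M (\<lambda>t. w1 t * (cmod (f t))\<^sup>2)"
    proof (rule Bochner_Integration.integrable_bound)
      show "integrable M (\<lambda>t. c * (w2 t * (cmod (f t))\<^sup>2))" using int by simp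
      show "AE t in M. norm (w1 t * (cmod (f t))\<^sup>2) \<le> norm (c * (w2 t * (cmod (f t))\<^sup>2))"
      proof (rule AE_I2)
        fix t
        have "\<bar>w1 t * (cmod (f t))\<^sup>2\<bar> = w1 t * (cmod (f t))\<^sup>2"
          using w1(2)[of t] by simp
        then show "norm (w1 t * (cmod (f t))\<^sup>2) \<le> norm (c * (w2 t * (cmod (f t))\<^sup>2))"
          using pw[of t] by (simp only: real_norm_def)
      qed
    qed measurable
    have "(\<integral>t. w1 t * (cmod (f t))\<^sup>2 \<partial>M) \<le> (\<integral>t. c * (w2 t * (cmod (f t))\<^sup>2) \<partial>M)"
      using int int1 by (intro integral_mono pw) auto
    then show ?thesis
      using int1 w1(2) w2(2) by (simp add: L2_1 sqn_density[OF M] less_imp_le)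
  qed
  have poly: "cpoly p \<in> L2_space ?M1" for p
    using step dense by (simp add: polynomials_dense_iff)
  have "\<exists>p. sqn ?M1 (\<lambda>t. f t - cpoly p t) < e" if f: "f \<in> L2_space ?M1" and "e > 0" for f e
  proof -
    have [measurable]: "f \<in> borel_measurable borel" and int: "integrable M (\<lambda>t. w1 t * (cmod (f t))\<^sup>2)"
      using f unfolding L2_1 by auto
    define g where "g n t = indicator {- real n..real n} t * f t" for n t
    have gm [measurable]: "g n \<in> borel_measurable borel" for n unfolding g_def by measurable
    have gle: "cmod (g n t) \<le> 1 * cmod (f t)" for n t by (simp add: g_def indicator_def)
    have g1: "g n \<in> L2_space ?M1" for n
      by (rule L2_space_bound[OF f _ gle]) simp
    have "(\<lambda>n. sqn ?M1 (\<lambda>t. g n t - f t)) \<longlonglongrightarrow> 0"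
    proof (rule tendsto_sqn_dominated[OF f _ gle])
      fix t
      obtain N where N: "\<bar>t\<bar> \<le> real N" using real_arch_simple by blast
      have "\<forall>\<^sub>F n in sequentially. g n t = f t"
        by (rule eventually_sequentiallyI[of N]) (use N in \<open>auto simp: g_def indicator_def abs_le_iff\<close>)
      then show "(\<lambda>n. g n t) \<longlonglongrightarrow> f t" by (rule tendsto_eventually)
    qed simp
    then have "\<forall>\<^sub>F n in sequentially. sqn ?M1 (\<lambda>t. g n t - f t) < e / 4"
      using \<open>e > 0\<close> by (intro order_tendstoD(2)) auto
    then obtain n where n: "sqn ?M1 (\<lambda>t. g n t - f t) < e / 4"
      by (auto simp: eventually_sequentially)
    have "continuous_on {- real n..real n} (\<lambda>t. w2 t / w1 t)"
      using w1 w2 by (intro continuous_intros) (auto intro: continuous_on_subset simp: less_imp_neq[THEN not_sym])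
    then have "bounded ((\<lambda>t. w2 t / w1 t) ` {- real n..real n})"
      by (intro compact_imp_bounded compact_continuous_image) auto
    then obtain K where "\<forall>x\<in>(\<lambda>t. w2 t / w1 t) ` {- real n..real n}. norm x \<le> K"
      unfolding bounded_iff ..
    then have K: "\<And>t. t \<in> {- real n..real n} \<Longrightarrow> \<bar>w2 t / w1 t\<bar> \<le> K" by simp
    have "integrable M (\<lambda>t. w2 t * (cmod (g n t))\<^sup>2)"
    proof (rule Bochner_Integration.integrable_bound)
      show "integrable M (\<lambda>t. K * (w1 t * (cmod (f t))\<^sup>2))" using int by simp
      have "norm (w2 t * (cmod (g n t))\<^sup>2) \<le> norm (K * (w1 t * (cmod (f t))\<^sup>2))" for t
      proof (cases "t \<in> {- real n..real n}")
        case True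
        have "w2 t \<le> K * w1 t"
          using K[OF True] w1(2)[of t] w2(2)[of t] by (simp add: field_simps)
        then have "w2 t * (cmod (f t))\<^sup>2 \<le> K * w1 t * (cmod (f t))\<^sup>2" by (rule mult_right_mono) simp
        moreover have "norm (w2 t * (cmod (g n t))\<^sup>2) = w2 t * (cmod (f t))\<^sup>2"
          using True w2(2)[of t] by (simp add: g_def)
        ultimately show ?thesis
          using abs_ge_self[of "K * (w1 t * (cmod (f t))\<^sup>2)"] by (simp only: real_norm_def mult.assoc)
      next
        case False
        then show ?thesis by (simp add: g_def)
      qed
      then show "AE t in M. norm (w2 t * (cmod (g n t))\<^sup>2) \<le> norm (K * (w1 t * (cmod (f t))\<^sup>2))" by simp
    qed measurable
    then have g2: "g n \<in> L2_space ?M2" by (simp add: L2_2)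
    \<comment> \<open>The passage to \<open>w1\<close> costs the factor c; the two errors then add
      up to less than 2 e/4 + 2 e/4 = e.\<close>
    have "e / (4 * c) > 0" using \<open>e > 0\<close> \<open>c > 0\<close> by simp
    then obtain p where p: "sqn ?M2 (\<lambda>t. g n t - cpoly p t) < e / (4 * c)"
      using g2 dense unfolding polynomials_dense_iff by blast
    have "(\<lambda>t. g n t - cpoly p t) \<in> L2_space ?M2"
      using dense by (intro L2_space_diff g2) (simp add: polynomials_dense_iff)
    then have "sqn ?M1 (\<lambda>t. g n t - cpoly p t) \<le> c * sqn ?M2 (\<lambda>t. g n t - cpoly p t)"
      using step by blast
    also have "\<dots> < e / 4" using p \<open>c > 0\<close> by (simp add: field_simps)
    finally have "sqn ?M1 (\<lambda>t. g n t - cpoly p t) < e / 4" .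
    moreover have "sqn ?M1 (\<lambda>t. f t - cpoly p t)
        \<le> 2 * sqn ?M1 (\<lambda>t. f t - g n t) + 2 * sqn ?M1 (\<lambda>t. g n t - cpoly p t)"
      by (rule sqn_triangle[OF f g1 poly])
    moreover have "sqn ?M1 (\<lambda>t. f t - g n t) < e / 4" using n by (simp add: sqn_minus_commute)
    ultimately show ?thesis by (intro exI[of _ p]) linarith
  qed
  then show ?thesis using poly by (simp add: polynomials_dense_iff)
qed

text \<open>A finite support would carry all the mass, its complement being covered by countably
  many null balls; the polynomial with zeros at its points would then have norm zero.\<close>

lemma infinite_measure_support:
  assumes M: "sets \<nu> = sets borel" and pos: "\<And>p. p \<noteq> 0 \<Longrightarrow> poly_inner \<nu> p p > 0"
  shows "infinite (measure_support \<nu>)"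
proof
  let ?S = "measure_support \<nu>"
  assume fin: "finite ?S"
  define F where "F = {ball t e | t e. emeasure \<nu> (ball t e) = 0}"
  obtain F' where F': "F' \<subseteq> F" "countable F'" "\<Union>F' = \<Union>F"
    by (rule Lindelof[of F]) (auto simp: F_def)
  have "(\<Union>A\<in>F'. A) \<in> null_sets \<nu>"
    using F' by (intro null_sets_UN') (auto simp: F_def null_sets_def M)
  then have null: "\<Union>F \<in> null_sets \<nu>" using F'(3) by simp
  have "t \<in> \<Union>F" if t: "t \<notin> ?S" for t
  proof -
    obtain e where "e > 0" "emeasure \<nu> (ball t e) = 0"
      using t by (auto simp: measure_support_def zero_less_iff_neq_zero)
    then show ?thesis by (auto simp: F_def intro!: exI[of _ "ball t e"])
  qed
  then have S: "t \<in> ?S" if "t \<notin> \<Union>F" for t using that by blast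
  from AE_not_in[OF null] have "AE t in \<nu>. t \<in> ?S" by eventually_elim (rule S)
  define p where "p = (\<Prod>s\<in>?S. [:- s, 1:])"
  have "p \<noteq> 0" using fin by (simp add: p_def)
  then have "poly_inner \<nu> p p > 0" by (rule pos)
  moreover have "poly_inner \<nu> p p = (\<integral>t. 0 \<partial>\<nu>)"
    unfolding poly_inner_def
  proof (rule integral_cong_AE)
    have "poly p \<in> borel_measurable borel"
      by (intro borel_measurable_continuous_onI continuous_intros)
    moreover have [measurable_cong]: "sets \<nu> = sets borel" by fact
    ultimately show "(\<lambda>t. poly p t * poly p t) \<in> borel_measurable \<nu>" by measurable
    show "AE t in \<nu>. poly p t * poly p t = 0"
      using \<open>AE t in \<nu>. t \<in> ?S\<close>
      by eventually_elim (use fin in \<open>auto simp: p_def poly_prod\<close>)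
  qed simp
  ultimately show False by simp
qed

text \<open>For w = i s/(n + 1) the numbers exp w and 1/(1 - w) differ by o(w). Both have modulus at
  most 1, so their powers of exponent n + 1 differ by at most n + 1 times as much.\<close>

lemma tendsto_exp_imaginary:
  "(\<lambda>n. (1 / (1 - \<i> * of_real (s / Suc n))) ^ Suc n) \<longlonglongrightarrow> exp (\<i> * of_real s)"
proof -
  define h where "h w = exp w - 1 / (1 - w)" for w :: complex
  define w where "w n = \<i> * of_real (s / Suc n)" for n
  have "(h has_field_derivative 0) (at 0)"
    unfolding h_def by (auto intro!: derivative_eq_intros)
  then have lim: "((\<lambda>y. h y / y) \<longlongrightarrow> 0) (at 0)"
    by (simp add: has_field_derivative_iff h_def)
  have w0: "w \<longlonglongrightarrow> 0"
  proof -
    have "(\<lambda>n. s / Suc n) \<longlonglongrightarrow> 0"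
      by (rule LIMSEQ_Suc[OF lim_const_over_n])
    then have "(\<lambda>n. \<i> * of_real (s / Suc n)) \<longlonglongrightarrow> \<i> * of_real 0"
      by (intro tendsto_intros)
    then show ?thesis by (simp add: w_def[abs_def])
  qed
  have "(\<lambda>n. of_nat (Suc n) * h (w n)) \<longlonglongrightarrow> 0"
  proof (cases "s = 0")
    case True
    then show ?thesis by (simp add: w_def h_def)
  next
    case False
    then have "w n \<noteq> 0" for n by (simp add: w_def del: of_nat_Suc)
    then have "filterlim w (at 0) sequentially"
      using w0 by (simp add: filterlim_at)
    then have "(\<lambda>n. h (w n) / w n) \<longlonglongrightarrow> 0" by (rule filterlim_compose[OF lim])
    then have "(\<lambda>n. \<i> * of_real s * (h (w n) / w n)) \<longlonglongrightarrow> \<i> * of_real s * 0"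
      by (intro tendsto_intros)
    moreover have "\<i> * of_real s * (h (w n) / w n) = of_nat (Suc n) * h (w n)" for n
      using False by (simp add: w_def field_simps)
    ultimately show ?thesis by simp
  qed
  then have "(\<lambda>n. cmod (of_nat (Suc n) * h (w n))) \<longlonglongrightarrow> 0" by (rule tendsto_norm_zero)
  then have "(\<lambda>n. (1 / (1 - w n)) ^ Suc n - exp (\<i> * of_real s)) \<longlonglongrightarrow> 0"
  proof (rule Lim_null_comparison[rotated])
    have "norm ((1 / (1 - w n)) ^ Suc n - exp (\<i> * of_real s)) \<le> cmod (of_nat (Suc n) * h (w n))" for n
    proof -
      have e: "exp (\<i> * of_real s) = exp (w n) ^ Suc n"
      proof -
        have "of_nat (Suc n) * w n = \<i> * of_real s" by (simp add: w_def del: of_nat_Suc)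
        then show ?thesis by (simp only: exp_of_nat_mult[symmetric])
      qed
      have "1 \<le> cmod (1 - w n)"
        using complex_Re_le_cmod[of "1 - w n"] by (simp add: w_def)
      then have "cmod (1 / (1 - w n)) \<le> 1" unfolding norm_divide by (auto simp: divide_le_eq)
      moreover have "cmod (exp (w n)) \<le> 1" by (simp add: w_def)
      ultimately have "norm ((1 / (1 - w n)) ^ Suc n - exp (w n) ^ Suc n) \<le> Suc n * norm (1 / (1 - w n) - exp (w n))"
        by (intro norm_power_diff)
      then show ?thesis
        by (simp only: e norm_mult norm_of_nat h_def norm_minus_commute[of "exp (w n)"])
    qed
    then show "\<forall>\<^sub>F n in sequentially. norm ((1 / (1 - w n)) ^ Suc n - exp (\<i> * of_real s))
        \<le> cmod (of_nat (Suc n) * h (w n))" by simp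
  qed
  then show ?thesis by (simp add: LIM_zero_iff w_def)
qed

section \<open>Determinacy\<close>

lemma polynomials_denseD:
  assumes "polynomials_dense M" "f \<in> L2_space M" "e > 0"
  shows "\<exists>p. sqn M (\<lambda>t. f t - cpoly p t) < e"
  using assms by (simp add: polynomials_dense_iff)

lemma integral_cpoly:
  assumes "hamburger_solution M"
  shows "integrable M (cpoly p)"
    and "(\<integral>t. cpoly p t \<partial>M) = (\<Sum>i\<le>degree p. coeff p i * of_real (\<integral>t. t ^ i \<partial>M))"
proof -
  have int: "integrable M (\<lambda>t. complex_of_real (t ^ i))" for i
    using assms by (intro integrable_of_real) (simp add: hamburger_solution_def)
  have e: "cpoly p = (\<lambda>t. \<Sum>i\<le>degree p. coeff p i * complex_of_real (t ^ i))"
    by (simp add: poly_altdef)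
  show "integrable M (cpoly p)"
    unfolding e by (intro Bochner_Integration.integrable_sum integrable_mult_right int)
  show "(\<integral>t. cpoly p t \<partial>M) = (\<Sum>i\<le>degree p. coeff p i * of_real (\<integral>t. t ^ i \<partial>M))"
    unfolding e
    by (subst Bochner_Integration.integral_sum)
      (auto intro!: integrable_mult_right int sum.cong simp del: of_real_power)
qed

text \<open>On the real line |p|^2 is itself a polynomial, so norms of polynomials depend on the
  moments alone.\<close>

lemma cmod_cpoly_sq: "complex_of_real ((cmod (cpoly p t))\<^sup>2) = cpoly (p * map_poly cnj p) t"
  using poly_cnj[of p "of_real t"] unfolding complex_norm_square by simp

lemma cpoly_L2:
  assumes "hamburger_solution M"
  shows "cpoly p \<in> L2_space M"
proof -
  have "integrable M (\<lambda>t. Re (complex_of_real ((cmod (cpoly p t))\<^sup>2)))"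
    unfolding cmod_cpoly_sq by (rule integrable_Re[OF integral_cpoly(1)[OF assms]])
  moreover have "cpoly p \<in> borel_measurable M"
    using integral_cpoly(1)[OF assms] by (rule borel_measurable_integrable)
  ultimately show ?thesis by (simp add: L2_space_def)
qed

lemma sqn_cpoly:
  assumes "hamburger_solution M"
  shows "complex_of_real (sqn M (cpoly p)) = (\<integral>t. cpoly (p * map_poly cnj p) t \<partial>M)"
  unfolding cmod_cpoly_sq[symmetric] sqn_def by (simp del: of_real_power)

lemma norm_integral_le_sqrt_sqn:
  assumes "prob_space M" and g: "g \<in> L2_space M"
  shows "cmod (\<integral>t. g t \<partial>M) \<le> sqrt (sqn M g)"
proof -
  interpret prob_space M by fact
  have one: "(\<lambda>t. 1) \<in> L2_space M" by (simp add: L2_space_def)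
  have norm: "(\<lambda>t. complex_of_real (cmod (g t))) \<in> L2_space M"
    using L2_spaceD[OF g] by (simp add: L2_space_def)
  have "cmod (\<integral>t. g t \<partial>M) \<le> (\<integral>t. cmod (g t) \<partial>M)" by (rule integral_norm_bound)
  also have "\<dots> = (\<integral>t. complex_of_real (cmod (g t)) \<bullet> 1 \<partial>M)" by (simp add: inner_complex_def)
  also have "\<dots> \<le> sqrt (sqn M (\<lambda>t. complex_of_real (cmod (g t)))) * sqrt (sqn M (\<lambda>t. 1))"
    using L2_Cauchy_Schwarz[OF norm one] by linarith
  finally show ?thesis by (simp add: sqn_def prob_space)
qed

text \<open>Riesz' criterion. If \<open>\<sigma>\<close> has the moments of \<open>\<nu>\<close>, polynomials have the same norm in both
  \<open>L\<^sub>2\<close> spaces, so polynomials approximating \<open>(1 - \<i> a t)\<^sup>-\<^sup>m\<close> in \<open>L\<^sub>2(\<nu>)\<close> can be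
  chosen to do so in \<open>L\<^sub>2(\<sigma>)\<close>; then
  \<open>(1 - \<i> s t / n)\<^sup>-\<^sup>n \<rightarrow> e\<^sup>i\<^sup>s\<^sup>t\<close> gives equality of the characteristic functions.\<close>

lemma same_moments_resolvent_powers:
  assumes nu: "hamburger_solution \<nu>" and si: "hamburger_solution \<sigma>"
    and mom: "\<And>k. (\<integral>t. t ^ k \<partial>\<sigma>) = (\<integral>t. t ^ k \<partial>\<nu>)"
    and dense: "polynomials_dense (density \<nu> (\<lambda>t. ennreal (1 + t\<^sup>2)))"
    and a: "a \<noteq> 0" and e: "e > 0"
  defines "r \<equiv> \<lambda>t. 1 / (1 - \<i> * of_real (a * t))"
  shows "\<exists>p. \<forall>M\<in>{\<nu>, \<sigma>}. (\<lambda>t. cpoly p t - r t ^ m) \<in> L2_space M \<and> sqn M (\<lambda>t. cpoly p t - r t ^ m) < e"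
  using e
proof (induction m arbitrary: e)
  case 0
  then show ?case by (intro exI[of _ 1]) (simp add: L2_space_zero sqn_def)
next
  case (Suc m)
  define u where "u t = 1 - \<i> * of_real (a * t)" for t
  define q where "q = [:1, - (\<i> * of_real a):]"
  have u_q: "u t = cpoly q t" for t by (simp add: u_def q_def mult_ac)
  have r_u: "r t = 1 / u t" for t by (simp add: r_def u_def)
  have u_sq: "(cmod (u t))\<^sup>2 = 1 + a\<^sup>2 * t\<^sup>2" for t
    unfolding cmod_power2 by (simp add: u_def power_mult_distrib)
  have u_ge: "1 \<le> cmod (u t)" for t
    using complex_Re_le_cmod[of "u t"] by (simp add: u_def)
  have u0: "u t \<noteq> 0" for t using u_ge[of t] by auto
  have sets: "sets \<nu> = sets borel" "sets \<sigma> = sets borel"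
    using nu si by (auto simp: hamburger_solution_def)
  have r_meas: "r \<in> borel_measurable M" if "sets M = sets borel" for M :: "real measure"
  proof -
    have "continuous_on UNIV r"
      unfolding r_u using u0 by (intro continuous_intros) (auto simp: u_q intro!: continuous_intros)
    then have "r \<in> borel_measurable borel" by (rule borel_measurable_continuous_onI)
    then show ?thesis using measurable_cong_sets[OF that refl] by blast
  qed
  have r_le: "cmod (r t) \<le> 1" for t using u_ge[of t] unfolding r_u norm_divide by (auto simp: divide_le_eq)
  have r_mult: "(\<lambda>t. r t * g t) \<in> L2_space M" "sqn M (\<lambda>t. r t * g t) \<le> sqn M g"
    if "sets M = sets borel" "g \<in> L2_space M" for M g
  proof -
    have le: "cmod (r t * g t) \<le> 1 * cmod (g t)" for t
      unfolding norm_mult by (rule mult_right_mono[OF r_le]) simp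
    show "(\<lambda>t. r t * g t) \<in> L2_space M"
      using L2_spaceD(1)[OF that(2)] r_meas[OF that(1)] by (intro L2_space_bound[OF that(2) _ le]) simp
    then show "sqn M (\<lambda>t. r t * g t) \<le> sqn M g"
      using that(2) le by (intro sqn_mono) auto
  qed
  from Suc.prems have "e / 4 > 0" by simp
  from Suc.IH[OF this] obtain p where
    p: "\<And>M. M \<in> {\<nu>, \<sigma>} \<Longrightarrow> (\<lambda>t. cpoly p t - r t ^ m) \<in> L2_space M"
       "\<And>M. M \<in> {\<nu>, \<sigma>} \<Longrightarrow> sqn M (\<lambda>t. cpoly p t - r t ^ m) < e / 4" by blast
  let ?w = "\<lambda>t::real. 1 + t\<^sup>2" and ?f = "\<lambda>t. r t * cpoly p t"
  have w: "?w \<in> borel_measurable borel" "0 \<le> ?w t" for t by auto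
  note L2w = L2_space_density[OF sets(1) w] and sqnw = sqn_density[OF sets(1) w]
  have pm: "cpoly p \<in> borel_measurable borel" for p
    by (intro borel_measurable_continuous_onI continuous_intros)
  have rm: "r \<in> borel_measurable borel" by (rule r_meas) simp
  have mw: "(\<lambda>t. r t * cpoly p t) \<in> borel_measurable \<nu>"
    using L2_spaceD(1)[OF r_mult(1)[OF sets(1) cpoly_L2[OF nu]]] .
  \<comment> \<open>As a is nonzero, this constant gives 1 + t^2 <= c |u|^2, which puts r p into the
    weighted space.\<close>
  define c where "c = 1 + 1 / a\<^sup>2"
  have w_le: "1 + t\<^sup>2 \<le> c * (cmod (u t))\<^sup>2" for t
  proof -
    have "c * (cmod (u t))\<^sup>2 = 1 + t\<^sup>2 + (1 / a\<^sup>2 + a\<^sup>2 * t\<^sup>2)"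
      using a unfolding u_sq c_def by (simp add: field_simps)
    moreover have "0 \<le> 1 / a\<^sup>2 + a\<^sup>2 * t\<^sup>2" by simp
    ultimately show ?thesis by linarith
  qed
  have f_sq: "(cmod (?f t))\<^sup>2 * (cmod (u t))\<^sup>2 = (cmod (cpoly p t))\<^sup>2" for t
    using u0[of t] by (simp add: r_u norm_mult norm_divide power_mult_distrib[symmetric])
  have "integrable \<nu> (\<lambda>t. ?w t * (cmod (?f t))\<^sup>2)"
  proof (rule Bochner_Integration.integrable_bound)
    show "integrable \<nu> (\<lambda>t. c * (cmod (cpoly p t))\<^sup>2)"
      using L2_spaceD(2)[OF cpoly_L2[OF nu]] by simp
    show "(\<lambda>t. ?w t * (cmod (?f t))\<^sup>2) \<in> borel_measurable \<nu>"
    proof -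
      have [measurable_cong]: "sets \<nu> = sets borel" by (rule sets(1))
      note mw [measurable]
      show ?thesis by measurable
    qed
    have "?w t * (cmod (?f t))\<^sup>2 \<le> c * (cmod (cpoly p t))\<^sup>2" for t
      using mult_right_mono[OF w_le, of "(cmod (?f t))\<^sup>2" t] f_sq[of t]
      by (simp add: mult.assoc mult.commute[of "(cmod (u t))\<^sup>2"])
    then show "AE t in \<nu>. norm (?w t * (cmod (?f t))\<^sup>2) \<le> norm (c * (cmod (cpoly p t))\<^sup>2)"
      by (intro AE_I2) (smt (verit, best) real_norm_def mult_nonneg_nonneg zero_le_power2)
  qed
  then have fL2: "?f \<in> L2_space (density \<nu> (\<lambda>t. ennreal (?w t)))"
    unfolding L2w using borel_measurable_times[OF rm pm] by blast
  \<comment> \<open>Chosen for |u|^2 <= (1 + a^2)(1 + t^2); the final estimate is 2 e/4 + 2 e/8 <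
    e.\<close>
  define d where "d = e / 8 / (1 + a\<^sup>2)"
  have a2: "1 + a\<^sup>2 > 0" by (smt (verit) zero_le_power2)
  then have "d > 0" using Suc.prems by (simp add: d_def)
  from polynomials_denseD[OF dense fL2 this]
  obtain s where s: "sqn (density \<nu> (\<lambda>t. ennreal (?w t))) (\<lambda>t. ?f t - cpoly s t) < d" ..
  have dL2: "(\<lambda>t. ?f t - cpoly s t) \<in> L2_space (density \<nu> (\<lambda>t. ennreal (?w t)))"
    using dense by (intro L2_space_diff fL2) (simp add: polynomials_dense_iff)
  \<comment> \<open>Since u r = 1, multiplying the error r p - s by u gives the polynomial p - q s.
    The weight 1 + t^2 pays for |u|^2; being a polynomial, the product has the same norm under both
    measures; and returning to r p - s costs nothing because |r| <= 1.\<close>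
  have nu_small: "sqn \<nu> (cpoly (p - q * s)) < e / 8"
  proof -
    have pw: "(cmod (cpoly (p - q * s) t))\<^sup>2 \<le> (1 + a\<^sup>2) * (?w t * (cmod (?f t - cpoly s t))\<^sup>2)" for t
    proof -
      have "cpoly (p - q * s) t = u t * (?f t - cpoly s t)"
        using u0[of t] by (simp add: r_u u_q[symmetric] algebra_simps)
      then have "(cmod (cpoly (p - q * s) t))\<^sup>2 = (1 + a\<^sup>2 * t\<^sup>2) * (cmod (?f t - cpoly s t))\<^sup>2"
        by (simp only: norm_mult power_mult_distrib u_sq)
      also have "\<dots> \<le> ((1 + a\<^sup>2) * ?w t) * (cmod (?f t - cpoly s t))\<^sup>2"
        by (intro mult_right_mono) (auto simp: algebra_simps)
      finally show ?thesis by (simp only: mult.assoc)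
    qed
    have "sqn \<nu> (cpoly (p - q * s)) \<le> (\<integral>t. (1 + a\<^sup>2) * (?w t * (cmod (?f t - cpoly s t))\<^sup>2) \<partial>\<nu>)"
      unfolding sqn_def
      using dL2 unfolding L2w
      by (intro integral_mono pw integrable_mult_right L2_spaceD(2)[OF cpoly_L2[OF nu]]) blast
    also have "\<dots> = (1 + a\<^sup>2) * sqn (density \<nu> (\<lambda>t. ennreal (?w t))) (\<lambda>t. ?f t - cpoly s t)"
    proof -
      have "(\<lambda>t. ?f t - cpoly s t) \<in> borel_measurable borel" using dL2 unfolding L2w by blast
      from sqnw[OF this] show ?thesis by (simp only: integral_mult_right_zero)
    qed
    also have "\<dots> < (1 + a\<^sup>2) * d" using s a2 by simp
    also have "\<dots> = e / 8"
      using a2 nonzero_mult_div_cancel_left[of "1 + a\<^sup>2" "e / 8"]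
      unfolding d_def times_divide_eq_right by linarith
    finally show ?thesis .
  qed
  have same: "sqn \<sigma> (cpoly g) = sqn \<nu> (cpoly g)" for g
  proof -
    have "complex_of_real (sqn \<sigma> (cpoly g)) = complex_of_real (sqn \<nu> (cpoly g))"
      unfolding sqn_cpoly[OF nu] sqn_cpoly[OF si] integral_cpoly(2)[OF nu] integral_cpoly(2)[OF si] mom ..
    then show ?thesis by simp
  qed
  have "(\<lambda>t. cpoly s t - r t ^ Suc m) \<in> L2_space M \<and> sqn M (\<lambda>t. cpoly s t - r t ^ Suc m) < e"
    if M: "M \<in> {\<nu>, \<sigma>}" for M
  proof -
    have setsM: "sets M = sets borel" and hM: "hamburger_solution M" using M sets nu si by auto
    have small: "sqn M (cpoly (p - q * s)) < e / 8" using M nu_small same[of "p - q * s"] by (metis insertE singletonD)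
    let ?A = "\<lambda>t. r t * cpoly (p - q * s) t" and ?B = "\<lambda>t. r t * (cpoly p t - r t ^ m)"
    have A: "?A t = ?f t - cpoly s t" for t
      using u0[of t] by (simp add: r_u u_q[symmetric] field_simps)
    have AL2: "?A \<in> L2_space M" and BL2: "?B \<in> L2_space M"
      using r_mult(1)[OF setsM] cpoly_L2[OF hM] p(1)[OF M] by blast+
    have eq: "cpoly s t - r t ^ Suc m = ?B t - ?A t" for t
      unfolding A by (simp add: algebra_simps)
    have "(\<lambda>t. cpoly s t - r t ^ Suc m) \<in> L2_space M"
      unfolding eq by (rule L2_space_diff[OF BL2 AL2])
    moreover have "sqn M (\<lambda>t. cpoly s t - r t ^ Suc m) \<le> 2 * sqn M ?B + 2 * sqn M ?A"
      unfolding eq using sqn_triangle[OF BL2 L2_space_zero AL2] by (simp add: sqn_def)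
    moreover have "sqn M ?B < e / 4"
      using r_mult(2)[OF setsM p(1)[OF M]] p(2)[OF M] by linarith
    moreover have "sqn M ?A < e / 8"
      using r_mult(2)[OF setsM cpoly_L2[OF hM], of "p - q * s"] small by linarith
    ultimately show ?thesis using Suc.prems by linarith
  qed
  then show ?case by blast
qed

text \<open>\<open>\<sigma>\<close> is a probability measure because its zeroth moment is that of
  \<open>\<nu>\<close>. Resolvent powers with a = s/(n + 1) and exponent n + 1 have equal integrals
  and tend boundedly to the characters.\<close>

lemma determinate_if_dense:
  assumes nu: "hamburger_solution \<nu>" and prob: "prob_space \<nu>"
    and dense: "polynomials_dense (density \<nu> (\<lambda>t. ennreal (1 + t\<^sup>2)))"
  shows "determinate \<nu>"
  unfolding determinate_def
proof (intro conjI allI impI nu)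
  fix \<sigma> assume si: "hamburger_solution \<sigma>" and mom: "\<forall>k. (\<integral>t. t ^ k \<partial>\<sigma>) = (\<integral>t. t ^ k \<partial>\<nu>)"
  have sets: "sets \<nu> = sets borel" "sets \<sigma> = sets borel"
    using nu si by (auto simp: hamburger_solution_def)
  interpret nu: prob_space \<nu> by fact
  have "integrable \<sigma> (\<lambda>t. t ^ 0)" using si unfolding hamburger_solution_def by blast
  then have "emeasure \<sigma> (space \<sigma>) < \<infinity>"
    by (simp add: integrable_iff_bounded)
  then interpret si: finite_measure \<sigma> by (intro finite_measureI) auto
  have "measure \<sigma> (space \<sigma>) = 1"
    using mom[rule_format, of 0] nu.prob_space by simp
  then interpret si: prob_space \<sigma>
    by (intro prob_spaceI) (simp add: si.emeasure_eq_measure)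
  have eq: "(\<integral>t. (1 / (1 - \<i> * of_real (a * t))) ^ m \<partial>\<sigma>) = (\<integral>t. (1 / (1 - \<i> * of_real (a * t))) ^ m \<partial>\<nu>)"
    (is "?I \<sigma> = ?I \<nu>") for a m
  proof (cases "a = 0")
    case True
    then show ?thesis using nu.prob_space si.prob_space by simp
  next
    case False
    let ?r = "\<lambda>t. (1 / (1 - \<i> * of_real (a * t))) ^ m"
    have "cmod (?I \<sigma> - ?I \<nu>) \<le> 0"
    proof (rule field_le_epsilon)
      fix e :: real assume "e > 0"
      then have "(e / 2)\<^sup>2 > 0" by simp
      from same_moments_resolvent_powers[OF nu si mom[rule_format] dense False this, of m]
      obtain p where p: "\<And>M. M \<in> {\<nu>, \<sigma>} \<Longrightarrow> (\<lambda>t. cpoly p t - ?r t) \<in> L2_space M"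
          "\<And>M. M \<in> {\<nu>, \<sigma>} \<Longrightarrow> sqn M (\<lambda>t. cpoly p t - ?r t) < (e / 2)\<^sup>2"
        by blast
      have close: "cmod ((\<integral>t. cpoly p t \<partial>M) - ?I M) \<le> e / 2" if M: "M \<in> {\<nu>, \<sigma>}" for M
      proof -
        have pr: "prob_space M" and h: "hamburger_solution M"
          using M nu si nu.prob_space_axioms si.prob_space_axioms by auto
        interpret prob_space M by (rule pr)
        have "integrable M (\<lambda>t. cnj 1 * (cpoly p t - ?r t))"
          by (rule L2_space_integrable_mult[OF _ p(1)[OF M]]) (simp add: L2_space_def)
        then have "integrable M (\<lambda>t. cpoly p t - ?r t)" by simp
        from Bochner_Integration.integrable_diff[OF integral_cpoly(1)[OF h, of p] this]
        have int: "integrable M ?r" by simp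
        have "cmod (\<integral>t. cpoly p t - ?r t \<partial>M) \<le> sqrt (sqn M (\<lambda>t. cpoly p t - ?r t))"
          by (rule norm_integral_le_sqrt_sqn[OF pr p(1)[OF M]])
        also have "\<dots> \<le> sqrt ((e / 2)\<^sup>2)"
          using p(2)[OF M] by (intro real_sqrt_le_mono) simp
        also have "\<dots> = e / 2" using \<open>e > 0\<close> by simp
        finally show ?thesis
          using int integral_cpoly(1)[OF h, of p] by simp
      qed
      have "(\<integral>t. cpoly p t \<partial>\<sigma>) = (\<integral>t. cpoly p t \<partial>\<nu>)"
        using mom by (simp add: integral_cpoly(2) nu si)
      then have "?I \<sigma> - ?I \<nu> = ((\<integral>t. cpoly p t \<partial>\<nu>) - ?I \<nu>) - ((\<integral>t. cpoly p t \<partial>\<sigma>) - ?I \<sigma>)" by simp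
      then have "cmod (?I \<sigma> - ?I \<nu>) \<le> cmod ((\<integral>t. cpoly p t \<partial>\<nu>) - ?I \<nu>) + cmod ((\<integral>t. cpoly p t \<partial>\<sigma>) - ?I \<sigma>)"
        using norm_triangle_ineq4 by metis
      then show "cmod (?I \<sigma> - ?I \<nu>) \<le> 0 + e" using close[of \<nu>] close[of \<sigma>] by simp
    qed
    then show ?thesis by simp
  qed
  have lim: "(\<lambda>n. \<integral>t. (1 / (1 - \<i> * of_real (s / Suc n * t))) ^ Suc n \<partial>M) \<longlonglongrightarrow> char M s"
    if M: "prob_space M" "sets M = sets borel" for M s
    unfolding char_def
  proof (rule integral_dominated_convergence)
    interpret prob_space M by (rule M)
    have [measurable_cong]: "sets M = sets borel" by (rule M)
    have inv_le: "cmod (1 / (1 - \<i> * of_real x)) \<le> 1" for x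
      using complex_Re_le_cmod[of "1 - \<i> * of_real x"]
      unfolding norm_divide by (auto simp: divide_le_eq)
    show "integrable M (\<lambda>_. 1::real)" by simp
    show "(\<lambda>t. iexp (s * t)) \<in> borel_measurable M" by measurable
    show "(\<lambda>t. (1 / (1 - \<i> * of_real (s / Suc n * t))) ^ Suc n) \<in> borel_measurable M" for n
      by measurable
    show "AE t in M. (\<lambda>n. (1 / (1 - \<i> * of_real (s / Suc n * t))) ^ Suc n) \<longlonglongrightarrow> iexp (s * t)"
      using tendsto_exp_imaginary[of "s * _"] by (intro AE_I2) simp
    show "AE t in M. norm ((1 / (1 - \<i> * of_real (s / Suc n * t))) ^ Suc n) \<le> 1" for n
      unfolding norm_power by (intro AE_I2 power_le_one norm_ge_zero inv_le)
  qed
  have "char \<sigma> = char \<nu>"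
  proof
    fix s
    have "(\<lambda>n. \<integral>t. (1 / (1 - \<i> * of_real (s / Suc n * t))) ^ Suc n \<partial>\<nu>) \<longlonglongrightarrow> char \<sigma> s"
      using lim[OF si.prob_space_axioms sets(2), of s] unfolding eq .
    then show "char \<sigma> s = char \<nu> s"
      using lim[OF nu.prob_space_axioms sets(1), of s] by (rule LIMSEQ_unique)
  qed
  moreover have "real_distribution \<sigma>" "real_distribution \<nu>"
    using sets by (auto intro!: real_distribution.intro nu.prob_space_axioms si.prob_space_axioms
        simp: real_distribution_axioms_def)
  ultimately show "\<sigma> = \<nu>" by (intro Levy_uniqueness)
qed

section \<open>Selfadjoint extensions of Jacobi operators\<close>

lemma tendsto_cinner_right: "(X \<longlongrightarrow> x) F \<Longrightarrow> ((\<lambda>n. cinner y (X n)) \<longlongrightarrow> cinner y x) F"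
  unfolding cinner_alt by (intro tendsto_Complex tendsto_intros)

lemma tendsto_cinner_left: "(X \<longlongrightarrow> x) F \<Longrightarrow> ((\<lambda>n. cinner (X n) y) \<longlongrightarrow> cinner x y) F"
  unfolding cinner_cnj[of y, symmetric] by (intro tendsto_cnj tendsto_cinner_right)

lemma closed_adjoint_op: "closed (adjoint_op T)"
  unfolding closed_sequential_limits
proof (intro allI impI)
  fix s l assume "(\<forall>n. s n \<in> adjoint_op T) \<and> s \<longlonglongrightarrow> l"
  then have s: "\<And>n. s n \<in> adjoint_op T" and lim: "(\<lambda>n. fst (s n)) \<longlonglongrightarrow> fst l" "(\<lambda>n. snd (s n)) \<longlonglongrightarrow> snd l"
    by (auto intro: tendsto_fst tendsto_snd)
  have "cinner (fst l) w = cinner (snd l) x" if "(x, w) \<in> T" for x w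
  proof (rule LIMSEQ_unique[OF tendsto_cinner_left[OF lim(1)]])
    have "cinner (fst (s n)) w = cinner (snd (s n)) x" for n
      using s[of n] that by (auto simp: adjoint_op_def)
    then show "(\<lambda>n. cinner (fst (s n)) w) \<longlonglongrightarrow> cinner (snd l) x"
      by (simp add: tendsto_cinner_left lim(2))
  qed
  then show "l \<in> adjoint_op T" by (cases l) (auto simp: adjoint_op_def)
qed

lemma selfadjoint_closed_operator: "selfadjoint T \<Longrightarrow> closed_operator T"
  using closed_adjoint_op[of T] by (simp add: selfadjoint_def closed_operator_def)

text \<open>The image of \<open>delta k\<close> under the Jacobi operator; the case distinction
  shields k = 0 from truncated subtraction.\<close>

definition jacobi_column :: "(nat \<Rightarrow> real) \<Rightarrow> (nat \<Rightarrow> real) \<Rightarrow> nat \<Rightarrow> ell2" where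
  "jacobi_column q b k = (if k = 0 then 0 else of_real (b (k - 1)) *\<^sub>C delta (k - 1))
     + of_real (q k) *\<^sub>C delta k + of_real (b k) *\<^sub>C delta (Suc k)"

lemma jacobi_op0_delta: "(delta k, jacobi_column q b k) \<in> jacobi_op0 q b"
proof -
  have "finite {j. coord (delta k) j \<noteq> 0}"
    by (rule finite_subset[of _ "{k}"]) (auto simp: coord_simps split: if_splits)
  then show ?thesis by (auto simp: jacobi_op0_def jacobi_column_def coord_simps)
qed

lemma jacobi_op0_add:
  assumes "(x, y) \<in> jacobi_op0 q b" "(x', y') \<in> jacobi_op0 q b"
  shows "(x + x', y + y') \<in> jacobi_op0 q b"
proof -
  have "{k. coord (x + x') k \<noteq> 0} \<subseteq> {k. coord x k \<noteq> 0} \<union> {k. coord x' k \<noteq> 0}"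
    by (auto simp: coord_simps)
  then have "finite {k. coord (x + x') k \<noteq> 0}"
    using assms by (auto simp: jacobi_op0_def intro: finite_subset)
  then show ?thesis using assms by (simp add: jacobi_op0_def coord_simps algebra_simps)
qed

lemma jacobi_op0_scale:
  assumes "(x, y) \<in> jacobi_op0 q b"
  shows "(c *\<^sub>C x, c *\<^sub>C y) \<in> jacobi_op0 q b"
proof -
  have "{k. coord (c *\<^sub>C x) k \<noteq> 0} \<subseteq> {k. coord x k \<noteq> 0}"
    by (auto simp: coord_simps)
  then have "finite {k. coord (c *\<^sub>C x) k \<noteq> 0}"
    using assms by (auto simp: jacobi_op0_def intro: finite_subset)
  then show ?thesis using assms by (simp add: jacobi_op0_def coord_simps algebra_simps)
qed

lemma jacobi_op0_finite_sum:
  "(\<Sum>k<n. c k *\<^sub>C delta k, \<Sum>k<n. c k *\<^sub>C jacobi_column q b k) \<in> jacobi_op0 q b"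
proof (induction n)
  case 0
  then show ?case by (simp add: jacobi_op0_def coord_simps)
next
  case (Suc n)
  then show ?case by (simp add: jacobi_op0_add jacobi_op0_scale jacobi_op0_delta)
qed

text \<open>The polynomials of the first kind of the Jacobi matrix: the solution of its formal
  eigenvalue equation at t with first entry 1. \<open>gram_schmidt_mu\<close> identifies them with
  the Gram-Schmidt sequence of \<open>mu\<close>.\<close>

fun jpoly :: "(nat \<Rightarrow> real) \<Rightarrow> (nat \<Rightarrow> real) \<Rightarrow> nat \<Rightarrow> real poly" where
  "jpoly q b 0 = 1"
| "jpoly q b (Suc 0) = smult (1 / b 0) [:- q 0, 1:]"
| "jpoly q b (Suc (Suc k)) =
     smult (1 / b (Suc k)) ([:- q (Suc k), 1:] * jpoly q b (Suc k) - smult (b k) (jpoly q b k))"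

lemma jpoly_coeff:
  assumes b: "\<And>k. b k > 0"
  shows "coeff (jpoly q b k) k > 0 \<and> (\<forall>i>k. coeff (jpoly q b k) i = 0)"
  using b
proof (induction q b k rule: jpoly.induct)
  case (2 q b)
  then show ?case by (auto simp: coeff_pCons split: nat.splits)
next
  case (3 q b k)
  from "3.IH"(1)[OF "3.prems"] "3.IH"(2)[OF "3.prems"] "3.prems"[of "Suc k"] show ?case
    by (auto simp: coeff_pCons split: nat.splits)
qed auto

abbreviation rpoly :: "real poly \<Rightarrow> real \<Rightarrow> complex" where
  "rpoly p \<equiv> \<lambda>t. of_real (poly p t)"

lemma poly_map_of_real: "poly (map_poly complex_of_real p) (of_real t) = of_real (poly p t)"
  by (induction p) (simp_all add: map_poly_pCons)

lemma cpoly_span: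
  assumes R: "\<And>k. coeff (R k) k \<noteq> 0" "\<And>k i. i > k \<Longrightarrow> coeff (R k) i = 0"
  shows "\<exists>n c. cpoly p = (\<lambda>t. \<Sum>k<n. c k * rpoly (R k) t)"
proof -
  have "\<exists>c. p = (\<Sum>k<Suc (degree p). smult (c k) (map_poly complex_of_real (R k)))"
    using R by (intro poly_span) (auto simp: coeff_map_poly coeff_eq_0)
  then obtain c where c: "p = (\<Sum>k<Suc (degree p). smult (c k) (map_poly complex_of_real (R k)))" ..
  have "cpoly p = (\<lambda>t. \<Sum>k<Suc (degree p). c k * rpoly (R k) t)"
    by (subst c) (simp only: poly_sum poly_smult poly_map_of_real)
  then show ?thesis by blast
qed

lemma cpoly_of_span: "\<exists>p. (\<lambda>t. \<Sum>k<n. c k * rpoly (R k) t) = cpoly p"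
  by (rule exI[of _ "\<Sum>k<n. smult (c k) (map_poly complex_of_real (R k))"])
    (simp add: poly_sum poly_map_of_real)

section \<open>The Jacobi operator in the functional model\<close>

locale jacobi_extension = spectral E Jt for E Jt +
  fixes q b :: "nat \<Rightarrow> real"
  assumes b_pos: "\<And>k. b k > 0" and Jt_extension: "Jt \<subseteq> adjoint_op (jacobi_op q b)"
begin

abbreviation pp :: "nat \<Rightarrow> real poly" where "pp \<equiv> jpoly q b"

text \<open>The inclusion \<open>Jt_extension\<close> read from the other side, since
  \<open>Jt\<close> is its own adjoint.\<close>

lemma jacobi_op_subset: "jacobi_op q b \<subseteq> Jt"
proof (rule subrelI)
  fix x y assume xy: "(x, y) \<in> jacobi_op q b"
  have "cinner x w = cinner y u" if "(u, w) \<in> Jt" for u w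
  proof -
    have "(u, w) \<in> adjoint_op (jacobi_op q b)" using Jt_extension that by blast
    then have "cinner u y = cinner w x" using xy by (auto simp: adjoint_op_def)
    then show ?thesis by (metis cinner_cnj)
  qed
  then show "(x, y) \<in> Jt" unfolding Jt_iff_adjoint[of x y] by blast
qed

lemma jacobi_op0_subset: "jacobi_op0 q b \<subseteq> Jt"
  using jacobi_op_subset closure_subset unfolding jacobi_op_def by blast

text \<open>\<open>Jt_rep\<close> sends column j of the matrix to t \<open>pp j\<close>. Solving the
  column for its last vector \<open>delta (Suc j)\<close> repeats the recurrence of
  \<open>jpoly\<close>, with \<open>b j\<close> as the divisor.\<close>

lemma rep_delta: "rep (delta k) (rpoly (pp k))"
proof (induction k rule: less_induct)
  case (less k)
  have col: "rep (jacobi_column q b j) (\<lambda>t. of_real t * rpoly (pp j) t)" if "j < k" for j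
    using jacobi_op0_delta[of j q b] jacobi_op0_subset by (intro Jt_rep[OF less.IH[OF that]]) blast
  show ?case
  proof (cases k)
    case 0
    have "rep (1 *\<^sub>C E UNIV (delta 0)) (\<lambda>t. 1 * indicator UNIV t)" by (rule rep_base) simp
    then show ?thesis by (simp add: 0 E_UNIV scaleC_simps)
  next
    case (Suc j)
    have b0: "complex_of_real (b j) \<noteq> 0" using b_pos[of j] by simp
    show ?thesis
    proof (cases j)
      case 0
      have "rep (of_real (1 / b 0) *\<^sub>C (jacobi_column q b 0 - of_real (q 0) *\<^sub>C delta 0))
          (\<lambda>t. of_real (1 / b 0) * (of_real t * rpoly (pp 0) t - of_real (q 0) * rpoly (pp 0) t))"
        using Suc 0 by (intro rep_scale rep_diff col less.IH) auto
      moreover have "of_real (1 / b 0) *\<^sub>C (jacobi_column q b 0 - of_real (q 0) *\<^sub>C delta 0) = delta k"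
        using b0 by (simp add: jacobi_column_def scaleC_simps Suc 0)
      ultimately show ?thesis by (simp add: Suc 0 diff_divide_distrib)
    next
      case (Suc i)
      have "rep (of_real (1 / b j) *\<^sub>C (jacobi_column q b j - of_real (q j) *\<^sub>C delta j - of_real (b i) *\<^sub>C delta i))
          (\<lambda>t. of_real (1 / b j) * (of_real t * rpoly (pp j) t - of_real (q j) * rpoly (pp j) t
              - of_real (b i) * rpoly (pp i) t))"
        using Suc \<open>k = Suc j\<close> by (intro rep_scale rep_diff col less.IH) auto
      moreover have "of_real (1 / b j) *\<^sub>C (jacobi_column q b j - of_real (q j) *\<^sub>C delta j - of_real (b i) *\<^sub>C delta i) = delta k"
        using b0 by (simp add: jacobi_column_def scaleC_simps Suc \<open>k = Suc j\<close>)
      moreover have "of_real (1 / b j) * (of_real t * rpoly (pp j) t - of_real (q j) * rpoly (pp j) t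
              - of_real (b i) * rpoly (pp i) t) = rpoly (pp k) t" for t
        by (simp add: Suc \<open>k = Suc j\<close> algebra_simps)
      ultimately show ?thesis by simp
    qed
  qed
qed

lemma prob_space_mu: "prob_space mu"
proof (rule prob_spaceI)
  have "delta 0 \<bullet> delta 0 = 1" by (simp add: inner_ell2_def cinner_delta coord_simps)
  then show "emeasure mu (space mu) = 1" by (simp add: emeasure_scalar_measure E_UNIV)
qed

lemma cpoly_span_pp: "\<exists>n c. cpoly p = (\<lambda>t. \<Sum>k<n. c k * rpoly (pp k) t)"
  using jpoly_coeff[of b q] b_pos by (intro cpoly_span) (auto simp: less_imp_neq[THEN not_sym])

lemma rep_span: "rep (\<Sum>k<n. c k *\<^sub>C delta k) (\<lambda>t. \<Sum>k<n. c k * rpoly (pp k) t)"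
  by (intro rep_sum rep_scale rep_delta)

lemma cpoly_L2_mu: "cpoly p \<in> L2_space mu"
proof -
  obtain n c where "cpoly p = (\<lambda>t. \<Sum>k<n. c k * rpoly (pp k) t)" using cpoly_span_pp by blast
  then show ?thesis using rep_L2[OF rep_span] by simp
qed

lemma hamburger_mu: "hamburger_solution mu"
  unfolding hamburger_solution_def
proof (intro conjI allI)
  fix k
  interpret prob_space mu by (rule prob_space_mu)
  have "integrable mu (\<lambda>t. cnj 1 * cpoly (monom 1 k) t)"
    by (intro L2_space_integrable_mult cpoly_L2_mu) (simp add: L2_space_def)
  from integrable_Re[OF this] show "integrable mu (\<lambda>t. t ^ k)"
    by (simp add: poly_monom of_real_power[symmetric] del: of_real_power)
qed simp

sublocale mom: all_moments mu
  by standard (use hamburger_mu in \<open>simp add: hamburger_solution_def\<close>)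

lemma orthonormal_pp: "orthonormal_polys mu pp"
proof -
  have "poly_inner mu (pp j) (pp k) = (if j = k then 1 else 0)" for j k
  proof -
    have "delta j \<bullet> delta k = poly_inner mu (pp j) (pp k)"
      using inner_rep[OF rep_delta rep_delta] by (simp add: poly_inner_def inner_complex_def)
    then show ?thesis by (cases "j = k") (simp_all add: inner_ell2_def cinner_delta coord_simps)
  qed
  then show ?thesis using jpoly_coeff[of b q] b_pos by (auto simp: orthonormal_polys_def)
qed

lemma gram_schmidt_mu: "gram_schmidt mu = pp"
  using mom.gram_schmidt_unique[OF orthonormal_pp] by blast

text \<open>Expanding a vector in the \<open>delta k\<close> amounts, through \<open>rep\<close>, to
  approximating its function by polynomials.\<close>

lemma dense_mu: "polynomials_dense mu"
  unfolding polynomials_dense_iff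
proof (intro conjI allI impI ballI cpoly_L2_mu)
  fix f and e :: real assume f: "f \<in> L2_space mu" and "e > 0"
  obtain v where v: "rep v f" using rep_exists[OF f] by blast
  have "(\<lambda>n. (norm (v - (\<Sum>k<n. coord v k *\<^sub>C delta k)))\<^sup>2) \<longlonglongrightarrow> (norm (v - v))\<^sup>2"
    by (intro tendsto_power tendsto_norm tendsto_diff tendsto_const delta_expansion)
  then have "\<forall>\<^sub>F n in sequentially. (norm (v - (\<Sum>k<n. coord v k *\<^sub>C delta k)))\<^sup>2 < e"
    using \<open>e > 0\<close> by (intro order_tendstoD(2)) auto
  then obtain n where n: "(norm (v - (\<Sum>k<n. coord v k *\<^sub>C delta k)))\<^sup>2 < e"
    by (auto simp: eventually_sequentially)
  obtain p where p: "(\<lambda>t. \<Sum>k<n. coord v k * rpoly (pp k) t) = cpoly p" using cpoly_of_span by blast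
  show "\<exists>p. sqn mu (\<lambda>t. f t - cpoly p t) < e"
    using n unfolding norm_rep[OF rep_diff[OF v rep_span]] fun_cong[OF p] by blast
qed

text \<open>This says that \<open>delta 0\<close> is cyclic. Finite combinations of the
  \<open>delta k\<close> have polynomial representatives, and \<open>Riesz_Fischer\<close> supplies
  a function for their limit.\<close>

lemma rep_surj: "\<exists>f. rep v f"
proof -
  let ?v = "\<lambda>n. \<Sum>k<n. coord v k *\<^sub>C delta k" and ?f = "\<lambda>n t. \<Sum>k<n. coord v k * rpoly (pp k) t"
  have r: "rep (?v n) (?f n)" for n by (rule rep_span)
  have lim: "?v \<longlonglongrightarrow> v" by (rule delta_expansion)
  then have C: "Cauchy ?v" by (rule LIMSEQ_imp_Cauchy)
  interpret prob_space mu by (rule prob_space_mu)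
  have "\<exists>g\<in>L2_space mu. (\<lambda>n. sqn mu (\<lambda>t. ?f n t - g t)) \<longlonglongrightarrow> 0"
  proof (rule Riesz_Fischer)
    fix e :: real assume "e > 0"
    then have "sqrt e > 0" by simp
    then obtain N where N: "\<And>m n. m \<ge> N \<Longrightarrow> n \<ge> N \<Longrightarrow> norm (?v m - ?v n) < sqrt e"
      using CauchyD[OF C] by blast
    have "sqn mu (\<lambda>t. ?f m t - ?f n t) < e" if "m \<ge> N" "n \<ge> N" for m n
    proof -
      have "sqn mu (\<lambda>t. ?f m t - ?f n t) = (norm (?v m - ?v n))\<^sup>2"
        by (rule norm_rep[OF rep_diff[OF r r], symmetric])
      also have "\<dots> < (sqrt e)\<^sup>2" using N[OF that] by (intro power_strict_mono) auto
      finally show ?thesis using \<open>e > 0\<close> by simp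
    qed
    then show "\<exists>N. \<forall>m\<ge>N. \<forall>n\<ge>N. sqn mu (\<lambda>t. ?f m t - ?f n t) < e" by blast
  qed (use finite_scalar_measure rep_L2[OF r] in auto)
  then show ?thesis using rep_lim[OF r lim] by blast
qed

text \<open>The witness for the choice in \<open>U_map\<close> is \<open>rep\<close> read from
  functions to vectors; \<open>rep_surj\<close> makes it onto.\<close>

lemma U_map_spec:
  "isometric_isomorphism mu (U_map mu)" "U_map mu (rpoly (pp k)) = delta k"
proof -
  define U where "U f = (THE v. rep v f)" for f
  have U: "U f = v" if "rep v f" for v f
    unfolding U_def using that rep_unique by blast
  have Urep: "rep (U f) f" if "f \<in> L2_space mu" for f
    using rep_exists[OF that] U by auto
  have "isometric_isomorphism mu U"
    unfolding isometric_isomorphism_def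
  proof (intro conjI allI ballI)
    fix f g c assume f: "f \<in> L2_space mu"
    show "U (\<lambda>t. c * f t) = c *\<^sub>C U f" by (intro U rep_scale Urep f)
    show "norm (U f) = sqrt (\<integral>t. (cmod (f t))\<^sup>2 \<partial>mu)"
      using norm_rep[OF Urep[OF f]] unfolding sqn_def by (metis norm_ge_zero real_sqrt_unique)
    assume g: "g \<in> L2_space mu"
    show "U (\<lambda>t. f t + g t) = U f + U g" by (intro U rep_add Urep f g)
  next
    have "v \<in> U ` L2_space mu" for v
      using rep_surj[of v] U rep_L2 by (metis image_eqI)
    then show "U ` L2_space mu = UNIV" by blast
  qed
  then have "isometric_isomorphism mu U \<and> (\<forall>k. U (\<lambda>t. of_real (poly (gram_schmidt mu k) t)) = delta k)"
    using U[OF rep_delta] by (simp add: gram_schmidt_mu)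
  then have "isometric_isomorphism mu (U_map mu) \<and>
      (\<forall>k. U_map mu (\<lambda>t. of_real (poly (gram_schmidt mu k) t)) = delta k)"
    unfolding U_map_def
    by (rule someI[where P = "\<lambda>U. isometric_isomorphism mu U \<and>
      (\<forall>k. U (\<lambda>t. of_real (poly (gram_schmidt mu k) t)) = delta k)"])
  then show "isometric_isomorphism mu (U_map mu)" "U_map mu (rpoly (pp k)) = delta k"
    by (simp_all add: gram_schmidt_mu)
qed

text \<open>The chosen map is pinned down by its values on the dense polynomials, where it agrees
  with \<open>rep\<close>.\<close>

lemma U_map_rep:
  assumes f: "rep v f"
  shows "U_map mu f = v"
proof -
  let ?U = "U_map mu"
  have add: "?U (\<lambda>t. f t + g t) = ?U f + ?U g" if "f \<in> L2_space mu" "g \<in> L2_space mu" for f g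
    using U_map_spec(1) that by (simp add: isometric_isomorphism_def)
  have scale: "?U (\<lambda>t. c * f t) = c *\<^sub>C ?U f" if "f \<in> L2_space mu" for f c
    using U_map_spec(1) that by (simp add: isometric_isomorphism_def)
  have norm: "(norm (?U f))\<^sup>2 = sqn mu f" if "f \<in> L2_space mu" for f
  proof -
    have "norm (?U f) = sqrt (sqn mu f)"
      using U_map_spec(1) that by (simp add: isometric_isomorphism_def sqn_def)
    then show ?thesis by (simp add: sqn_nonneg)
  qed
  have span: "?U (\<lambda>t. \<Sum>k<n. c k * rpoly (pp k) t) = (\<Sum>k<n. c k *\<^sub>C delta k)" for n c
  proof (induction n)
    case 0
    show ?case using norm[OF L2_space_zero] by (simp add: sqn_def)
  next
    case (Suc n)
    have "?U (\<lambda>t. \<Sum>k<Suc n. c k * rpoly (pp k) t)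
        = ?U (\<lambda>t. \<Sum>k<n. c k * rpoly (pp k) t) + ?U (\<lambda>t. c n * rpoly (pp n) t)"
      using add[OF rep_L2[OF rep_span] rep_L2[OF rep_scale[OF rep_delta]]] by simp
    then show ?case
      by (simp add: Suc scale[OF rep_L2[OF rep_delta]] U_map_spec(2))
  qed
  have "norm (?U f - v) \<le> 0"
  proof (rule field_le_epsilon)
    fix e :: real assume "e > 0"
    then have "(e / 2)\<^sup>2 > 0" by simp
    from polynomials_denseD[OF dense_mu rep_L2[OF f] this]
    obtain p where p: "sqn mu (\<lambda>t. f t - cpoly p t) < (e / 2)\<^sup>2" by blast
    obtain n c where c: "cpoly p = (\<lambda>t. \<Sum>k<n. c k * rpoly (pp k) t)" using cpoly_span_pp by blast
    let ?x = "\<Sum>k<n. c k *\<^sub>C delta k"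
    have fp: "(\<lambda>t. f t - cpoly p t) \<in> L2_space mu" by (intro L2_space_diff rep_L2[OF f] cpoly_L2_mu)
    have "?U f = ?U (\<lambda>t. f t - cpoly p t) + ?U (cpoly p)"
      using add[OF fp cpoly_L2_mu, of p] by simp
    then have "?U f - ?x = ?U (\<lambda>t. f t - cpoly p t)" by (simp add: c span)
    then have "(norm (?U f - ?x))\<^sup>2 < (e / 2)\<^sup>2" using p norm[OF fp] by simp
    then have 1: "norm (?U f - ?x) < e / 2" by (rule power_less_imp_less_base) (use \<open>e > 0\<close> in simp)
    have "(norm (v - ?x))\<^sup>2 < (e / 2)\<^sup>2"
      using p unfolding norm_rep[OF rep_diff[OF f rep_span]] fun_cong[OF c] .
    then have 2: "norm (v - ?x) < e / 2" by (rule power_less_imp_less_base) (use \<open>e > 0\<close> in simp)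
    have "norm (?U f - v) \<le> norm (?U f - ?x) + norm (v - ?x)"
      using norm_triangle_ineq4[of "?U f - ?x" "v - ?x"] by simp
    then show "norm (?U f - v) \<le> 0 + e" using 1 2 by simp
  qed
  then show ?thesis by simp
qed

lemma U_map_L2: "f \<in> L2_space mu \<Longrightarrow> rep (U_map mu f) f"
  using rep_exists U_map_rep by blast

text \<open>Multiplication by a real variable is symmetric, so the pair passes the test of the
  adjoint against all of \<open>Jt\<close>; \<open>rep_surj\<close> turns every vector in that test
  into a function.\<close>

lemma Jt_rep_iff:
  assumes v: "rep v f" and w: "rep w (\<lambda>t. of_real t * f t)"
  shows "(v, w) \<in> Jt"
  unfolding Jt_iff_adjoint
proof safe
  fix x y assume xy: "(x, y) \<in> Jt"
  obtain g where g: "rep x g" using rep_surj by blast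
  have "cinner v y = (\<integral>t. cnj (f t) * (of_real t * g t) \<partial>mu)"
    by (rule cinner_rep[OF v Jt_rep[OF g xy]])
  also have "\<dots> = (\<integral>t. cnj (of_real t * f t) * g t \<partial>mu)"
    by (simp add: mult_ac)
  also have "\<dots> = cinner w x" by (rule cinner_rep[OF w g, symmetric])
  finally show "cinner v y = cinner w x" .
qed

end

section \<open>The measures \<open>\<nu>\<^sub>n\<close> and the bases \<open>\<omega>\<close>\<close>

lemma tendsto_zero_if_norm_sq_le:
  fixes a :: "nat \<Rightarrow> 'a::real_normed_vector"
  assumes "\<And>n. (norm (a n))\<^sup>2 \<le> 1 / Suc n"
  shows "a \<longlonglongrightarrow> 0"
proof -
  have "(\<lambda>n. sqrt (1 / Suc n)) \<longlonglongrightarrow> sqrt 0"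
    by (intro tendsto_real_sqrt LIMSEQ_Suc[OF lim_1_over_n])
  then have "(\<lambda>n. sqrt (1 / Suc n)) \<longlonglongrightarrow> 0" by simp
  moreover have "norm (a n) \<le> sqrt (1 / Suc n)" for n
    using assms[of n] by (rule real_le_rsqrt)
  ultimately show ?thesis by (intro Lim_null_comparison[of a "\<lambda>n. sqrt (1 / Suc n)"]) auto
qed

section \<open>Weights (1 + t^2)^k and the index of determinacy\<close>

context jacobi_extension
begin

definition wt :: "nat \<Rightarrow> real \<Rightarrow> real" where
  "wt n t = 1 / C_const mu n * (1 / (1 + t\<^sup>2) ^ n)"

lemma nu_eq: "nu mu n = density mu (\<lambda>t. ennreal (wt n t))"
  by (simp add: nu_def wt_def)

lemma one_plus_sq_pos: "0 < 1 + (t::real)\<^sup>2" "1 \<le> 1 + (t::real)\<^sup>2"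
  by (simp_all add: add_pos_nonneg)

lemma inv_weight_le: "1 / (1 + (t::real)\<^sup>2) ^ n \<le> 1"
  using one_le_power[OF one_plus_sq_pos(2), of t n] by (auto simp: divide_le_eq)

lemma inv_weight_integrable: "integrable mu (\<lambda>t. 1 / (1 + t\<^sup>2) ^ n)"
proof -
  interpret prob_space mu by (rule prob_space_mu)
  show ?thesis
    by (rule integrable_const_bound[of _ 1]) (use inv_weight_le in \<open>auto simp: abs_le_iff\<close>)
qed

lemma C_pos: "C_const mu n > 0"
proof -
  interpret prob_space mu by (rule prob_space_mu)
  have nonneg: "AE t in mu. 0 \<le> 1 / (1 + t\<^sup>2) ^ n" by simp
  have "C_const mu n \<noteq> 0"
  proof
    assume "C_const mu n = 0"
    then have "AE t in mu. 1 / (1 + t\<^sup>2) ^ n = 0"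
      using integral_nonneg_eq_0_iff_AE[OF inv_weight_integrable nonneg] by (simp add: C_const_def)
    moreover have "1 / (1 + t\<^sup>2) ^ n \<noteq> 0" for t :: real using one_plus_sq_pos(1)[of t] by simp
    ultimately have "AE t in mu. False" by simp
    then show False by simp
  qed
  moreover have "C_const mu n \<ge> 0"
    unfolding C_const_def by (rule integral_nonneg_AE[OF nonneg])
  ultimately show ?thesis by simp
qed

lemma wt_pos: "wt n t > 0"
  using C_pos one_plus_sq_pos(1)[of t] by (simp add: wt_def)

lemma continuous_wt: "continuous_on UNIV (wt n)"
  unfolding wt_def by (intro continuous_intros) (auto simp: one_plus_sq_pos(1)[THEN less_imp_neq, THEN not_sym])

lemma wt_measurable [measurable]: "wt n \<in> borel_measurable borel"
  by (rule borel_measurable_continuous_onI[OF continuous_wt])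

lemma dense_inverse_weight:
  assumes "c > 0"
  shows "polynomials_dense (density mu (\<lambda>t. ennreal (c * (1 / (1 + t\<^sup>2) ^ n))))"
proof (rule polynomials_dense_weight[where ?w2.0 = "\<lambda>_. 1" and c = c])
  show "polynomials_dense (density mu (\<lambda>t. ennreal 1))" using dense_mu by (simp add: density_1)
  show "continuous_on UNIV (\<lambda>t::real. c * (1 / (1 + t\<^sup>2) ^ n))"
    by (intro continuous_intros) (auto simp: one_plus_sq_pos(1)[THEN less_imp_neq, THEN not_sym])
  show "c * (1 / (1 + t\<^sup>2) ^ n) \<le> c * 1" for t :: real
    using assms inv_weight_le by (intro mult_left_mono) auto
  show "0 < c * (1 / (1 + t\<^sup>2) ^ n)" for t :: real
    using assms one_plus_sq_pos(1)[of t] by simp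
qed auto

lemma density_nu:
  "density (nu mu n) (\<lambda>t. ennreal ((1 + t\<^sup>2) ^ m)) = density mu (\<lambda>t. ennreal ((1 + t\<^sup>2) ^ m * wt n t))"
proof -
  have "density (nu mu n) (\<lambda>t. ennreal ((1 + t\<^sup>2) ^ m))
      = density mu (\<lambda>t. ennreal (wt n t) * ennreal ((1 + t\<^sup>2) ^ m))"
    unfolding nu_eq by (rule density_density_eq) measurable
  also have "(\<lambda>t. ennreal (wt n t) * ennreal ((1 + t\<^sup>2) ^ m)) = (\<lambda>t. ennreal ((1 + t\<^sup>2) ^ m * wt n t))"
    using wt_pos one_plus_sq_pos(1) by (simp add: ennreal_mult'[symmetric] less_imp_le mult.commute)
  finally show ?thesis .
qed

text \<open>The combined weight is a multiple of (1 + t^2)^-(n - m), which is bounded because m <=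
  n.\<close>

lemma dense_density_nu:
  assumes "m \<le> n"
  shows "polynomials_dense (density (nu mu n) (\<lambda>t. ennreal ((1 + t\<^sup>2) ^ m)))"
proof -
  have "(1 + t\<^sup>2) ^ m * wt n t = 1 / C_const mu n * (1 / (1 + t\<^sup>2) ^ (n - m))" for t
    using assms one_plus_sq_pos(1)[of t] by (simp add: wt_def power_diff)
  then show ?thesis
    unfolding density_nu using dense_inverse_weight[of "1 / C_const mu n" "n - m"] C_pos by simp
qed

lemma rep_cpoly_jacobi_op0:
  "\<exists>x y. rep x (cpoly p) \<and> rep y (\<lambda>t. of_real t * cpoly p t) \<and> (x, y) \<in> jacobi_op0 q b"
proof -
  obtain n c where c: "cpoly p = (\<lambda>t. \<Sum>k<n. c k * rpoly (pp k) t)" using cpoly_span_pp by blast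
  let ?x = "\<Sum>k<n. c k *\<^sub>C delta k" and ?y = "\<Sum>k<n. c k *\<^sub>C jacobi_column q b k"
  have xy: "(?x, ?y) \<in> jacobi_op0 q b" by (rule jacobi_op0_finite_sum)
  have x: "rep ?x (cpoly p)" unfolding c by (rule rep_span)
  have "rep ?y (\<lambda>t. of_real t * cpoly p t)"
    using jacobi_op0_subset xy by (intro Jt_rep[OF x]) blast
  then show ?thesis using x xy by blast
qed

text \<open>Since (1 + t^2)|f|^2 = |f|^2 + |t f|^2, the weighted norm is the graph norm of
  multiplication by t.\<close>

lemma L2_graph_weight:
  assumes v: "f \<in> L2_space mu" and w: "(\<lambda>t. of_real t * f t) \<in> L2_space mu"
  shows "f \<in> L2_space (density mu (\<lambda>t. ennreal (1 + t\<^sup>2)))"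
    and "sqn mu f \<le> sqn (density mu (\<lambda>t. ennreal (1 + t\<^sup>2))) f"
    and "sqn mu (\<lambda>t. of_real t * f t) \<le> sqn (density mu (\<lambda>t. ennreal (1 + t\<^sup>2))) f"
proof -
  have f [measurable]: "f \<in> borel_measurable borel" using L2_spaceD(1)[OF v] by simp
  have e: "(1 + t\<^sup>2) * (cmod (f t))\<^sup>2 = (cmod (f t))\<^sup>2 + (cmod (of_real t * f t))\<^sup>2" for t
    by (simp add: norm_mult power_mult_distrib algebra_simps)
  have int: "integrable mu (\<lambda>t. (1 + t\<^sup>2) * (cmod (f t))\<^sup>2)"
    unfolding e by (intro Bochner_Integration.integrable_add L2_spaceD(2) v w)
  then show "f \<in> L2_space (density mu (\<lambda>t. ennreal (1 + t\<^sup>2)))"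
    by (subst L2_space_density) auto
  have "sqn (density mu (\<lambda>t. ennreal (1 + t\<^sup>2))) f = (\<integral>t. (1 + t\<^sup>2) * (cmod (f t))\<^sup>2 \<partial>mu)"
    by (rule sqn_density) auto
  also have "\<dots> = sqn mu f + sqn mu (\<lambda>t. of_real t * f t)"
    unfolding e sqn_def by (intro Bochner_Integration.integral_add L2_spaceD(2) v w)
  finally have s: "sqn (density mu (\<lambda>t. ennreal (1 + t\<^sup>2))) f = sqn mu f + sqn mu (\<lambda>t. of_real t * f t)" .
  show "sqn mu f \<le> sqn (density mu (\<lambda>t. ennreal (1 + t\<^sup>2))) f"
    "sqn mu (\<lambda>t. of_real t * f t) \<le> sqn (density mu (\<lambda>t. ennreal (1 + t\<^sup>2))) f"
    unfolding s using sqn_nonneg by (auto simp: add_increasing add_increasing2)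
qed

text \<open>Density of the polynomials in \<open>L\<^sub>2((1 + t\<^sup>2) \<mu>)\<close> says that the finitely supported sequences are
  a core of \<open>Jt\<close>.\<close>

lemma not_dense_graph_weight:
  assumes "\<not> selfadjoint (jacobi_op q b)"
  shows "\<not> polynomials_dense (density mu (\<lambda>t. ennreal (1 + t\<^sup>2)))"
proof
  let ?M = "density mu (\<lambda>t. ennreal (1 + t\<^sup>2))"
  assume dense: "polynomials_dense ?M"
  have "Jt \<subseteq> jacobi_op q b"
  proof (rule subrelI)
    fix v w assume vw: "(v, w) \<in> Jt"
    obtain f where f: "rep v f" using rep_surj by blast
    have w: "rep w (\<lambda>t. of_real t * f t)" by (rule Jt_rep[OF f vw])
    have "\<exists>x y. (x, y) \<in> jacobi_op0 q b \<and> (norm (x - v))\<^sup>2 \<le> 1 / Suc n \<and> (norm (y - w))\<^sup>2 \<le> 1 / Suc n" for n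
    proof -
      have "1 / real (Suc n) > 0" by simp
      from polynomials_denseD[OF dense L2_graph_weight(1)[OF rep_L2[OF f] rep_L2[OF w]] this]
      obtain p where p: "sqn ?M (\<lambda>t. f t - cpoly p t) < 1 / Suc n" by blast
      obtain x y where x: "rep x (cpoly p)" and y: "rep y (\<lambda>t. of_real t * cpoly p t)"
        and xy: "(x, y) \<in> jacobi_op0 q b" using rep_cpoly_jacobi_op0 by blast
      note vx = rep_diff[OF f x]
      have wy: "rep (w - y) (\<lambda>t. of_real t * (f t - cpoly p t))"
        using rep_diff[OF w y] by (simp add: right_diff_distrib)
      note le = L2_graph_weight(2,3)[OF rep_L2[OF vx] rep_L2[OF wy]]
      show ?thesis
        using xy p le norm_rep[OF vx] norm_rep[OF wy]
        by (intro exI[of _ x] exI[of _ y]) (simp add: norm_minus_commute)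
    qed
    then obtain x y where xy: "\<And>n. (x n, y n) \<in> jacobi_op0 q b"
      "\<And>n. (norm (x n - v))\<^sup>2 \<le> 1 / Suc n" "\<And>n. (norm (y n - w))\<^sup>2 \<le> 1 / Suc n" by metis
    have "x \<longlonglongrightarrow> v" "y \<longlonglongrightarrow> w"
      using tendsto_zero_if_norm_sq_le[OF xy(2)] tendsto_zero_if_norm_sq_le[OF xy(3)] by (simp_all add: LIM_zero_iff)
    then have "(\<lambda>n. (x n, y n)) \<longlonglongrightarrow> (v, w)" by (rule tendsto_Pair)
    then show "(v, w) \<in> jacobi_op q b"
      unfolding jacobi_op_def closure_sequential
      by (intro exI[of _ "\<lambda>n. (x n, y n)"]) (simp add: xy(1))
  qed
  then have "jacobi_op q b = Jt" using jacobi_op_subset by blast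
  then show False using assms sa by simp
qed

text \<open>For m > n the weight (1 + t^2)^(m - n) dominates 1 + t^2, so density at m would descend
  to the graph weight, against \<open>not_dense_graph_weight\<close>.\<close>

lemma ind_nu:
  assumes nsa: "\<not> selfadjoint (jacobi_op q b)" and "n \<ge> 1"
  shows "ind (nu mu n) = enat n"
proof -
  let ?S = "{m. m \<ge> 1 \<and> polynomials_dense (density (nu mu n) (\<lambda>t. ennreal ((1 + t\<^sup>2) ^ m)))}"
  have le: "m \<le> n" if m: "m \<in> ?S" for m
  proof (rule ccontr)
    assume "\<not> m \<le> n"
    have "polynomials_dense (density mu (\<lambda>t. ennreal (1 + t\<^sup>2)))"
    proof (rule polynomials_dense_weight)
      show "polynomials_dense (density mu (\<lambda>t. ennreal ((1 + t\<^sup>2) ^ m * wt n t)))"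
        using m by (simp add: density_nu)
      show "1 + t\<^sup>2 \<le> C_const mu n * ((1 + t\<^sup>2) ^ m * wt n t)" for t
      proof -
        have "(1 + t\<^sup>2) ^ m = (1 + t\<^sup>2) ^ (m - n) * (1 + t\<^sup>2) ^ n"
          using \<open>\<not> m \<le> n\<close> by (simp add: power_add[symmetric])
        then have "C_const mu n * ((1 + t\<^sup>2) ^ m * wt n t) = (1 + t\<^sup>2) ^ (m - n)"
          using C_pos[of n] one_plus_sq_pos(1)[of t] by (simp add: wt_def)
        moreover have "(1 + t\<^sup>2) ^ 1 \<le> (1 + t\<^sup>2) ^ (m - n)"
          using \<open>\<not> m \<le> n\<close> one_plus_sq_pos(2) by (intro power_increasing) auto
        ultimately show ?thesis by simp
      qed
      show "continuous_on UNIV (\<lambda>t. (1 + t\<^sup>2) ^ m * wt n t)"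
        by (intro continuous_intros continuous_wt)
      show "0 < (1 + t\<^sup>2) ^ m * wt n t" for t
        using wt_pos one_plus_sq_pos(1)[of t] by simp
    qed (auto intro!: continuous_intros one_plus_sq_pos)
    then show False using not_dense_graph_weight[OF nsa] by simp
  qed
  have "n \<in> ?S" using \<open>n \<ge> 1\<close> dense_density_nu by simp
  then have "enat n \<le> Sup (enat ` ?S)" by (intro Sup_upper) auto
  moreover have "Sup (enat ` ?S) \<le> enat n" using le by (intro Sup_least) auto
  ultimately show ?thesis unfolding ind_def by simp
qed

section \<open>Moments, determinacy and support of \<open>nu mu n\<close>\<close>

lemma integrable_nu_iff:
  fixes g :: "real \<Rightarrow> real"
  assumes "g \<in> borel_measurable borel"
  shows "integrable (nu mu n) g \<longleftrightarrow> integrable mu (\<lambda>t. wt n t * g t)"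
  unfolding nu_eq using assms wt_pos[THEN less_imp_le] by (intro integrable_real_density) auto

lemma integral_nu:
  fixes g :: "real \<Rightarrow> real"
  assumes "g \<in> borel_measurable borel"
  shows "(\<integral>t. g t \<partial>nu mu n) = (\<integral>t. wt n t * g t \<partial>mu)"
  unfolding nu_eq using assms wt_pos[THEN less_imp_le] by (intro integral_real_density) auto

lemma wt_le: "wt n t \<le> 1 / C_const mu n"
  unfolding wt_def using C_pos[of n] inv_weight_le[of t n]
  by (intro mult_left_le) (auto simp: less_imp_le)

lemma hamburger_nu: "hamburger_solution (nu mu n)"
  unfolding hamburger_solution_def
proof (intro conjI allI)
  show "sets (nu mu n) = sets borel" by (simp add: nu_eq)
  fix k
  have "integrable mu (\<lambda>t. wt n t * t ^ k)"
  proof (rule Bochner_Integration.integrable_bound)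
    show "integrable mu (\<lambda>t. 1 / C_const mu n * t ^ k)"
      by (intro integrable_mult_right mom.moment)
    have "\<bar>wt n t * t ^ k\<bar> \<le> \<bar>1 / C_const mu n * t ^ k\<bar>" for t
      unfolding abs_mult using wt_le[of n t] wt_pos[of n t] C_pos[of n] by (intro mult_right_mono) auto
    then show "AE t in mu. norm (wt n t * t ^ k) \<le> norm (1 / C_const mu n * t ^ k)" by simp
  qed measurable
  then show "integrable (nu mu n) (\<lambda>t. t ^ k)" by (subst integrable_nu_iff) auto
qed

lemma prob_space_nu: "prob_space (nu mu n)"
proof (rule prob_spaceI)
  have int: "integrable mu (wt n)"
    unfolding wt_def by (intro integrable_mult_right inv_weight_integrable)
  have "emeasure (nu mu n) (space (nu mu n)) = (\<integral>\<^sup>+ t. ennreal (wt n t) \<partial>mu)"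
    by (simp add: nu_eq emeasure_density cong: nn_integral_cong)
  also have "\<dots> = ennreal (\<integral>t. wt n t \<partial>mu)"
    using int wt_pos[THEN less_imp_le] by (intro nn_integral_eq_integral) auto
  also have "(\<integral>t. wt n t \<partial>mu) = 1"
  proof -
    have "(\<integral>t. wt n t \<partial>mu) = 1 / C_const mu n * C_const mu n"
      by (simp only: wt_def integral_mult_right_zero C_const_def[symmetric])
    then show ?thesis using C_pos[of n] by simp
  qed
  finally show "emeasure (nu mu n) (space (nu mu n)) = 1" by simp
qed

text \<open>The condition n >= 1 brings m = 1 into the range of
  \<open>dense_density_nu\<close>.\<close>

lemma determinate_nu: "n \<ge> 1 \<Longrightarrow> determinate (nu mu n)"
  using dense_density_nu[of 1 n] hamburger_nu prob_space_nu by (intro determinate_if_dense) auto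

sublocale nu_mom: all_moments "nu mu n" for n
  by standard (use hamburger_nu in \<open>simp add: hamburger_solution_def\<close>)

lemma poly_measurable: "poly p \<in> borel_measurable borel" for p :: "real poly"
  by (intro borel_measurable_continuous_onI continuous_intros)

lemma poly_inner_nu: "poly_inner (nu mu n) p r = (\<integral>t. wt n t * (poly p t * poly r t) \<partial>mu)"
  unfolding poly_inner_def using poly_measurable by (intro integral_nu) measurable

text \<open>The weight is positive, so a polynomial of norm zero vanishes \<open>mu\<close>-almost
  everywhere. Its coefficients with respect to \<open>pp\<close> are then zero, and so is the
  polynomial.\<close>

lemma poly_inner_nu_pos:
  assumes "p \<noteq> 0"
  shows "poly_inner (nu mu n) p p > 0"
proof -
  have int: "integrable mu (\<lambda>t. wt n t * (poly p t * poly p t))"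
    using nu_mom.integrable_poly_mult[of n p p] poly_measurable by (subst (asm) integrable_nu_iff) auto
  have nonneg: "AE t in mu. 0 \<le> wt n t * (poly p t * poly p t)"
    using wt_pos[THEN less_imp_le] by simp
  have "poly_inner (nu mu n) p p \<noteq> 0"
  proof
    assume "poly_inner (nu mu n) p p = 0"
    then have "AE t in mu. wt n t * (poly p t * poly p t) = 0"
      using integral_nonneg_eq_0_iff_AE[OF int nonneg] by (simp add: poly_inner_nu)
    then have AE: "AE t in mu. poly p t = 0"
      by eventually_elim (use wt_pos[of n] in \<open>auto simp: less_le\<close>)
    let ?d = "degree p"
    have "poly_inner mu (pp k) p = (\<integral>t. 0 \<partial>mu)" for k
      unfolding poly_inner_def using AE poly_measurable
      by (intro integral_cong_AE) (auto elim!: eventually_mono)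
    then have "poly_inner mu (pp k) p = 0" for k by simp
    then have "p = 0"
      using mom.orthonormal_polys_expansion[OF orthonormal_pp, of "Suc ?d" p] by (simp add: coeff_eq_0)
    then show False using assms by simp
  qed
  moreover have "poly_inner (nu mu n) p p \<ge> 0"
    unfolding poly_inner_nu by (rule integral_nonneg_AE[OF nonneg])
  ultimately show ?thesis by simp
qed

lemma infinite_support_nu: "infinite (measure_support (nu mu n))"
  by (rule infinite_measure_support) (use poly_inner_nu_pos in \<open>auto simp: nu_eq\<close>)

lemma gram_schmidt_nu: "orthonormal_polys (nu mu n) (gram_schmidt (nu mu n))"
  by (rule nu_mom.gram_schmidt_orthonormal[OF poly_inner_nu_pos])

section \<open>Transport by the prefactor, and the core spanned by the
  \<open>omega mu n k\<close>\<close>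

definition pre :: "nat \<Rightarrow> real \<Rightarrow> complex" where
  "pre n t = 1 / (of_real (sqrt (C_const mu n)) * (of_real t - \<i>) ^ n)"

lemma f_fun_eq: "f_fun mu n k = (\<lambda>t. pre n t * rpoly (gram_schmidt (nu mu n) k) t)"
  by (simp add: f_fun_def pre_def fun_eq_iff)

lemma pre_sq: "(cmod (pre n t))\<^sup>2 = wt n t"
proof -
  have "(cmod (of_real t - \<i>))\<^sup>2 = 1 + t\<^sup>2" unfolding cmod_power2 by simp
  then have "(cmod ((of_real t - \<i>) ^ n))\<^sup>2 = (1 + t\<^sup>2) ^ n"
    by (metis norm_power power_mult mult.commute)
  then show ?thesis
    using C_pos[of n] by (simp add: pre_def wt_def norm_divide norm_mult power_divide power_mult_distrib)
qed

lemma cnj_pre_mult: "cnj (pre n t) * pre n t = of_real (wt n t)"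
  unfolding pre_sq[symmetric] complex_norm_square by (rule mult.commute)

lemma pre_nonzero: "pre n t \<noteq> 0"
  using pre_sq[of n t] wt_pos[of n t] by auto

lemma pre_le: "cmod (pre n t) \<le> sqrt (1 / C_const mu n)"
  by (rule real_le_rsqrt) (simp only: pre_sq wt_le)

lemma pre_measurable [measurable]: "pre n \<in> borel_measurable borel"
  unfolding pre_def by measurable

lemma pre_mult_L2: "f \<in> L2_space mu \<Longrightarrow> (\<lambda>t. pre n t * f t) \<in> L2_space mu"
proof -
  assume f: "f \<in> L2_space mu"
  note L2_spaceD(1)[OF f, measurable]
  have "cmod (pre n t * f t) \<le> sqrt (1 / C_const mu n) * cmod (f t)" for t
    unfolding norm_mult by (intro mult_right_mono pre_le) simp
  then show ?thesis by (intro L2_space_bound[OF f]) measurable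
qed

lemma rpoly_L2: "rpoly p \<in> L2_space mu"
  using cpoly_L2_mu[of "map_poly of_real p"] by (simp add: poly_map_of_real)

lemma rep_omega: "rep (omega mu n k) (\<lambda>t. pre n t * rpoly (gram_schmidt (nu mu n) k) t)"
  unfolding omega_def f_fun_eq by (intro U_map_L2 pre_mult_L2 rpoly_L2)

text \<open>Anticipates the image of \<open>omega mu n k\<close> under \<open>Jt\<close>, confirmed
  in \<open>op_app_omega\<close>: t passes through the prefactor onto the polynomial.\<close>

definition Jomega :: "nat \<Rightarrow> nat \<Rightarrow> ell2" where
  "Jomega n k = U_map mu (\<lambda>t. pre n t * rpoly ([:0, 1:] * gram_schmidt (nu mu n) k) t)"

lemma rep_Jomega: "rep (Jomega n k) (\<lambda>t. pre n t * rpoly ([:0, 1:] * gram_schmidt (nu mu n) k) t)"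
  unfolding Jomega_def by (intro U_map_L2 pre_mult_L2 rpoly_L2)

lemma omega_in_Jt: "(omega mu n k, Jomega n k) \<in> Jt"
  using rep_Jomega[of n k] by (intro Jt_rep_iff[OF rep_omega]) (simp add: mult_ac)

lemma op_app_omega: "op_app Jt (omega mu n k) = Jomega n k"
  unfolding op_app_def using omega_in_Jt Jt_unique by (intro the_equality) blast+

lemma cinner_pre:
  assumes "rep x (\<lambda>t. pre n t * rpoly p t)" "rep y (\<lambda>t. pre n t * rpoly r t)"
  shows "cinner x y = of_real (poly_inner (nu mu n) p r)"
proof -
  have "cinner x y = (\<integral>t. cnj (pre n t * rpoly p t) * (pre n t * rpoly r t) \<partial>mu)"
    by (rule cinner_rep[OF assms])
  also have "\<dots> = (\<integral>t. complex_of_real (wt n t * (poly p t * poly r t)) \<partial>mu)"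
  proof (intro Bochner_Integration.integral_cong refl)
    fix t
    have "cnj (pre n t * rpoly p t) * (pre n t * rpoly r t) = (cnj (pre n t) * pre n t) * (rpoly p t * rpoly r t)"
      by (simp add: mult_ac)
    then show "cnj (pre n t * rpoly p t) * (pre n t * rpoly r t) = complex_of_real (wt n t * (poly p t * poly r t))"
      by (simp add: cnj_pre_mult)
  qed
  also have "\<dots> = of_real (poly_inner (nu mu n) p r)"
    unfolding poly_inner_nu by (rule integral_complex_of_real)
  finally show ?thesis .
qed

text \<open>Division by \<open>pre n\<close> maps f into L2 of (1 + t^2) \<open>nu mu n\<close>,
  isometrically for the graph norm. Polynomials are dense there because n >= 1, and multiplying an
  approximant back by \<open>pre n\<close> gives a combination of the \<open>omega mu n k\<close>
  close to v in graph norm.\<close>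

lemma core_approximation:
  assumes "n \<ge> 1" and vw: "(v, w) \<in> Jt" and "e > 0"
  shows "\<exists>m c. (norm (v - (\<Sum>k<m. c k *\<^sub>C omega mu n k)))\<^sup>2 < e \<and> (norm (w - (\<Sum>k<m. c k *\<^sub>C Jomega n k)))\<^sup>2 < e"
proof -
  let ?R = "gram_schmidt (nu mu n)"
  let ?M = "density mu (\<lambda>t. ennreal ((1 + t\<^sup>2) ^ 1 * wt n t))"
  let ?N = "density mu (\<lambda>t. ennreal (1 + t\<^sup>2))"
  have dense: "polynomials_dense ?M" using dense_density_nu[of 1 n] assms(1) by (simp only: density_nu)
  obtain f where f: "rep v f" using rep_surj by blast
  have w: "rep w (\<lambda>t. of_real t * f t)" by (rule Jt_rep[OF f vw])
  have fm [measurable]: "f \<in> borel_measurable borel" using L2_spaceD(1)[OF rep_L2[OF f]] by simp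
  have W: "(\<lambda>t. (1 + t\<^sup>2) ^ 1 * wt n t) \<in> borel_measurable borel" "0 \<le> (1 + t\<^sup>2) ^ 1 * wt n t"
    "(\<lambda>t::real. 1 + t\<^sup>2) \<in> borel_measurable borel" "0 \<le> 1 + t\<^sup>2" for t :: real
    using wt_pos[of n t, THEN less_imp_le] one_plus_sq_pos(1)[of t, THEN less_imp_le] by auto
  note L2M = L2_space_density[OF sets_scalar_measure W(1,2)] and sqnM = sqn_density[OF sets_scalar_measure W(1,2)]
  note L2N = L2_space_density[OF sets_scalar_measure W(3,4)] and sqnN = sqn_density[OF sets_scalar_measure W(3,4)]
  \<comment> \<open>The weight \<open>wt n\<close> is |\<open>pre n\<close>|^2 and cancels, leaving
    the graph weight.\<close>
  have e1: "(1 + t\<^sup>2) ^ 1 * wt n t * (cmod (g t / pre n t))\<^sup>2 = (1 + t\<^sup>2) * (cmod (g t))\<^sup>2" for g t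
    unfolding pre_sq[symmetric] using pre_nonzero[of n t] by (simp add: norm_divide power_divide)
  have "f \<in> L2_space ?N" by (rule L2_graph_weight(1)[OF rep_L2[OF f] rep_L2[OF w]])
  then have "(\<lambda>t. f t / pre n t) \<in> L2_space ?M"
    unfolding L2M L2N e1 by auto
  from polynomials_denseD[OF dense this \<open>e > 0\<close>]
  obtain p where p: "sqn ?M (\<lambda>t. f t / pre n t - cpoly p t) < e" by blast
  have pm: "cpoly p \<in> borel_measurable borel"
    by (intro borel_measurable_continuous_onI continuous_intros)
  note pm [measurable]
  have "sqn ?M (\<lambda>t. f t / pre n t - cpoly p t) = sqn ?M (\<lambda>t. (f t - pre n t * cpoly p t) / pre n t)"
    using pre_nonzero by (simp add: diff_divide_distrib)
  also have "\<dots> = (\<integral>t. (1 + t\<^sup>2) ^ 1 * wt n t * (cmod ((f t - pre n t * cpoly p t) / pre n t))\<^sup>2 \<partial>mu)"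
    by (rule sqnM) measurable
  also have "\<dots> = (\<integral>t. (1 + t\<^sup>2) * (cmod (f t - pre n t * cpoly p t))\<^sup>2 \<partial>mu)"
    by (simp only: e1[where g = "\<lambda>t. f t - pre n t * cpoly p t"])
  also have "\<dots> = sqn ?N (\<lambda>t. f t - pre n t * cpoly p t)"
    by (rule sqnN[symmetric]) measurable
  finally have small: "sqn ?N (\<lambda>t. f t - pre n t * cpoly p t) < e" using p by simp
  note Rp = gram_schmidt_nu[of n, unfolded orthonormal_polys_def]
  have "\<exists>m c. cpoly p = (\<lambda>t. \<Sum>k<m. c k * rpoly (?R k) t)"
    using Rp by (intro cpoly_span) (auto simp: less_imp_neq[THEN not_sym])
  then obtain m c where c: "cpoly p = (\<lambda>t. \<Sum>k<m. c k * rpoly (?R k) t)" by blast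
  let ?x = "\<Sum>k<m. c k *\<^sub>C omega mu n k" and ?y = "\<Sum>k<m. c k *\<^sub>C Jomega n k"
  have "rep ?x (\<lambda>t. \<Sum>k<m. c k * (pre n t * rpoly (?R k) t))"
    by (intro rep_sum rep_scale rep_omega)
  then have x: "rep ?x (\<lambda>t. pre n t * cpoly p t)"
    by (simp add: fun_cong[OF c] sum_distrib_left mult_ac)
  have "rep ?y (\<lambda>t. \<Sum>k<m. c k * (pre n t * rpoly ([:0, 1:] * ?R k) t))"
    by (intro rep_sum rep_scale rep_Jomega)
  then have y: "rep ?y (\<lambda>t. of_real t * (pre n t * cpoly p t))"
    by (simp add: fun_cong[OF c] sum_distrib_left mult_ac)
  note vx = rep_diff[OF f x]
  have wy: "rep (w - ?y) (\<lambda>t. of_real t * (f t - pre n t * cpoly p t))"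
    using rep_diff[OF w y] by (simp add: right_diff_distrib)
  note le = L2_graph_weight(2,3)[OF rep_L2[OF vx] rep_L2[OF wy]]
  show ?thesis
    using le small norm_rep[OF vx] norm_rep[OF wy] by (intro exI[of _ m] exI[of _ c]) simp
qed

lemma core_sequence:
  assumes "n \<ge> 1" and "(v, w) \<in> Jt"
  shows "\<exists>m c. (\<lambda>j. \<Sum>k<m j. c j k *\<^sub>C omega mu n k) \<longlonglongrightarrow> v \<and> (\<lambda>j. \<Sum>k<m j. c j k *\<^sub>C Jomega n k) \<longlonglongrightarrow> w"
proof -
  have "\<forall>j. \<exists>m c. (norm (v - (\<Sum>k<m. c k *\<^sub>C omega mu n k)))\<^sup>2 < 1 / Suc j
      \<and> (norm (w - (\<Sum>k<m. c k *\<^sub>C Jomega n k)))\<^sup>2 < 1 / Suc j"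
    by (intro allI core_approximation[OF assms]) simp
  then obtain m c where mc: "\<And>j. (norm (v - (\<Sum>k<m j. c j k *\<^sub>C omega mu n k)))\<^sup>2 < 1 / Suc j"
      "\<And>j. (norm (w - (\<Sum>k<m j. c j k *\<^sub>C Jomega n k)))\<^sup>2 < 1 / Suc j"
    unfolding choice_iff by blast
  have lim: "s \<longlonglongrightarrow> z" if "\<And>j. (norm (z - s j))\<^sup>2 < 1 / Suc j" for s and z :: ell2
  proof -
    have "(\<lambda>j. s j - z) \<longlonglongrightarrow> 0"
      by (rule tendsto_zero_if_norm_sq_le) (use that in \<open>simp add: norm_minus_commute less_imp_le\<close>)
    then show ?thesis by (simp add: LIM_zero_iff)
  qed
  show ?thesis
    by (rule exI[of _ m], rule exI[of _ c]) (use lim[OF mc(1)] lim[OF mc(2)] in blast)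
qed

text \<open>Orthonormality is inherited from the polynomials; totality comes from the core property
  and the density of the domain of \<open>Jt\<close>.\<close>

lemma orthonormal_basis_omega:
  assumes "n \<ge> 1"
  shows "orthonormal_basis (omega mu n)"
  unfolding orthonormal_basis_def
proof (intro conjI allI)
  fix j k
  show "cinner (omega mu n j) (omega mu n k) = (if j = k then 1 else 0)"
    using gram_schmidt_nu[of n]
    by (simp add: cinner_pre[OF rep_omega rep_omega] orthonormal_polys_def)
next
  have "Domain Jt \<subseteq> closure (cspan_seq (omega mu n))"
  proof
    fix v assume "v \<in> Domain Jt"
    then obtain m c where lim: "(\<lambda>j. \<Sum>k<m j. c j k *\<^sub>C omega mu n k) \<longlonglongrightarrow> v"
      using core_sequence[OF assms] by blast
    have "(\<Sum>k<m j. c j k *\<^sub>C omega mu n k) \<in> cspan_seq (omega mu n)" for j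
      by (auto simp: cspan_seq_def)
    with lim show "v \<in> closure (cspan_seq (omega mu n))"
      unfolding closure_sequential by (intro exI[of _ "\<lambda>j. \<Sum>k<m j. c j k *\<^sub>C omega mu n k"]) simp
  qed
  then have "closure (Domain Jt) \<subseteq> closure (cspan_seq (omega mu n))"
    by (rule closure_minimal) simp
  then show "closure (cspan_seq (omega mu n)) = UNIV"
    using sa by (auto simp: selfadjoint_def)
qed

text \<open>A linear \<open>B\<close> agreeing with \<open>Jt\<close> on the
  \<open>omega mu n k\<close> agrees on their span, and \<open>core_sequence\<close> reaches every
  pair of \<open>Jt\<close> from there by a limit of graph points, which closedness retains.\<close>

lemma basis_omega:
  assumes n: "n \<ge> 1"
  shows "basis_of_representation Jt (omega mu n)"
  unfolding basis_of_representation_def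
proof (intro conjI allI impI)
  show "closed_operator Jt" using sa by (rule selfadjoint_closed_operator)
  show "orthonormal_basis (omega mu n)" using n by (rule orthonormal_basis_omega)
  show "omega mu n k \<in> Domain Jt" for k using omega_in_Jt by blast
next
  fix B assume B: "closed_operator B"
    and eq: "\<forall>k. omega mu n k \<in> Domain B \<and> op_app B (omega mu n k) = op_app Jt (omega mu n k)"
  have lin: "(0, 0) \<in> B" "\<And>x y x' y'. (x, y) \<in> B \<Longrightarrow> (x', y') \<in> B \<Longrightarrow> (x + x', y + y') \<in> B"
    "\<And>c x y. (x, y) \<in> B \<Longrightarrow> (c *\<^sub>C x, c *\<^sub>C y) \<in> B" and sv: "single_valued B" and cl: "closed B"
    using B by (simp_all add: closed_operator_def linear_operator_def)
  \<comment> \<open>\<open>op_app\<close> is a definite description; single-valuedness of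
    \<open>B\<close> turns equality of values into membership in the graph.\<close>
  have mem: "(omega mu n k, Jomega n k) \<in> B" for k
  proof -
    obtain y where y: "(omega mu n k, y) \<in> B" using eq by blast
    then have "op_app B (omega mu n k) = y"
      unfolding op_app_def using sv by (intro the_equality) (auto dest: single_valuedD)
    then show ?thesis using y eq by (simp add: op_app_omega)
  qed
  have sum: "(\<Sum>k<m. c k *\<^sub>C omega mu n k, \<Sum>k<m. c k *\<^sub>C Jomega n k) \<in> B" for m c
    by (induction m) (auto intro: lin mem)
  show "Jt \<subseteq> B"
  proof (rule subrelI)
    fix v w assume "(v, w) \<in> Jt"
    from core_sequence[OF n this] obtain m c
      where "(\<lambda>j. \<Sum>k<m j. c j k *\<^sub>C omega mu n k) \<longlonglongrightarrow> v" "(\<lambda>j. \<Sum>k<m j. c j k *\<^sub>C Jomega n k) \<longlonglongrightarrow> w"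
      by blast
    then have lim: "(\<lambda>j. (\<Sum>k<m j. c j k *\<^sub>C omega mu n k, \<Sum>k<m j. c j k *\<^sub>C Jomega n k)) \<longlonglongrightarrow> (v, w)"
      by (rule tendsto_Pair)
    show "(v, w) \<in> B" by (rule closed_sequentially[OF cl _ lim]) (rule sum)
  qed
qed

text \<open>By \<open>cinner_pre\<close> the entries are those of multiplication by t on the
  orthonormal polynomials of \<open>nu mu n\<close>.\<close>

lemma matrix_omega:
  "\<exists>q' b'. (\<forall>k. b' k > 0) \<and> three_term_recurrence (gram_schmidt (nu mu n)) q' b' \<and>
     matrix_representation Jt (omega mu n) = jacobi_matrix q' b'"
proof (intro exI conjI allI)
  let ?R = "gram_schmidt (nu mu n)"
  let ?q = "nu_mom.rec_q n ?R" and ?b = "nu_mom.rec_b n ?R"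
  show "?b k > 0" for k by (rule nu_mom.rec_b_pos[OF gram_schmidt_nu])
  show "three_term_recurrence ?R ?q ?b" by (rule nu_mom.three_term[OF gram_schmidt_nu])
  show "matrix_representation Jt (omega mu n) = jacobi_matrix ?q ?b"
  proof (intro ext)
    fix i j
    have "matrix_representation Jt (omega mu n) i j = of_real (poly_inner (nu mu n) (?R i) ([:0, 1:] * ?R j))"
      unfolding matrix_representation_def op_app_omega by (rule cinner_pre[OF rep_omega rep_Jomega])
    then show "matrix_representation Jt (omega mu n) i j = jacobi_matrix ?q ?b i j"
      unfolding nu_mom.poly_inner_recurrence[OF gram_schmidt_nu] jacobi_matrix_def by simp
  qed
qed

end

text \<open>Determinacy and infinite support accompany the index because \<open>ind\<close> is
  meaningful for such measures. The modification asked for in (iii) is the exponent n of t - i in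
  \<open>f_fun\<close>.\<close>

theorem mainTheorem5:
  fixes q b :: "nat \<Rightarrow> real"
    and Jt :: operator
    and E :: "real set \<Rightarrow> ell2 \<Rightarrow> ell2"
    and \<mu> :: "real measure"
  assumes "\<And>k. b k > 0"
    and "\<not> selfadjoint (jacobi_op q b)"
    and "canonical_selfadjoint_extension (jacobi_op q b) Jt"
    and "is_spectral_measure Jt E"
    and "\<mu> = scalar_measure E (delta 0)"
  shows "(\<forall>n\<ge>1. determinate (nu \<mu> n) \<and> infinite (measure_support (nu \<mu> n)) \<and>
                ind (nu \<mu> n) = enat n)
       \<and> (basis_of_representation Jt (omega \<mu> 1) \<and>
          (\<exists>q' b'. (\<forall>k. b' k > 0) \<and>
             three_term_recurrence (gram_schmidt (nu \<mu> 1)) q' b' \<and>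
             matrix_representation Jt (omega \<mu> 1) = jacobi_matrix q' b'))
       \<and> (\<forall>n\<ge>1. basis_of_representation Jt (omega \<mu> n) \<and>
             (\<exists>q' b'. (\<forall>k. b' k > 0) \<and>
                matrix_representation Jt (omega \<mu> n) = jacobi_matrix q' b'))"
proof -
  interpret jacobi_extension E Jt q b
  proof
    show "projection_valued_measure E" using assms(4) by (simp add: is_spectral_measure_def)
    show "selfadjoint Jt" "Jt \<subseteq> adjoint_op (jacobi_op q b)"
      using assms(3) by (simp_all add: canonical_selfadjoint_extension_def)
  qed (use assms in auto)
  show ?thesis
    unfolding assms(5)
  proof (intro conjI allI impI)
    fix n :: nat assume n: "1 \<le> n"
    show "determinate (nu mu n)" by (rule determinate_nu[OF n])
    show "infinite (measure_support (nu mu n))" by (rule infinite_support_nu)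
    show "ind (nu mu n) = enat n" by (rule ind_nu[OF assms(2) n])
    show "basis_of_representation Jt (omega mu n)" by (rule basis_omega[OF n])
    show "\<exists>q' b'. (\<forall>k. b' k > 0) \<and> matrix_representation Jt (omega mu n) = jacobi_matrix q' b'"
      using matrix_omega by blast
  qed (use basis_omega matrix_omega in auto)
qed

end
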